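(* Let $q\colon E\to M$ be a smooth vector bundle and let $\chi\in\mathfrak{X}^l(E)$ be a linear vector field on $E$ over a vector field $X\in\mathfrak{X}(M)$. Let $\phi\colon\Omega\to M$ be the flow of $X$ on its open flow domain $\Omega\subseteq\mathbb{R}\times M$ containing $\{0\}\times M$. Then the flow $\Phi$ of $\chi$ is defined on \[ \widetilde\Omega:=\{(t,e)\in\mathbb{R}\times E\mid (t,q(e))\in\Omega\}, \] and for each $t\in\mathbb{R}$ the map \[ \Phi_t\colon q^{-1}(M_t)\to q^{-1}(M_{-t}) \] is an isomorphism of vector bundles over the diffeomorphism $\phi_t\colon M_t\to M_{-t}$, where $M_t\subseteq M$ is the open subset $M_t:=\{x\in M\mid (t,x)\in\Omega\}$.
   Context: All manifolds and vector bundles are smooth and real. $\mathfrak{X}(M)$ is the space of smooth vector fields on $M$. "Flow" and "flow domain" mean the maximal flow and its maximal domain: for a vector field $X$ on $M$, $\Omega$ is the set of $(t,x)$ such that the maximal integral curve of $X$ through $x$ at time $0$ is defined at time $t$, and $\phi(t,x)=\phi_t(x)$ is the value of that curve at time $t$. That the flow of $\chi$ "is defined on $\widetilde\Omega$" means that $\widetilde\Omega$ is its maximal flow domain. For a vector bundle $q\colon E\to M$ with addition $+\colon E\times_M E\to E$, the tangent map $Tq\colon TE\to TM$ is again a smooth vector bundle (of twice the rank of $E$), whose fibrewise addition is the tangent map $T{+}\colon T(E\times_ME)=TE\times_{TM}TE\to TE$ and whose scalar multiplication by $\alpha\in\mathbb{R}$ is the tangent map of the scalar multiplication $E\to E$,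 $e\mapsto\alpha e$. A vector field $\chi\colon E\to TE$ is called linear over $X\in\mathfrak{X}(M)$ if $\chi$ is a morphism of vector bundles from $q\colon E\to M$ to $Tq\colon TE\to TM$ over the base map $X\colon M\to TM$. $\mathfrak{X}^l(E)$ is the set of linear vector fields on $E$. *)

theory Defs
  imports "HOL-Analysis.Analysis"
begin

section \<open>Finite-dimensional model spaces\<close>

text \<open>
  The model spaces of manifolds and vector bundles. The library class
  \<^class>\<open>euclidean_space\<close> excludes dimension zero, which would rule out zero-dimensional
  manifolds and bundles of rank zero; this class admits them.
\<close>

class fin_dim_inner = real_inner +
  assumes finite_spanning_set: "\<exists>B::'a set. finite B \<and> (\<forall>x. \<exists>u. x = (\<Sum>b\<in>B. u b *\<^sub>R b))"

instance euclidean_space \<subseteq> fin_dim_inner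
proof
  show "\<exists>B::'a set. finite B \<and> (\<forall>x. \<exists>u. x = (\<Sum>b\<in>B. u b *\<^sub>R b))"
    using finite_Basis euclidean_representation[symmetric] by blast
qed

instance prod :: (fin_dim_inner, fin_dim_inner) fin_dim_inner
proof
  obtain A :: "'a set" where A: "finite A" "\<forall>x. \<exists>u. x = (\<Sum>b\<in>A. u b *\<^sub>R b)"
    using finite_spanning_set by blast
  obtain B :: "'b set" where B: "finite B" "\<forall>x. \<exists>u. x = (\<Sum>b\<in>B. u b *\<^sub>R b)"
    using finite_spanning_set by blast
  let ?C = "(\<lambda>x. (x, 0)) ` A \<union> (\<lambda>y. (0, y)) ` B"
  have A': "UNIV = span A" and B': "UNIV = span B"
    using A B span_finite by (auto simp: span_finite image_iff)
  have lin1: "linear (\<lambda>x::'a. (x, 0::'b))" and lin2: "linear (\<lambda>y::'b. (0::'a, y))"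
    by (auto intro!: linearI)
  have fin: "finite ?C" using A(1) B(1) by auto
  have "z \<in> span ?C" for z
  proof -
    obtain x y where z: "z = (x, y)" by (cases z)
    have "(x, 0::'b) \<in> span ((\<lambda>x. (x, 0)) ` A)" "(0::'a, y) \<in> span ((\<lambda>y. (0, y)) ` B)"
      unfolding linear_span_image[OF lin1] linear_span_image[OF lin2] A'[symmetric] B'[symmetric]
      by auto
    then have "(x, 0) \<in> span ?C" "(0, y) \<in> span ?C"
      by (meson in_mono span_mono sup_ge1 sup_ge2)+
    from span_add[OF this] show ?thesis by (simp add: z)
  qed
  then have "\<exists>u. z = (\<Sum>b\<in>?C. u b *\<^sub>R b)" for z
    using span_finite[OF fin] by (metis (no_types, lifting) imageE)
  with fin show "\<exists>C::('a \<times> 'b) set. finite C \<and> (\<forall>x. \<exists>u. x = (\<Sum>b\<in>C. u b *\<^sub>R b))"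
    by blast
qed

instantiation unit :: real_inner
begin

definition zero_unit :: unit where "zero_unit = ()"
definition plus_unit :: "unit \<Rightarrow> unit \<Rightarrow> unit" where "plus_unit x y = ()"
definition minus_unit :: "unit \<Rightarrow> unit \<Rightarrow> unit" where "minus_unit x y = ()"
definition uminus_unit :: "unit \<Rightarrow> unit" where "uminus_unit x = ()"
definition scaleR_unit :: "real \<Rightarrow> unit \<Rightarrow> unit" where "scaleR_unit r x = ()"
definition sgn_unit :: "unit \<Rightarrow> unit" where "sgn_unit x = ()"
definition norm_unit :: "unit \<Rightarrow> real" where "norm_unit x = 0"
definition dist_unit :: "unit \<Rightarrow> unit \<Rightarrow> real" where "dist_unit x y = 0"
definition inner_unit :: "unit \<Rightarrow> unit \<Rightarrow> real" where "inner_unit x y = 0"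
definition uniformity_unit :: "(unit \<times> unit) filter" where
  "uniformity_unit = (INF e\<in>{0 <..}. principal {(x, y). dist x y < e})"
definition open_unit :: "unit set \<Rightarrow> bool" where
  "open_unit U \<longleftrightarrow> (\<forall>x\<in>U. eventually (\<lambda>(x', y). x' = x \<longrightarrow> y \<in> U) uniformity)"

instance
  by standard
    (simp_all add: norm_unit_def dist_unit_def inner_unit_def uniformity_unit_def open_unit_def)

end

instance unit :: fin_dim_inner
proof
  show "\<exists>B::unit set. finite B \<and> (\<forall>x. \<exists>u. x = (\<Sum>b\<in>B. u b *\<^sub>R b))"
    by (intro exI[of _ "{}"]) auto
qed

section \<open>Smooth maps between model spaces\<close>

text \<open>To be used on open sets \<open>S\<close>. In finite dimension, continuity of all iterated directional
  derivatives amounts to continuity of the iterated total derivatives.\<close>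

fun Ck_on :: "nat \<Rightarrow> 'a::real_normed_vector set \<Rightarrow> ('a \<Rightarrow> 'b::real_normed_vector) \<Rightarrow> bool" where
  "Ck_on 0 S f \<longleftrightarrow> continuous_on S f"
| "Ck_on (Suc k) S f \<longleftrightarrow> (\<forall>x\<in>S. f differentiable (at x)) \<and>
     (\<forall>v. Ck_on k S (\<lambda>x. frechet_derivative f (at x) v))"

definition smooth_on :: "'a::real_normed_vector set \<Rightarrow> ('a \<Rightarrow> 'b::real_normed_vector) \<Rightarrow> bool" where
  "smooth_on S f \<longleftrightarrow> (\<forall>k. Ck_on k S f)"

section \<open>Manifolds\<close>

text \<open>A chart is a pair of its domain and a coordinate map; the values of the coordinate map
  outside the domain are irrelevant. Atlases need not be maximal: an atlas stands for the smooth
  structure it generates.\<close>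

type_synonym ('a, 'm) chart = "'a set \<times> ('a \<Rightarrow> 'm)"

record ('a, 'm) manifold =
  mtop :: "'a topology"
  atlas :: "('a, 'm) chart set"

abbreviation points :: "('a, 'm) manifold \<Rightarrow> 'a set" where
  "points M \<equiv> topspace (mtop M)"

definition chart_inv :: "('a, 'm) chart \<Rightarrow> 'm \<Rightarrow> 'a" where
  "chart_inv c = inv_into (fst c) (snd c)"

definition smooth_manifold :: "('a, 'm::fin_dim_inner) manifold \<Rightarrow> bool" where
  "smooth_manifold M \<longleftrightarrow>
     Hausdorff_space (mtop M) \<and> second_countable (mtop M) \<and>
     (\<forall>p\<in>points M. \<exists>c\<in>atlas M. p \<in> fst c) \<and>
     (\<forall>c\<in>atlas M. openin (mtop M) (fst c) \<and> open (snd c ` fst c) \<and>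
        homeomorphic_map (subtopology (mtop M) (fst c)) (top_of_set (snd c ` fst c)) (snd c)) \<and>
     (\<forall>c\<in>atlas M. \<forall>d\<in>atlas M. smooth_on (snd c ` (fst c \<inter> fst d)) (snd d \<circ> chart_inv c))"

definition smooth_map ::
  "('a, 'm::fin_dim_inner) manifold \<Rightarrow> ('b, 'n::fin_dim_inner) manifold \<Rightarrow> ('a \<Rightarrow> 'b) \<Rightarrow> bool" where
  "smooth_map M N f \<longleftrightarrow>
     continuous_map (mtop M) (mtop N) f \<and>
     (\<forall>c\<in>atlas M. \<forall>d\<in>atlas N.
        smooth_on (snd c ` {p\<in>fst c. f p \<in> fst d}) (snd d \<circ> f \<circ> chart_inv c))"

definition diffeomorphism ::
  "('a, 'm::fin_dim_inner) manifold \<Rightarrow> ('b, 'n::fin_dim_inner) manifold \<Rightarrow> ('a \<Rightarrow> 'b) \<Rightarrow> bool" where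
  "diffeomorphism M N f \<longleftrightarrow>
     smooth_map M N f \<and>
     (\<exists>g. smooth_map N M g \<and> (\<forall>p\<in>points M. g (f p) = p) \<and> (\<forall>p\<in>points N. f (g p) = p))"

definition open_submanifold :: "('a, 'm) manifold \<Rightarrow> 'a set \<Rightarrow> ('a, 'm) manifold" where
  "open_submanifold M W =
     \<lparr>mtop = subtopology (mtop M) W, atlas = (\<lambda>(U, c). (U \<inter> W, c)) ` atlas M\<rparr>"

definition prod_manifold :: "('a, 'm) manifold \<Rightarrow> ('b, 'n) manifold \<Rightarrow> ('a \<times> 'b, 'm \<times> 'n) manifold" where
  "prod_manifold M N =
     \<lparr>mtop = prod_topology (mtop M) (mtop N),
      atlas = {(U \<times> V, map_prod c d) | U c V d. (U, c) \<in> atlas M \<and> (V, d) \<in> atlas N}\<rparr>"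

definition model_manifold :: "('m::fin_dim_inner, 'm) manifold" where
  "model_manifold = \<lparr>mtop = euclidean, atlas = {(UNIV, id)}\<rparr>"

section \<open>Tangent bundles and tangent maps\<close>

text \<open>A tangent vector at \<open>p\<close> is given by its components in all charts around \<open>p\<close>, subject to the
  usual transformation rule. The value \<open>0\<close> at all other arguments is only there to make the
  representation unique.\<close>

type_synonym ('a, 'm) tangent = "'a \<times> (('a, 'm) chart \<Rightarrow> 'm)"

definition tangent_vectors :: "('a, 'm::fin_dim_inner) manifold \<Rightarrow> ('a, 'm) tangent set" where
  "tangent_vectors M =
     {(p, v). p \<in> points M \<and>
        (\<forall>c. \<not> (c \<in> atlas M \<and> p \<in> fst c) \<longrightarrow> v c = 0) \<and>
        (\<forall>c\<in>atlas M. \<forall>d\<in>atlas M. p \<in> fst c \<and> p \<in> fst d \<longrightarrow>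
           v d = frechet_derivative (snd d \<circ> chart_inv c) (at (snd c p)) (v c))}"

definition tangent_chart ::
  "('a, 'm::fin_dim_inner) manifold \<Rightarrow> ('a, 'm) chart \<Rightarrow> (('a, 'm) tangent, 'm \<times> 'm) chart" where
  "tangent_chart M c =
     ({\<xi> \<in> tangent_vectors M. fst \<xi> \<in> fst c}, \<lambda>\<xi>. (snd c (fst \<xi>), snd \<xi> c))"

definition tangent_bundle ::
  "('a, 'm::fin_dim_inner) manifold \<Rightarrow> (('a, 'm) tangent, 'm \<times> 'm) manifold" where
  "tangent_bundle M =
     \<lparr>mtop = topology_generated_by
        {{\<xi> \<in> fst (tangent_chart M c). snd (tangent_chart M c) \<xi> \<in> G} | c G. c \<in> atlas M \<and> open G},
      atlas = tangent_chart M ` atlas M\<rparr>"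

text \<open>The components are computed in some chart around the base point; by the chain rule the
  choice does not matter if \<open>f\<close> is smooth near that point and the argument is a tangent vector.\<close>

definition tangent_map ::
  "('a, 'm::fin_dim_inner) manifold \<Rightarrow> ('b, 'n::fin_dim_inner) manifold \<Rightarrow> ('a \<Rightarrow> 'b) \<Rightarrow>
     ('a, 'm) tangent \<Rightarrow> ('b, 'n) tangent" where
  "tangent_map M N f \<xi> =
     (let p = fst \<xi>; c = (SOME c. c \<in> atlas M \<and> p \<in> fst c)
      in (f p, \<lambda>d. if d \<in> atlas N \<and> f p \<in> fst d
                   then frechet_derivative (snd d \<circ> f \<circ> chart_inv c) (at (snd c p)) (snd \<xi> c)
                   else 0))"

definition vector_field :: "('a, 'm::fin_dim_inner) manifold \<Rightarrow> ('a \<Rightarrow> ('a, 'm) tangent) \<Rightarrow> bool" where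
  "vector_field M X \<longleftrightarrow> smooth_map M (tangent_bundle M) X \<and> (\<forall>p\<in>points M. fst (X p) = p)"

section \<open>Integral curves and flows\<close>

definition integral_curve ::
  "('a, 'm::fin_dim_inner) manifold \<Rightarrow> ('a \<Rightarrow> ('a, 'm) tangent) \<Rightarrow> 'a \<Rightarrow> real set \<Rightarrow> (real \<Rightarrow> 'a) \<Rightarrow> bool" where
  "integral_curve M X x J \<gamma> \<longleftrightarrow>
     open J \<and> is_interval J \<and> 0 \<in> J \<and> \<gamma> 0 = x \<and>
     continuous_map (top_of_set J) (mtop M) \<gamma> \<and>
     (\<forall>t\<in>J. \<forall>c\<in>atlas M. \<gamma> t \<in> fst c \<longrightarrow>
        ((snd c \<circ> \<gamma>) has_vector_derivative snd (X (\<gamma> t)) c) (at t))"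

definition maximal_integral_curve ::
  "('a, 'm::fin_dim_inner) manifold \<Rightarrow> ('a \<Rightarrow> ('a, 'm) tangent) \<Rightarrow> 'a \<Rightarrow> real set \<Rightarrow> (real \<Rightarrow> 'a) \<Rightarrow> bool" where
  "maximal_integral_curve M X x J \<gamma> \<longleftrightarrow>
     integral_curve M X x J \<gamma> \<and>
     \<not> (\<exists>J' \<gamma>'. integral_curve M X x J' \<gamma>' \<and> J \<subset> J' \<and> (\<forall>t\<in>J. \<gamma>' t = \<gamma> t))"

definition flow_domain ::
  "('a, 'm::fin_dim_inner) manifold \<Rightarrow> ('a \<Rightarrow> ('a, 'm) tangent) \<Rightarrow> (real \<times> 'a) set" where
  "flow_domain M X =
     {(t, x). x \<in> points M \<and> (\<exists>J \<gamma>. maximal_integral_curve M X x J \<gamma> \<and> t \<in> J)}"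

definition flow ::
  "('a, 'm::fin_dim_inner) manifold \<Rightarrow> ('a \<Rightarrow> ('a, 'm) tangent) \<Rightarrow> real \<Rightarrow> 'a \<Rightarrow> 'a" where
  "flow M X t x = (THE y. \<exists>J \<gamma>. maximal_integral_curve M X x J \<gamma> \<and> t \<in> J \<and> y = \<gamma> t)"

section \<open>Vector bundles\<close>

text \<open>The last field is a bundle atlas: a pair \<open>(U, \<psi>)\<close> stands for the local trivialization
  \<open>e \<mapsto> (proj e, \<psi> e)\<close> from the part of the bundle over \<open>U\<close> to \<open>U \<times> 'f\<close>. Like the atlas of a
  manifold it need not be maximal.\<close>

record ('b, 'e, 'a, 'm, 'f) vbundle =
  tot :: "('b, 'e) manifold"
  base :: "('a, 'm) manifold"
  proj :: "'b \<Rightarrow> 'a"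
  vadd :: "'b \<Rightarrow> 'b \<Rightarrow> 'b"
  vscale :: "real \<Rightarrow> 'b \<Rightarrow> 'b"
  trivs :: "('a set \<times> ('b \<Rightarrow> 'f)) set"

definition over :: "('b, 'e, 'a, 'm, 'f) vbundle \<Rightarrow> 'a set \<Rightarrow> 'b set" where
  "over E U = {e \<in> points (tot E). proj E e \<in> U}"

text \<open>The vector space axioms for the fibres are not listed: they follow, since a local
  trivialization maps each fibre bijectively and compatibly with both operations onto \<open>'f\<close>.\<close>

definition smooth_vector_bundle ::
  "('b, 'e::fin_dim_inner, 'a, 'm::fin_dim_inner, 'f::fin_dim_inner) vbundle \<Rightarrow> bool" where
  "smooth_vector_bundle E \<longleftrightarrow>
     smooth_manifold (tot E) \<and> smooth_manifold (base E) \<and> smooth_map (tot E) (base E) (proj E) \<and>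
     (\<forall>e\<in>points (tot E). \<forall>e'\<in>points (tot E). proj E e = proj E e' \<longrightarrow>
        vadd E e e' \<in> points (tot E) \<and> proj E (vadd E e e') = proj E e) \<and>
     (\<forall>e\<in>points (tot E). \<forall>\<alpha>. vscale E \<alpha> e \<in> points (tot E) \<and> proj E (vscale E \<alpha> e) = proj E e) \<and>
     (\<forall>p\<in>points (base E). \<exists>(U, \<psi>)\<in>trivs E. p \<in> U) \<and>
     (\<forall>(U, \<psi>)\<in>trivs E.
        openin (mtop (base E)) U \<and>
        diffeomorphism (open_submanifold (tot E) (over E U))
          (prod_manifold (open_submanifold (base E) U) model_manifold) (\<lambda>e. (proj E e, \<psi> e)) \<and>
        (\<forall>e\<in>over E U. \<forall>e'\<in>over E U. proj E e = proj E e' \<longrightarrow> \<psi> (vadd E e e') = \<psi> e + \<psi> e') \<and>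
        (\<forall>e\<in>over E U. \<forall>\<alpha>. \<psi> (vscale E \<alpha> e) = \<alpha> *\<^sub>R \<psi> e))"

definition restrict_bundle ::
  "('b, 'e, 'a, 'm, 'f) vbundle \<Rightarrow> 'a set \<Rightarrow> ('b, 'e, 'a, 'm, 'f) vbundle" where
  "restrict_bundle E W =
     E\<lparr>tot := open_submanifold (tot E) (over E W), base := open_submanifold (base E) W,
       trivs := (\<lambda>(U, \<psi>). (U \<inter> W, \<psi>)) ` trivs E\<rparr>"

definition bundle_morphism ::
  "('b, 'e::fin_dim_inner, 'a, 'm::fin_dim_inner, 'f) vbundle \<Rightarrow>
   ('d, 'e2::fin_dim_inner, 'c, 'm2::fin_dim_inner, 'f2) vbundle \<Rightarrow> ('b \<Rightarrow> 'd) \<Rightarrow> ('a \<Rightarrow> 'c) \<Rightarrow> bool" where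
  "bundle_morphism E F \<Psi> f \<longleftrightarrow>
     smooth_map (tot E) (tot F) \<Psi> \<and> smooth_map (base E) (base F) f \<and>
     (\<forall>e\<in>points (tot E). proj F (\<Psi> e) = f (proj E e)) \<and>
     (\<forall>e\<in>points (tot E). \<forall>e'\<in>points (tot E). proj E e = proj E e' \<longrightarrow>
        \<Psi> (vadd E e e') = vadd F (\<Psi> e) (\<Psi> e')) \<and>
     (\<forall>e\<in>points (tot E). \<forall>\<alpha>. \<Psi> (vscale E \<alpha> e) = vscale F \<alpha> (\<Psi> e))"

definition bundle_isomorphism ::
  "('b, 'e::fin_dim_inner, 'a, 'm::fin_dim_inner, 'f) vbundle \<Rightarrow>
   ('d, 'e2::fin_dim_inner, 'c, 'm2::fin_dim_inner, 'f2) vbundle \<Rightarrow> ('b \<Rightarrow> 'd) \<Rightarrow> ('a \<Rightarrow> 'c) \<Rightarrow> bool" where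
  "bundle_isomorphism E F \<Psi> f \<longleftrightarrow>
     bundle_morphism E F \<Psi> f \<and>
     (\<exists>\<Theta> g. bundle_morphism F E \<Theta> g \<and>
        (\<forall>e\<in>points (tot E). \<Theta> (\<Psi> e) = e) \<and> (\<forall>e\<in>points (tot F). \<Psi> (\<Theta> e) = e) \<and>
        (\<forall>p\<in>points (base E). g (f p) = p) \<and> (\<forall>p\<in>points (base F). f (g p) = p))"

section \<open>The tangent prolongation of a vector bundle\<close>

text \<open>The fibre product of \<open>E\<close> with itself over \<open>M\<close>, with the charts obtained from a chart
  \<open>(U, c)\<close> of \<open>M\<close> and a local trivialization \<open>(V, \<psi>)\<close>.\<close>

definition fibre_square ::
  "('b, 'e, 'a, 'm, 'f) vbundle \<Rightarrow> ('b \<times> 'b, 'm \<times> 'f \<times> 'f) manifold" where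
  "fibre_square E =
     \<lparr>mtop = subtopology (prod_topology (mtop (tot E)) (mtop (tot E)))
        {(e, e'). proj E e = proj E e'},
      atlas = {({(e, e') \<in> over E (U \<inter> V) \<times> over E (U \<inter> V). proj E e = proj E e'},
                \<lambda>(e, e'). (c (proj E e), \<psi> e, \<psi> e')) | U c V \<psi>.
               (U, c) \<in> atlas (base E) \<and> (V, \<psi>) \<in> trivs E}\<rparr>"

text \<open>The tangent map of the addition, precomposed with the inverse of the identification
  \<open>(T pr\<^sub>1, T pr\<^sub>2)\<close> of the tangent bundle of the fibre square with the fibre square of \<open>T q\<close>.\<close>

definition tangent_add ::
  "('b, 'e::fin_dim_inner, 'a, 'm::fin_dim_inner, 'f::fin_dim_inner) vbundle \<Rightarrow>
     ('b, 'e) tangent \<Rightarrow> ('b, 'e) tangent \<Rightarrow> ('b, 'e) tangent" where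
  "tangent_add E \<xi> \<eta> =
     tangent_map (fibre_square E) (tot E) (\<lambda>(e, e'). vadd E e e')
       (THE \<zeta>. \<zeta> \<in> tangent_vectors (fibre_square E) \<and>
          tangent_map (fibre_square E) (tot E) fst \<zeta> = \<xi> \<and>
          tangent_map (fibre_square E) (tot E) snd \<zeta> = \<eta>)"

definition tangent_scale ::
  "('b, 'e::fin_dim_inner, 'a, 'm, 'f) vbundle \<Rightarrow> real \<Rightarrow> ('b, 'e) tangent \<Rightarrow> ('b, 'e) tangent" where
  "tangent_scale E \<alpha> = tangent_map (tot E) (tot E) (vscale E \<alpha>)"

text \<open>The vector bundle \<open>T q : TE \<rightarrow> TM\<close>; its local trivializations are the tangent maps of those
  of \<open>E\<close>, where \<open>T'f\<close> is written as \<open>'f \<times> 'f\<close>.\<close>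

definition tangent_prolongation ::
  "('b, 'e::fin_dim_inner, 'a, 'm::fin_dim_inner, 'f::fin_dim_inner) vbundle \<Rightarrow>
   (('b, 'e) tangent, 'e \<times> 'e, ('a, 'm) tangent, 'm \<times> 'm, 'f \<times> 'f) vbundle" where
  "tangent_prolongation E =
     \<lparr>tot = tangent_bundle (tot E), base = tangent_bundle (base E),
      proj = tangent_map (tot E) (base E) (proj E),
      vadd = tangent_add E, vscale = tangent_scale E,
      trivs = {({\<zeta> \<in> tangent_vectors (base E). fst \<zeta> \<in> U},
                \<lambda>\<xi>. (\<psi> (fst \<xi>), snd (tangent_map (tot E) model_manifold \<psi> \<xi>) (UNIV, id))) | U \<psi>.
               (U, \<psi>) \<in> trivs E}\<rparr>"

definition linear_vector_field ::
  "('b, 'e::fin_dim_inner, 'a, 'm::fin_dim_inner, 'f::fin_dim_inner) vbundle \<Rightarrow>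
     ('a \<Rightarrow> ('a, 'm) tangent) \<Rightarrow> ('b \<Rightarrow> ('b, 'e) tangent) \<Rightarrow> bool" where
  "linear_vector_field E X Y \<longleftrightarrow>
     vector_field (base E) X \<and> vector_field (tot E) Y \<and>
     bundle_morphism E (tangent_prolongation E) Y X"

end

theory Submission
  imports Defs
begin

text \<open>
  Smooth dependence on initial values: on a short interval the integral curves of a field \<open>f\<close> solve
  \<open>y = x + I (f \<circ> y)\<close> in the Banach space of curves, with \<open>I\<close> the integration operator and a
  contraction on the right. The derivative of the solution with respect to \<open>x\<close> solves a linear
  fixed point equation whose coefficients depend on the solution itself, so that induction on \<open>k\<close>
  shows the solution to be \<open>C\<^sup>k\<close> in \<open>x\<close>.

  The linear vector field enters only through homogeneity: the projection and all scalar
  multiplications map integral curves to integral curves. So the zero section carries integral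
  curves of the base; since flow domains are open, the time-\<open>t\<close> flow is defined near the zero vector
  over any point of \<open>M\<^sub>t\<close>, and by homogeneity on its whole fibre. Additivity of the flow on fibres is
  automatic, because a homogeneous map that is differentiable at the origin is linear.
\<close>

section \<open>Orthonormal bases of the model spaces\<close>

text \<open>\<open>Ck_on\<close> speaks of derivatives in fixed directions, whereas every chain rule
  produces a moving linear map applied to a moving vector. Orthonormal bases resolve this: in such a
  basis the linearization of \<open>superpos f\<close> at a curve is a finite sum of bilinear terms,
  each pairing a coordinate of the argument with the curve of partial derivatives of
  \<open>f\<close>. These coefficients are superpositions in the same space of curves, so one
  induction covers all orders. A second obstacle is that \<open>superpos f\<close> makes sense only
  on curves with values in a compact part of the domain of \<open>f\<close>, a closed set of curves
  rather than an open one. Its derivative is therefore taken within that set, and a Lipschitz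
  estimate for the solution carries it over to the initial value, which does range over an open set.

  Smoothness is proved in the initial value for each fixed time. This suits the assertions on
  \<open>\<Phi>\<close>, which concern one time at a time; openness of the flow domain, which
  couples times and points, comes from existence times that are locally uniform in the initial
  value.\<close>

definition orthonormal :: "'a::real_inner set \<Rightarrow> bool" where
  "orthonormal B \<longleftrightarrow> (\<forall>b\<in>B. \<forall>c\<in>B. b \<bullet> c = (if b = c then 1 else 0))"

text \<open>Gram-Schmidt, one vector at a time. \<open>A\<close> may be linearly dependent: if the
  remainder \<open>r\<close> of the new vector vanishes, the basis is kept; otherwise
  \<open>r\<close> is normalized and joins it. Earlier vectors keep their expansion because they are
  orthogonal to the new \<open>u\<close>.\<close>

lemma orthonormal_extension:
  fixes A :: "'a::real_inner set"
  assumes "finite A"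
  shows "\<exists>B. finite B \<and> orthonormal B \<and> (\<forall>a\<in>A. a = (\<Sum>b\<in>B. (a \<bullet> b) *\<^sub>R b))"
  using assms
proof (induction A rule: finite_induct)
  case empty
  show ?case by (intro exI[of _ "{}"]) (simp add: orthonormal_def)
next
  case (insert a A)
  then obtain B where B: "finite B" "orthonormal B" "\<And>a. a \<in> A \<Longrightarrow> a = (\<Sum>b\<in>B. (a \<bullet> b) *\<^sub>R b)"
    by blast
  define r where "r = a - (\<Sum>b\<in>B. (a \<bullet> b) *\<^sub>R b)"
  show ?case
  proof (cases "r = 0")
    case True
    then have "a = (\<Sum>b\<in>B. (a \<bullet> b) *\<^sub>R b)" by (simp add: r_def)
    with B show ?thesis by blast
  next
    case False
    define u where "u = r /\<^sub>R norm r"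
    have rb: "r \<bullet> b = 0" if "b \<in> B" for b
    proof -
      have "(\<Sum>c\<in>B. (a \<bullet> c) *\<^sub>R c) \<bullet> b = (\<Sum>c\<in>B. if c = b then a \<bullet> c else 0)"
        unfolding inner_sum_left using B(2) that by (intro sum.cong) (auto simp: orthonormal_def)
      then show ?thesis using that B(1) by (simp add: r_def inner_diff_left)
    qed
    then have ub: "u \<bullet> b = 0" if "b \<in> B" for b using that by (simp add: u_def)
    have uu: "u \<bullet> u = 1" using False by (simp add: norm_eq_1[symmetric]) (simp add: u_def)
    have "u \<notin> B" using ub uu by force
    have xu: "x \<bullet> u = 0" if "x \<in> A" for x
    proof -
      have "x \<bullet> u = (\<Sum>b\<in>B. (x \<bullet> b) *\<^sub>R b) \<bullet> u" using B(3)[OF that] by simp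
      also have "\<dots> = 0" unfolding inner_sum_left
        by (rule sum.neutral) (simp add: ub inner_commute[of _ u])
      finally show ?thesis .
    qed
    have "a \<bullet> u = (r + (\<Sum>b\<in>B. (a \<bullet> b) *\<^sub>R b)) \<bullet> u" by (simp add: r_def)
    also have "\<dots> = r \<bullet> u"
      by (simp add: inner_add_left inner_sum_left ub inner_commute[of _ u] inner_add_right inner_sum_right)
    also have "\<dots> = norm r" using False
      by (simp add: u_def power2_norm_eq_inner[symmetric] power2_eq_square)
    finally have au: "(a \<bullet> u) *\<^sub>R u = r" using False by (simp add: u_def)
    show ?thesis
    proof (intro exI[of _ "insert u B"] conjI ballI)
      show "orthonormal (insert u B)"
        unfolding orthonormal_def
      proof (intro ballI)
        fix b c assume "b \<in> insert u B" "c \<in> insert u B"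
        then show "b \<bullet> c = (if b = c then 1 else 0)"
          using B(2) ub uu \<open>u \<notin> B\<close> inner_commute[of b u] by (auto simp: orthonormal_def)
      qed
      show "x = (\<Sum>b\<in>insert u B. (x \<bullet> b) *\<^sub>R b)" if "x \<in> insert a A" for x
      proof -
        have "(\<Sum>b\<in>insert u B. (x \<bullet> b) *\<^sub>R b) = (x \<bullet> u) *\<^sub>R u + (\<Sum>b\<in>B. (x \<bullet> b) *\<^sub>R b)"
          using B(1) \<open>u \<notin> B\<close> by simp
        also have "\<dots> = x"
        proof (cases "x = a")
          case True
          then show ?thesis by (simp only: au) (simp add: r_def)
        next
          case False
          then have "x \<in> A" using that by simp
          from B(3)[OF this] xu[OF this] show ?thesis by simp
        qed
        finally show ?thesis by (rule sym)
      qed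
    qed (simp add: B(1))
  qed
qed

text \<open>In dimension zero this set is empty; the constants chosen below allow for that.\<close>

definition onb :: "'a::fin_dim_inner set" where
  "onb = (SOME B. finite B \<and> (\<forall>x. x = (\<Sum>b\<in>B. (x \<bullet> b) *\<^sub>R b)) \<and> orthonormal B)"

lemma onb: "finite (onb :: 'a::fin_dim_inner set)" "x = (\<Sum>b\<in>onb. (x \<bullet> b) *\<^sub>R b)"
  "orthonormal (onb :: 'a set)" for x :: "'a::fin_dim_inner"
proof -
  obtain A :: "'a set" where A: "finite A" "\<And>x. \<exists>u. x = (\<Sum>a\<in>A. u a *\<^sub>R a)"
    using finite_spanning_set by blast
  obtain B where B: "finite B" "orthonormal B" "\<And>a. a \<in> A \<Longrightarrow> a = (\<Sum>b\<in>B. (a \<bullet> b) *\<^sub>R b)"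
    using orthonormal_extension[OF A(1)] by blast
  have "x = (\<Sum>b\<in>B. (x \<bullet> b) *\<^sub>R b)" for x
  proof -
    obtain u where u: "x = (\<Sum>a\<in>A. u a *\<^sub>R a)" using A(2) by blast
    have "(\<Sum>b\<in>B. (x \<bullet> b) *\<^sub>R b) = (\<Sum>b\<in>B. \<Sum>a\<in>A. u a *\<^sub>R (a \<bullet> b) *\<^sub>R b)"
      unfolding u inner_sum_left scaleR_sum_left by simp
    also have "\<dots> = (\<Sum>a\<in>A. u a *\<^sub>R (\<Sum>b\<in>B. (a \<bullet> b) *\<^sub>R b))"
      by (subst sum.swap) (simp add: scaleR_sum_right)
    also have "\<dots> = x" unfolding u by (rule sum.cong) (auto simp: B(3)[symmetric])
    finally show ?thesis by simp
  qed
  with B have "\<exists>B::'a set. finite B \<and> (\<forall>x. x = (\<Sum>b\<in>B. (x \<bullet> b) *\<^sub>R b)) \<and> orthonormal B"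
    by blast
  from someI_ex[OF this] have
    "finite (onb :: 'a set) \<and> (\<forall>x::'a. x = (\<Sum>b\<in>onb. (x \<bullet> b) *\<^sub>R b)) \<and> orthonormal (onb :: 'a set)"
    unfolding onb_def .
  then show "finite (onb :: 'a set)" "x = (\<Sum>b\<in>onb. (x \<bullet> b) *\<^sub>R b)" "orthonormal (onb :: 'a set)"
    by simp_all
qed

lemma norm_onb: "b \<in> onb \<Longrightarrow> norm b = 1"
  using onb(3) by (auto simp: orthonormal_def norm_eq_1)

lemma linear_eq_sum_onb:
  fixes x :: "'a::fin_dim_inner"
  assumes "linear f" shows "f x = (\<Sum>b\<in>onb. (x \<bullet> b) *\<^sub>R f b)"
proof -
  interpret linear f by fact
  have "f x = f (\<Sum>b\<in>onb. (x \<bullet> b) *\<^sub>R b)" using onb(2)[of x] by simp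
  then show ?thesis by (simp add: sum scaleR)
qed

text \<open>Bolzano-Weierstrass, one coordinate after the other: passing to a further subsequence
  preserves the convergence of the coordinates already treated. Compactness of closed balls and
  completeness follow, as the fixed point arguments require.\<close>

instance fin_dim_inner \<subseteq> heine_borel
proof
  fix f :: "nat \<Rightarrow> 'a"
  assume bdd: "bounded (range f)"
  have "\<exists>r. strict_mono r \<and> (\<forall>b\<in>D. convergent (\<lambda>n. f (r n) \<bullet> b))" if "finite D" for D
    using that
  proof (induction D rule: finite_induct)
    case empty
    show ?case using strict_mono_id by auto
  next
    case (insert b D)
    then obtain r :: "nat \<Rightarrow> nat" where r: "strict_mono r" "\<And>c. c \<in> D \<Longrightarrow> convergent (\<lambda>n. f (r n) \<bullet> c)"
      by blast
    have "bounded (range (\<lambda>n. f (r n) \<bullet> b))"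
      by (rule bounded_subset[OF bounded_linear_image[OF bdd bounded_linear_inner_left[of b]]]) auto
    then obtain l s where s: "strict_mono s" "((\<lambda>n. f (r n) \<bullet> b) \<circ> s) \<longlonglongrightarrow> l"
      using bounded_imp_convergent_subsequence by blast
    have "convergent (\<lambda>n. f (r (s n)) \<bullet> c)" if "c \<in> D" for c
      using convergent_subseq_convergent[OF r(2)[OF that] s(1)] by (simp add: o_def)
    with s r(1) show ?case
      by (intro exI[of _ "r \<circ> s"]) (auto simp: convergent_def o_def strict_mono_def)
  qed
  from this[OF onb(1)] obtain r where r: "strict_mono r" "\<And>b. b \<in> onb \<Longrightarrow> convergent (\<lambda>n. f (r n) \<bullet> b)"
    by blast
  obtain l where l: "\<And>b. b \<in> onb \<Longrightarrow> (\<lambda>n. f (r n) \<bullet> b) \<longlonglongrightarrow> l b"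
    using r(2) unfolding convergent_def by metis
  have "(\<lambda>n. \<Sum>b\<in>onb. (f (r n) \<bullet> b) *\<^sub>R b) \<longlonglongrightarrow> (\<Sum>b\<in>onb. l b *\<^sub>R b)"
    by (intro tendsto_sum tendsto_scaleR l tendsto_const)
  then have "(f \<circ> r) \<longlonglongrightarrow> (\<Sum>b\<in>onb. l b *\<^sub>R b)" by (simp add: onb(2)[symmetric] o_def)
  with r(1) show "\<exists>l r. strict_mono r \<and> (f \<circ> r) \<longlonglongrightarrow> l" by blast
qed

instance fin_dim_inner \<subseteq> banach ..

section \<open>Calculus of \<open>C\<^sup>k\<close> maps\<close>

lemma frechet_derivativeI: "(f has_derivative f') (at x) \<Longrightarrow> frechet_derivative f (at x) = f'"
  using frechet_derivative_at by metis

lemma has_derivative_frechet: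
  "f differentiable (at x) \<Longrightarrow> (f has_derivative frechet_derivative f (at x)) (at x)"
  by (simp add: frechet_derivative_works)

lemma frechet_derivative_cong:
  assumes "open S" "x \<in> S" "\<And>x. x \<in> S \<Longrightarrow> f x = g x"
  shows "frechet_derivative f (at x) = frechet_derivative g (at x)"
proof -
  have "(f has_derivative D) (at x) \<longleftrightarrow> (g has_derivative D) (at x)" for D
    using assms has_derivative_transform_within_open by metis
  then show ?thesis by (simp add: frechet_derivative_def)
qed

lemma differentiable_cong:
  assumes "open S" "x \<in> S" "\<And>x. x \<in> S \<Longrightarrow> f x = g x" "f differentiable (at x)"
  shows "g differentiable (at x)"
  using assms has_derivative_transform_within_open unfolding differentiable_def by blast

lemma Ck_on_cong:
  assumes "open S" "Ck_on k S f" "\<And>x. x \<in> S \<Longrightarrow> f x = g x"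
  shows "Ck_on k S g"
  using assms(2,3)
proof (induction k arbitrary: f g)
  case 0
  then show ?case using continuous_on_cong by (metis Ck_on.simps(1))
next
  case (Suc k)
  have "frechet_derivative f (at x) = frechet_derivative g (at x)" if "x \<in> S" for x
    using frechet_derivative_cong[OF assms(1) that Suc.prems(2)] .
  with Suc.IH[of "\<lambda>x. frechet_derivative f (at x) v" "\<lambda>x. frechet_derivative g (at x) v" for v] Suc.prems
  show ?case using differentiable_cong[OF assms(1) _ Suc.prems(2)] by simp
qed

lemma Ck_on_SucI:
  assumes "open S" "\<And>x. x \<in> S \<Longrightarrow> (f has_derivative f' x) (at x)" "\<And>v. Ck_on k S (\<lambda>x. f' x v)"
  shows "Ck_on (Suc k) S f"
  unfolding Ck_on.simps
proof (intro conjI ballI allI)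
  show "f differentiable (at x)" if "x \<in> S" for x using assms(2)[OF that] differentiableI by blast
  show "Ck_on k S (\<lambda>x. frechet_derivative f (at x) v)" for v
    by (rule Ck_on_cong[OF assms(1,3)]) (simp add: frechet_derivativeI[OF assms(2)])
qed

lemma Ck_on_SucD:
  assumes "Ck_on (Suc k) S f"
  shows "x \<in> S \<Longrightarrow> (f has_derivative frechet_derivative f (at x)) (at x)"
    "Ck_on k S (\<lambda>x. frechet_derivative f (at x) v)"
  using assms has_derivative_frechet by auto

lemma Ck_on_mono_Suc: "Ck_on (Suc k) S f \<Longrightarrow> Ck_on k S f"
proof (induction k arbitrary: f)
  case 0
  then show ?case
    by (auto intro!: continuous_at_imp_continuous_on differentiable_imp_continuous_within)
next
  case (Suc k)
  have "Ck_on k S (\<lambda>x. frechet_derivative f (at x) v)" for v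
    by (rule Suc.IH[OF Ck_on_SucD(2)[OF Suc.prems]])
  moreover have "f differentiable (at x)" if "x \<in> S" for x
    using Suc.prems that by simp
  ultimately show ?case by simp
qed

lemma Ck_on_imp_continuous_on: "Ck_on k S f \<Longrightarrow> continuous_on S f"
proof (induction k)
  case (Suc k)
  then show ?case using Ck_on_mono_Suc by blast
qed simp

lemma Ck_on_subset: "Ck_on k S f \<Longrightarrow> T \<subseteq> S \<Longrightarrow> Ck_on k T f"
  by (induction k arbitrary: f) (auto intro: continuous_on_subset)

lemma Ck_on_locally:
  assumes "\<And>x. x \<in> S \<Longrightarrow> \<exists>T. open T \<and> x \<in> T \<and> Ck_on k T f"
  shows "Ck_on k S f"
  using assms
proof (induction k arbitrary: f)
  case 0
  have "isCont f x" if "x \<in> S" for x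
    using 0[OF that] continuous_on_eq_continuous_at by (metis Ck_on.simps(1))
  then show ?case by (simp add: continuous_at_imp_continuous_on)
next
  case (Suc k)
  have "Ck_on k S (\<lambda>x. frechet_derivative f (at x) v)" for v
    by (rule Suc.IH) (use Suc.prems in fastforce)
  with Suc.prems show ?case by fastforce
qed

lemma Ck_on_const: "Ck_on k S (\<lambda>x. c)"
  by (induction k arbitrary: c) (auto intro!: continuous_intros simp: frechet_derivative_const)

lemma Ck_on_bounded_linear:
  assumes "open S" "bounded_linear L" "Ck_on k S f" shows "Ck_on k S (\<lambda>x. L (f x))"
  using assms(3)
proof (induction k arbitrary: f)
  case 0
  then show ?case using bounded_linear.continuous_on[OF assms(2)] by auto
next
  case (Suc k)
  show ?case
  proof (rule Ck_on_SucI[OF assms(1), where f' = "\<lambda>x v. L (frechet_derivative f (at x) v)"])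
    show "((\<lambda>x. L (f x)) has_derivative (\<lambda>v. L (frechet_derivative f (at x) v))) (at x)" if "x \<in> S" for x
      by (rule bounded_linear.has_derivative[OF assms(2) Ck_on_SucD(1)[OF Suc.prems that]])
    show "Ck_on k S (\<lambda>x. L (frechet_derivative f (at x) v))" for v
      by (rule Suc.IH[OF Ck_on_SucD(2)[OF Suc.prems]])
  qed
qed

lemma Ck_on_ident:
  assumes "open S" shows "Ck_on k S (\<lambda>x. x)"
proof (cases k)
  case (Suc k)
  show ?thesis unfolding Suc
    by (rule Ck_on_SucI[OF assms has_derivative_ident Ck_on_const])
qed (simp add: continuous_on_id)

lemma Ck_on_linear: "open S \<Longrightarrow> bounded_linear L \<Longrightarrow> Ck_on k S L"
  by (rule Ck_on_bounded_linear[OF _ _ Ck_on_ident])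

lemma Ck_on_add:
  assumes "open S" "Ck_on k S f" "Ck_on k S g" shows "Ck_on k S (\<lambda>x. f x + g x)"
  using assms(2,3)
proof (induction k arbitrary: f g)
  case 0
  then show ?case by (auto intro: continuous_on_add)
next
  case (Suc k)
  let ?f' = "\<lambda>x. frechet_derivative f (at x)" and ?g' = "\<lambda>x. frechet_derivative g (at x)"
  show ?case
  proof (rule Ck_on_SucI[OF assms(1), where f' = "\<lambda>x v. ?f' x v + ?g' x v"])
    show "((\<lambda>x. f x + g x) has_derivative (\<lambda>v. ?f' x v + ?g' x v)) (at x)" if "x \<in> S" for x
      by (rule has_derivative_add[OF Ck_on_SucD(1)[OF Suc.prems(1) that] Ck_on_SucD(1)[OF Suc.prems(2) that]])
    show "Ck_on k S (\<lambda>x. ?f' x v + ?g' x v)" for v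
      by (rule Suc.IH[OF Ck_on_SucD(2)[OF Suc.prems(1)] Ck_on_SucD(2)[OF Suc.prems(2)]])
  qed
qed

lemma Ck_on_sum:
  assumes "open S" "\<And>i. i \<in> I \<Longrightarrow> Ck_on k S (f i)" shows "Ck_on k S (\<lambda>x. \<Sum>i\<in>I. f i x)"
  using assms(2)
proof (induction I rule: infinite_finite_induct)
  case (insert i I)
  then show ?case by (simp add: Ck_on_add[OF assms(1)])
qed (auto intro: Ck_on_const)

lemma Ck_on_bilinear:
  assumes "open S" "bounded_bilinear P" "Ck_on k S f" "Ck_on k S g"
  shows "Ck_on k S (\<lambda>x. P (f x) (g x))"
  using assms(3,4)
proof (induction k arbitrary: f g)
  case 0
  then show ?case using bounded_bilinear.continuous_on[OF assms(2)] by auto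
next
  case (Suc k)
  let ?f' = "\<lambda>x. frechet_derivative f (at x)" and ?g' = "\<lambda>x. frechet_derivative g (at x)"
  show ?case
  proof (rule Ck_on_SucI[OF assms(1), where f' = "\<lambda>x v. P (f x) (?g' x v) + P (?f' x v) (g x)"])
    show "((\<lambda>x. P (f x) (g x)) has_derivative (\<lambda>v. P (f x) (?g' x v) + P (?f' x v) (g x))) (at x)"
      if "x \<in> S" for x
      by (rule bounded_bilinear.FDERIV[OF assms(2) Ck_on_SucD(1)[OF Suc.prems(1) that]
            Ck_on_SucD(1)[OF Suc.prems(2) that]])
    show "Ck_on k S (\<lambda>x. P (f x) (?g' x v) + P (?f' x v) (g x))" for v
      by (intro Ck_on_add[OF assms(1)] Suc.IH Ck_on_SucD(2)[OF Suc.prems(1)]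
          Ck_on_SucD(2)[OF Suc.prems(2)] Suc.prems[THEN Ck_on_mono_Suc])
  qed
qed

lemma Ck_on_Pair:
  assumes "open S" "Ck_on k S f" "Ck_on k S g" shows "Ck_on k S (\<lambda>x. (f x, g x))"
proof -
  have "Ck_on k S (\<lambda>x. (f x, 0) + (0, g x))"
    by (intro Ck_on_add assms Ck_on_bounded_linear[OF assms(1) _ assms(2)]
      Ck_on_bounded_linear[OF assms(1) _ assms(3)] bounded_linear_Pair bounded_linear_ident bounded_linear_zero)
  then show ?thesis by simp
qed

text \<open>The derivative \<open>?g' (f x) (?f' x v)\<close> is no composition of the kind the
  induction treats, since the direction depends on \<open>x\<close>. Expanded in an orthonormal
  basis of the middle space, it is a sum of products of a coordinate of \<open>?f' x v\<close> with
  \<open>?g' (f x) b\<close> for fixed \<open>b\<close>, and the induction hypothesis applies to the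
  latter.\<close>

lemma Ck_on_compose:
  fixes g :: "'a::fin_dim_inner \<Rightarrow> 'b::real_normed_vector"
  assumes "open S" "open T" "Ck_on k S f" "Ck_on k T g" "f ` S \<subseteq> T"
  shows "Ck_on k S (\<lambda>x. g (f x))"
  using assms(3,4)
proof (induction k arbitrary: g)
  case 0
  then show ?case using continuous_on_compose2 assms(5) by auto
next
  case (Suc k)
  have lin: "linear (frechet_derivative g (at (f x)))" if "x \<in> S" for x
    using Ck_on_SucD(1)[OF Suc.prems(2), of "f x"] that assms(5) has_derivative_linear by blast
  let ?f' = "\<lambda>x. frechet_derivative f (at x)" and ?g' = "\<lambda>x. frechet_derivative g (at x)"
  show ?case
  proof (rule Ck_on_SucI[OF assms(1), where f' = "\<lambda>x v. ?g' (f x) (?f' x v)"])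
    show "((\<lambda>x. g (f x)) has_derivative (\<lambda>v. ?g' (f x) (?f' x v))) (at x)" if "x \<in> S" for x
    proof -
      have "f x \<in> T" using that assms(5) by blast
      from has_derivative_compose[OF Ck_on_SucD(1)[OF Suc.prems(1) that] Ck_on_SucD(1)[OF Suc.prems(2) this]]
      show ?thesis .
    qed
    show "Ck_on k S (\<lambda>x. ?g' (f x) (?f' x v))" for v
    proof (rule Ck_on_cong[OF assms(1)])
      show "Ck_on k S (\<lambda>x. \<Sum>b\<in>onb. (?f' x v \<bullet> b) *\<^sub>R ?g' (f x) b)"
      proof (rule Ck_on_sum[OF assms(1)])
        fix b :: 'a
        have "Ck_on k S (\<lambda>x. ?f' x v \<bullet> b)"
          by (rule Ck_on_bounded_linear[OF assms(1) bounded_linear_inner_left Ck_on_SucD(2)[OF Suc.prems(1)]])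
        moreover have "Ck_on k S (\<lambda>x. ?g' (f x) b)"
          by (rule Suc.IH[OF Suc.prems(1)[THEN Ck_on_mono_Suc] Ck_on_SucD(2)[OF Suc.prems(2)]])
        ultimately show "Ck_on k S (\<lambda>x. (?f' x v \<bullet> b) *\<^sub>R ?g' (f x) b)"
          by (rule Ck_on_bilinear[OF assms(1) bounded_bilinear_scaleR])
      qed
    qed (simp add: linear_eq_sum_onb[OF lin, symmetric])
  qed
qed

lemma smooth_on_imp_continuous_on: "smooth_on S f \<Longrightarrow> continuous_on S f"
  by (auto simp: smooth_on_def intro: Ck_on_imp_continuous_on)

lemma smooth_on_has_derivative:
  "smooth_on S f \<Longrightarrow> x \<in> S \<Longrightarrow> (f has_derivative frechet_derivative f (at x)) (at x)"
  unfolding smooth_on_def by (rule Ck_on_SucD(1)) auto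

lemma smooth_on_frechet_derivative: "smooth_on S f \<Longrightarrow> smooth_on S (\<lambda>x. frechet_derivative f (at x) v)"
  unfolding smooth_on_def by (metis Ck_on_SucD(2))

lemma smooth_on_subset: "smooth_on S f \<Longrightarrow> T \<subseteq> S \<Longrightarrow> smooth_on T f"
  by (auto simp: smooth_on_def intro: Ck_on_subset)

lemma smooth_on_cong:
  "open S \<Longrightarrow> smooth_on S f \<Longrightarrow> (\<And>x. x \<in> S \<Longrightarrow> f x = g x) \<Longrightarrow> smooth_on S g"
  by (meson smooth_on_def Ck_on_cong)

lemma smooth_on_locally:
  assumes "\<And>x. x \<in> S \<Longrightarrow> \<exists>T. open T \<and> x \<in> T \<and> smooth_on T f"
  shows "smooth_on S f"
  unfolding smooth_on_def using assms by (meson smooth_on_def Ck_on_locally)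

lemma smooth_on_compose:
  fixes g :: "'a::fin_dim_inner \<Rightarrow> 'b::real_normed_vector"
  assumes "open S" "open T" "smooth_on S f" "smooth_on T g" "f ` S \<subseteq> T"
  shows "smooth_on S (\<lambda>x. g (f x))"
  using assms Ck_on_compose unfolding smooth_on_def by blast

lemma smooth_on_Pair:
  assumes "open S" "smooth_on S f" "smooth_on S g" shows "smooth_on S (\<lambda>x. (f x, g x))"
  using assms Ck_on_Pair unfolding smooth_on_def by blast

lemma smooth_on_bounded_linear:
  assumes "open S" "bounded_linear L" "smooth_on S f" shows "smooth_on S (\<lambda>x. L (f x))"
  using assms Ck_on_bounded_linear unfolding smooth_on_def by blast

lemma smooth_on_linear: "open S \<Longrightarrow> bounded_linear L \<Longrightarrow> smooth_on S L"
  using Ck_on_linear unfolding smooth_on_def by blast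

lemma smooth_on_const: "smooth_on S (\<lambda>x. c)"
  using Ck_on_const unfolding smooth_on_def by blast

section \<open>Local flows of ordinary differential equations\<close>

text \<open>\<open>R\<close> is the inverse of the identity minus \<open>T\<close>, obtained from
  the contraction principle. Its bound 2 comes from absorbing \<open>norm (T (R x))\<close>, which
  is at most half of \<open>norm (R x)\<close>.\<close>

lemma linear_fixed_point_solver:
  fixes T :: "'c::banach \<Rightarrow> 'c"
  assumes T: "bounded_linear T" "\<And>z. norm (T z) \<le> norm z / 2"
  obtains R where "bounded_linear R" "\<And>c z. z = c + T z \<Longrightarrow> z = R c" "\<And>c. R c = c + T (R c)"
proof -
  interpret bounded_linear T by fact
  have ex1: "\<exists>!z. c + T z = z" for c
    using banach_fix_type[of "1/2" "\<lambda>z. c + T z"] T(2)[of "x - y" for x y]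
    by (simp add: dist_norm diff)
  define R where "R c = (THE z. c + T z = z)" for c
  have R: "R c = c + T (R c)" for c using theI'[OF ex1[of c]] by (simp add: R_def)
  have eqR: "z = R c" if "z = c + T z" for c z using ex1[of c] R[of c] that by metis
  have "bounded_linear R"
  proof (rule bounded_linear_intro)
    show "R (x + y) = R x + R y" for x y
      by (rule eqR[symmetric]) (subst R[of x], subst R[of y], simp add: add)
    show "R (r *\<^sub>R x) = r *\<^sub>R R x" for r x
      by (rule eqR[symmetric]) (subst R[of x], simp add: scaleR scaleR_add_right)
    show "norm (R x) \<le> norm x * 2" for x
      using norm_triangle_ineq[of x "T (R x)"] T(2)[of "R x"] R[of x] by simp
  qed
  from that[OF this eqR R] show thesis .
qed

text \<open>Near \<open>x\<close> the factor \<open>s\<close> is of the order of the increment while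
  \<open>u\<close> tends to 0, so the product is of smaller order than the increment. It matters
  that \<open>u\<close> is merely continuous: in the application it is the increment of a solution
  whose differentiability is still to be shown.\<close>

lemma has_derivative_zero_bilinear:
  fixes s :: "'p::real_normed_vector \<Rightarrow> 'd::real_normed_vector" and u :: "'p \<Rightarrow> 'c::real_normed_vector"
  assumes P: "bounded_bilinear P" and s: "(s has_derivative s') (at x)" "s x = 0"
    and u: "isCont u x" "u x = 0"
  shows "((\<lambda>y. P (u y) (s y)) has_derivative (\<lambda>h. 0)) (at x)"
  unfolding has_derivative_at
proof
  interpret bounded_bilinear P by fact
  obtain K where K: "K > 0" "\<And>a b. norm (P a b) \<le> norm a * norm b * K" using pos_bounded by blast
  have lin: "bounded_linear s'" and q: "(\<lambda>h. norm (s (x + h) - s x - s' h) / norm h) \<midarrow>0\<rightarrow> 0"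
    using s(1) by (auto simp: has_derivative_at)
  let ?b = "\<lambda>h. norm (u (x + h)) * (norm (s (x + h) - s x - s' h) / norm h + onorm s') * K"
  have "(\<lambda>h. u (x + h)) \<midarrow>0\<rightarrow> u x" using u(1) by (simp add: isCont_def LIM_offset_zero_iff)
  then have "?b \<midarrow>0\<rightarrow> norm (u x) * (0 + onorm s') * K" by (intro tendsto_intros q)
  then have b: "?b \<midarrow>0\<rightarrow> 0" by (simp add: u(2))
  show "(\<lambda>h. norm (P (u (x + h)) (s (x + h)) - P (u x) (s x) - 0) / norm h) \<midarrow>0\<rightarrow> 0"
  proof (rule tendsto_sandwich[OF _ _ tendsto_const b])
    show "\<forall>\<^sub>F h in at 0. norm (P (u (x + h)) (s (x + h)) - P (u x) (s x) - 0) / norm h \<le> ?b h"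
    proof (rule eventually_at_topological[THEN iffD2], intro exI[of _ UNIV] conjI ballI impI)
      fix h :: 'p assume "h \<noteq> 0"
      have "norm (s (x + h)) \<le> norm (s (x + h) - s x - s' h) + norm (s' h)"
        using norm_triangle_ineq[of "s (x + h) - s' h" "s' h"] s(2) by simp
      also have "\<dots> \<le> norm (s (x + h) - s x - s' h) + onorm s' * norm h"
        using onorm[OF lin] by simp
      finally have 1: "norm (s (x + h)) / norm h \<le> norm (s (x + h) - s x - s' h) / norm h + onorm s'"
        using \<open>h \<noteq> 0\<close> by (simp add: field_simps)
      have "norm (P (u (x + h)) (s (x + h))) / norm h \<le> norm (u (x + h)) * norm (s (x + h)) * K / norm h"
        by (intro divide_right_mono K) auto
      also have "\<dots> = norm (u (x + h)) * (norm (s (x + h)) / norm h) * K" by simp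
      also have "\<dots> \<le> ?b h" using K(1) 1 by (intro mult_right_mono mult_left_mono) auto
      finally show "norm (P (u (x + h)) (s (x + h)) - P (u x) (s x) - 0) / norm h \<le> ?b h"
        by (simp add: u(2) zero_left)
    qed auto
  qed auto
qed auto

text \<open>Subtracts the fixed point equations at two parameters. In the applications
  \<open>E'\<close> is the contracting operator applied to the increment \<open>q - p\<close>, and
  \<open>E\<close> is an error term that joins the inhomogeneity.\<close>

lemma eq_diffI:
  fixes p :: "'a::ab_group_add"
  assumes "p = b1 + A" "q = b2 + B" "E' + E = B - A" shows "q - p = (b2 - b1) + E + E'"
  using assms by (simp add: algebra_simps)

text \<open>The increment \<open>w y - w x\<close> solves the equation with the operator at
  \<open>y\<close> and the inhomogeneity \<open>e y\<close>, so its norm is at most twice that of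
  \<open>e y\<close>. Only the value \<open>w x\<close> at the fixed point enters \<open>e\<close>,
  which therefore tends to 0 by continuity of \<open>a\<close> and \<open>b\<close> alone.\<close>

lemma continuous_on_linear_fixed_point:
  fixes w b :: "'p::real_normed_vector \<Rightarrow> 'c::banach" and a :: "'i \<Rightarrow> 'p \<Rightarrow> 'd::real_normed_vector"
  assumes U: "open U" and P: "\<And>i. bounded_bilinear (P i)"
    and contr: "\<And>x z. x \<in> U \<Longrightarrow> norm (\<Sum>i\<in>I. P i z (a i x)) \<le> norm z / 2"
    and a: "\<And>i. i \<in> I \<Longrightarrow> continuous_on U (a i)" and b: "continuous_on U b"
    and w: "\<And>x. x \<in> U \<Longrightarrow> w x = b x + (\<Sum>i\<in>I. P i (w x) (a i x))"
  shows "continuous_on U w"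
proof -
  have "(w \<longlongrightarrow> w x) (at x within U)" if x: "x \<in> U" for x
  proof -
    define e where "e y = (b y - b x) + (\<Sum>i\<in>I. P i (w x) (a i y - a i x))" for y
    have "continuous_on U e" unfolding e_def
      by (intro continuous_intros a b bounded_bilinear.continuous_on[OF P])
    moreover have "e x = 0" by (simp add: e_def bounded_bilinear.zero_right[OF P])
    ultimately have e0: "(e \<longlongrightarrow> 0) (at x within U)" using x by (metis continuous_on_def)
    have "norm (w y - w x) \<le> norm (e y) * 2" if y: "y \<in> U" for y
    proof -
      have "w y - w x = e y + (\<Sum>i\<in>I. P i (w y - w x) (a i y))"
      proof -
        have "(\<Sum>i\<in>I. P i (w y - w x) (a i y)) + (\<Sum>i\<in>I. P i (w x) (a i y - a i x)) =
          (\<Sum>i\<in>I. P i (w y) (a i y)) - (\<Sum>i\<in>I. P i (w x) (a i x))"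
          by (simp add: bounded_bilinear.diff_right[OF P] bounded_bilinear.diff_left[OF P] sum_subtractf)
        from eq_diffI[OF w[OF x] w[OF y] this] show ?thesis unfolding e_def .
      qed
      then have "norm (w y - w x) \<le> norm (e y) + norm (\<Sum>i\<in>I. P i (w y - w x) (a i y))"
        using norm_triangle_ineq by metis
      with contr[OF y, of "w y - w x"] show ?thesis by simp
    qed
    then have "\<forall>\<^sub>F y in at x within U. norm (w y - w x) \<le> norm (e y) * 2"
      by (simp add: eventually_at_filter)
    from tendsto_0_le[OF e0 this] show ?thesis by (simp add: LIM_zero_iff)
  qed
  then show ?thesis by (simp add: continuous_on_def)
qed

lemma has_derivative_linear_fixed_point:
  fixes w b :: "'p::real_normed_vector \<Rightarrow> 'c::banach" and a :: "'i \<Rightarrow> 'p \<Rightarrow> 'd::real_normed_vector"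
  assumes U: "open U" "x \<in> U" and P: "\<And>i. bounded_bilinear (P i)"
    and contr: "\<And>z. norm (\<Sum>i\<in>I. P i z (a i x)) \<le> norm z / 2"
    and a: "\<And>i. i \<in> I \<Longrightarrow> (a i has_derivative a' i) (at x)" and b: "(b has_derivative b') (at x)"
    and w: "\<And>x. x \<in> U \<Longrightarrow> w x = b x + (\<Sum>i\<in>I. P i (w x) (a i x))" and cont: "isCont w x"
  obtains w' where "(w has_derivative w') (at x)"
    "\<And>v. w' v = (b' v + (\<Sum>i\<in>I. P i (w x) (a' i v))) + (\<Sum>i\<in>I. P i (w' v) (a i x))"
proof -
  have T: "bounded_linear (\<lambda>z. \<Sum>i\<in>I. P i z (a i x))"
    by (intro bounded_linear_sum bounded_bilinear.bounded_linear_left[OF P])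
  from linear_fixed_point_solver[OF T contr] obtain R where R: "bounded_linear R"
    "\<And>c z. z = c + (\<Sum>i\<in>I. P i z (a i x)) \<Longrightarrow> z = R c"
    "\<And>c. R c = c + (\<Sum>i\<in>I. P i (R c) (a i x))"
    by blast
  interpret R: bounded_linear R by fact
  txt \<open>With \<open>G\<close> as below, \<open>w y - w x\<close> solves \<open>z = (G y - G x) + T z\<close> with the fixed operator \<open>T\<close> at \<open>x\<close>.\<close>
  define G where "G y = b y + (\<Sum>i\<in>I. P i (w x) (a i y)) + (\<Sum>i\<in>I. P i (w y - w x) (a i y - a i x))" for y
  let ?G' = "\<lambda>v. b' v + (\<Sum>i\<in>I. P i (w x) (a' i v))"
  have "(G has_derivative (\<lambda>v. ?G' v + (\<Sum>i\<in>I. 0))) (at x)"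
    unfolding G_def
  proof (intro has_derivative_add has_derivative_sum b)
    fix i assume i: "i \<in> I"
    show "((\<lambda>y. P i (w x) (a i y)) has_derivative (\<lambda>v. P i (w x) (a' i v))) (at x)"
      by (rule bounded_linear.has_derivative[OF bounded_bilinear.bounded_linear_right[OF P] a[OF i]])
    show "((\<lambda>y. P i (w y - w x) (a i y - a i x)) has_derivative (\<lambda>v. 0)) (at x)"
    proof (rule has_derivative_zero_bilinear[OF P])
      show "((\<lambda>y. a i y - a i x) has_derivative a' i) (at x)"
        using has_derivative_diff[OF a[OF i] has_derivative_const] by simp
      show "isCont (\<lambda>y. w y - w x) x" using cont by (intro continuous_intros)
    qed simp_all
  qed
  then have G: "(G has_derivative ?G') (at x)" by simp
  have "w x + R (G y - G x) = w y" if y: "y \<in> U" for y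
  proof -
    have "w y - w x = (G y - G x) + (\<Sum>i\<in>I. P i (w y - w x) (a i x))"
      using w[OF y] w[OF U(2)] unfolding G_def
      by (simp add: bounded_bilinear.diff_right[OF P] bounded_bilinear.diff_left[OF P] sum_subtractf
          bounded_bilinear.zero_right[OF P])
    from R(2)[OF this] show ?thesis by (metis add.commute diff_add_cancel)
  qed
  moreover have "((\<lambda>y. w x + R (G y - G x)) has_derivative (\<lambda>v. R (?G' v))) (at x)"
    using has_derivative_add[OF has_derivative_const R.has_derivative[OF has_derivative_diff[OF G has_derivative_const]]]
    by simp
  ultimately have "(w has_derivative (\<lambda>v. R (?G' v))) (at x)"
    using has_derivative_transform_within_open[OF _ U] by blast
  then show thesis by (rule that) (rule R(3))
qed

text \<open>A directional derivative of \<open>w\<close> solves an equation with the same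
  coefficients \<open>a\<close> and a new inhomogeneity built from \<open>w\<close> and the
  derivatives of \<open>a\<close> and \<open>b\<close>. Hence the induction keeps \<open>a\<close>
  fixed and generalizes \<open>b\<close> and \<open>w\<close>; it is used first for \<open>w\<close>
  itself, to make the new inhomogeneity \<open>C\<^sup>k\<close>, and then for the
  derivative.\<close>

lemma Ck_on_linear_fixed_point:
  fixes w b :: "'p::real_normed_vector \<Rightarrow> 'c::banach" and a :: "'i \<Rightarrow> 'p \<Rightarrow> 'd::real_normed_vector"
  assumes U: "open U" and P: "\<And>i. bounded_bilinear (P i)"
    and contr: "\<And>x z. x \<in> U \<Longrightarrow> norm (\<Sum>i\<in>I. P i z (a i x)) \<le> norm z / 2"
    and "\<And>i. i \<in> I \<Longrightarrow> Ck_on k U (a i)" and "Ck_on k U b"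
    and "\<And>x. x \<in> U \<Longrightarrow> w x = b x + (\<Sum>i\<in>I. P i (w x) (a i x))"
  shows "Ck_on k U w"
  using assms(4-6)
proof (induction k arbitrary: b w)
  case 0
  show ?case unfolding Ck_on.simps
    by (rule continuous_on_linear_fixed_point[OF U P contr]) (use 0 in auto)
next
  case (Suc k)
  note a = Suc.prems(1) and b = Suc.prems(2) and w = Suc.prems(3)
  have ak: "Ck_on k U (a i)" if "i \<in> I" for i by (rule Ck_on_mono_Suc[OF a[OF that]])
  have wk: "Ck_on k U w" by (rule Suc.IH[OF ak Ck_on_mono_Suc[OF b] w])
  let ?a' = "\<lambda>i x. frechet_derivative (a i) (at x)" and ?b' = "\<lambda>x. frechet_derivative b (at x)"
  let ?Q = "\<lambda>x w'. (w has_derivative w') (at x) \<and>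
    (\<forall>v. w' v = (?b' x v + (\<Sum>i\<in>I. P i (w x) (?a' i x v))) + (\<Sum>i\<in>I. P i (w' v) (a i x)))"
  have "\<forall>x\<in>U. \<exists>w'. ?Q x w'"
  proof
    fix x assume x: "x \<in> U"
    have "isCont w x" using Ck_on_imp_continuous_on[OF wk] U x by (simp add: continuous_on_eq_continuous_at)
    from this obtain w' where "(w has_derivative w') (at x)"
      "\<And>v. w' v = (?b' x v + (\<Sum>i\<in>I. P i (w x) (?a' i x v))) + (\<Sum>i\<in>I. P i (w' v) (a i x))"
      using has_derivative_linear_fixed_point[OF U x P contr[OF x] Ck_on_SucD(1)[OF a x] Ck_on_SucD(1)[OF b x] w]
      by blast
    then show "\<exists>w'. ?Q x w'" by blast
  qed
  then obtain w' where "\<forall>x\<in>U. ?Q x (w' x)" by (rule bchoice[THEN exE])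
  then have w': "(w has_derivative w' x) (at x)"
    "w' x v = (?b' x v + (\<Sum>i\<in>I. P i (w x) (?a' i x v))) + (\<Sum>i\<in>I. P i (w' x v) (a i x))"
    if "x \<in> U" for x v using that by blast+
  show ?case
  proof (rule Ck_on_SucI[OF U w'(1)])
    fix v
    show "Ck_on k U (\<lambda>x. w' x v)"
    proof (rule Suc.IH[OF ak _ w'(2)])
      show "Ck_on k U (\<lambda>x. ?b' x v + (\<Sum>i\<in>I. P i (w x) (?a' i x v)))"
        by (intro Ck_on_add[OF U] Ck_on_sum[OF U] Ck_on_bilinear[OF U P] wk Ck_on_SucD(2)[OF b])
          (rule Ck_on_SucD(2)[OF a])
    qed
  qed
qed

section \<open>Estimates uniform on compact sets\<close>

text \<open>Continuity is available for each direction separately, so the operator bound is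
  assembled from bounds along the basis vectors.\<close>

lemma derivative_bound_compact:
  fixes g :: "'m::fin_dim_inner \<Rightarrow> 'n::real_normed_vector"
  assumes "smooth_on S g" "compact K" "K \<subseteq> S"
  obtains L where "L \<ge> 0" "\<And>x v. x \<in> K \<Longrightarrow> norm (frechet_derivative g (at x) v) \<le> L * norm v"
proof -
  have "\<exists>B\<ge>0. \<forall>x\<in>K. norm (frechet_derivative g (at x) b) \<le> B" for b
  proof -
    have "continuous_on K (\<lambda>x. frechet_derivative g (at x) b)"
      using smooth_on_imp_continuous_on[OF smooth_on_frechet_derivative[OF assms(1)]] assms(3)
        continuous_on_subset by blast
    from compact_imp_bounded[OF compact_continuous_image[OF this assms(2)]]
    obtain B where "\<And>x. x \<in> K \<Longrightarrow> norm (frechet_derivative g (at x) b) \<le> B"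
      by (auto simp: bounded_iff)
    \<comment> \<open>If \<open>K\<close> is empty, \<open>B\<close> may be negative.\<close>
    then show ?thesis by (intro exI[of _ "max B 0"]) (auto simp: le_max_iff_disj)
  qed
  then obtain B where B: "\<And>b. B b \<ge> 0" "\<And>b x. x \<in> K \<Longrightarrow> norm (frechet_derivative g (at x) b) \<le> B b"
    by metis
  show thesis
  proof (rule that)
    show "(\<Sum>b\<in>(onb::'m set). B b) \<ge> 0" by (intro sum_nonneg B)
    fix x v assume x: "x \<in> K"
    have lin: "linear (frechet_derivative g (at x))"
      using smooth_on_has_derivative[OF assms(1)] x assms(3) has_derivative_linear by blast
    have "norm (frechet_derivative g (at x) v) \<le> (\<Sum>b\<in>onb. norm ((v \<bullet> b) *\<^sub>R frechet_derivative g (at x) b))"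
      unfolding linear_eq_sum_onb[OF lin, of v] by (rule norm_sum)
    also have "\<dots> \<le> (\<Sum>b\<in>onb. B b * norm v)"
    proof (rule sum_mono)
      fix b :: 'm assume "b \<in> onb"
      then have "\<bar>v \<bullet> b\<bar> \<le> norm v" using Cauchy_Schwarz_ineq2[of v b] by (simp add: norm_onb)
      then show "norm ((v \<bullet> b) *\<^sub>R frechet_derivative g (at x) b) \<le> B b * norm v"
        using mult_mono[OF _ B(2)[OF x, of b], of "\<bar>v \<bullet> b\<bar>" "norm v"] by (simp add: mult.commute)
    qed
    finally show "norm (frechet_derivative g (at x) v) \<le> (\<Sum>b\<in>onb. B b) * norm v"
      by (simp add: sum_distrib_right)
  qed
qed

text \<open>The mean value inequality on the segment from \<open>x\<close> to \<open>y\<close>,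
  together with uniform continuity of the derivative on \<open>K\<close> along each basis vector.
  That \<open>d\<close> does not depend on \<open>x\<close> is what allows the estimate to be
  applied at all times of a curve at once.\<close>

lemma uniform_linearization:
  fixes g :: "'m::fin_dim_inner \<Rightarrow> 'n::real_normed_vector"
  assumes g: "smooth_on S g" and K: "compact K" "convex K" "K \<subseteq> S" and e: "e > 0"
  obtains d where "d > 0" "\<And>x y. x \<in> K \<Longrightarrow> y \<in> K \<Longrightarrow> norm (y - x) < d \<Longrightarrow>
    norm (g y - g x - frechet_derivative g (at x) (y - x)) \<le> e * norm (y - x)"
proof -
  \<comment> \<open>Each basis direction may contribute \<open>c\<close> to the total error
    \<open>e\<close>; the added 1 keeps the denominator positive in dimension zero.\<close>
  define c where "c = e / (card (onb :: 'm set) + 1)"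
  have c: "c > 0" "card (onb :: 'm set) * c \<le> e" using e by (auto simp: c_def field_simps)
  have "\<exists>d>0. \<forall>x\<in>K. \<forall>y\<in>K. norm (y - x) < d \<longrightarrow>
    norm (frechet_derivative g (at y) b - frechet_derivative g (at x) b) \<le> c" for b
  proof -
    have "continuous_on K (\<lambda>x. frechet_derivative g (at x) b)"
      using smooth_on_imp_continuous_on[OF smooth_on_frechet_derivative[OF g]] K(3)
        continuous_on_subset by blast
    from compact_uniformly_continuous[OF this K(1)] c(1) show ?thesis
      unfolding uniformly_continuous_on_def dist_norm by (meson less_imp_le)
  qed
  then obtain d where d: "\<And>b. d b > 0" "\<And>b x y. x \<in> K \<Longrightarrow> y \<in> K \<Longrightarrow> norm (y - x) < d b \<Longrightarrow>
    norm (frechet_derivative g (at y) b - frechet_derivative g (at x) b) \<le> c"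
    by metis
  \<comment> \<open>The inserted 1 keeps the set nonempty in dimension zero.\<close>
  define D where "D = Min (insert 1 (d ` (onb :: 'm set)))"
  have D: "D > 0" using onb(1) d(1) unfolding D_def by (subst Min_gr_iff) auto
  have Dd: "D \<le> d b" if "b \<in> onb" for b unfolding D_def using onb(1) that by (intro Min_le) auto
  have lin: "linear (frechet_derivative g (at x))" if "x \<in> K" for x
    using smooth_on_has_derivative[OF g] that K(3) has_derivative_linear by blast
  show thesis
  proof (rule that[OF D])
    fix x y assume xy: "x \<in> K" "y \<in> K" "norm (y - x) < D"
    have seg: "z \<in> K" "norm (z - x) < D" if "z \<in> closed_segment x y" for z
    proof -
      show "z \<in> K" using that xy K(2) closed_segment_subset by blast
      show "norm (z - x) < D" using segment_bound[OF that] xy(3) by linarith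
    qed
    have "norm (g y - g x - frechet_derivative g (at x) (y - x)) \<le> norm (y - x) * e"
    proof (rule differentiable_bound_linearization[where S = "closed_segment x y"])
      show "x + t *\<^sub>R (y - x) \<in> closed_segment x y" if "t \<in> {0..1}" for t
        using that by (auto simp: in_segment algebra_simps intro!: exI[of _ t])
      show "(g has_derivative frechet_derivative g (at z)) (at z within closed_segment x y)"
        if "z \<in> closed_segment x y" for z
        using smooth_on_has_derivative[OF g] seg(1)[OF that] K(3) has_derivative_at_withinI by blast
      show "onorm (frechet_derivative g (at z) - frechet_derivative g (at x)) \<le> e"
        if z: "z \<in> closed_segment x y" for z
        unfolding fun_diff_def
      proof (rule onorm_bound)
        fix v :: 'm
        let ?D = "\<lambda>v. frechet_derivative g (at z) v - frechet_derivative g (at x) v"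
        have "linear ?D" by (intro linear_compose_sub lin seg(1) z xy(1))
        then have "norm (?D v) = norm (\<Sum>b\<in>onb. (v \<bullet> b) *\<^sub>R ?D b)" using linear_eq_sum_onb by metis
        also have "\<dots> \<le> (\<Sum>b\<in>onb. norm ((v \<bullet> b) *\<^sub>R ?D b))" by (rule norm_sum)
        also have "\<dots> \<le> (\<Sum>b\<in>(onb::'m set). norm v * c)"
        proof (rule sum_mono)
          fix b :: 'm assume b: "b \<in> onb"
          then have "\<bar>v \<bullet> b\<bar> \<le> norm v" using Cauchy_Schwarz_ineq2[of v b] by (simp add: norm_onb)
          moreover have "norm (?D b) \<le> c"
            using d(2)[OF xy(1) seg(1)[OF z], of b] seg(2)[OF z] Dd[OF b] by simp
          ultimately show "norm ((v \<bullet> b) *\<^sub>R ?D b) \<le> norm v * c"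
            using c(1) by (simp add: mult_mono)
        qed
        also have "\<dots> = (card (onb::'m set) * c) * norm v" by simp
        also have "\<dots> \<le> e * norm v" by (intro mult_right_mono c) simp
        finally show "norm (?D v) \<le> e * norm v" .
      qed (use e in simp)
    qed simp
    then show "norm (g y - g x - frechet_derivative g (at x) (y - x)) \<le> e * norm (y - x)"
      by (simp add: mult.commute)
  qed
qed

lemma lipschitz_on_compact:
  fixes g :: "'m::fin_dim_inner \<Rightarrow> 'n::real_normed_vector"
  assumes "smooth_on S g" "convex K" "K \<subseteq> S" "x \<in> K" "y \<in> K"
    and L: "L \<ge> 0" "\<And>x v. x \<in> K \<Longrightarrow> norm (frechet_derivative g (at x) v) \<le> L * norm v"
  shows "norm (g x - g y) \<le> L * norm (x - y)"
proof (rule differentiable_bound[OF assms(2) _ _ assms(4,5)])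
  fix x assume "x \<in> K"
  then show "(g has_derivative frechet_derivative g (at x)) (at x within K)"
    using smooth_on_has_derivative[OF assms(1)] assms(3) has_derivative_at_withinI by blast
  show "onorm (frechet_derivative g (at x)) \<le> L" by (rule onorm_bound[OF L(1)]) (rule L(2)[OF \<open>x \<in> K\<close>])
qed

text \<open>Curves \<open>[-e, e] \<rightarrow> 'm\<close> are represented by bounded continuous functions on the whole
  line; the antiderivative is extended constantly beyond \<open>[-e, e]\<close>.\<close>

definition antideriv :: "real \<Rightarrow> (real \<Rightarrow>\<^sub>C 'm::banach) \<Rightarrow> (real \<Rightarrow>\<^sub>C 'm)" where
  "antideriv e g = Bcontfun (\<lambda>t. integral {-e..max (-e) (min e t)} g - integral {-e..0} g)"

lemma apply_Bcontfun_bounded: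
  assumes "continuous_on UNIV f" "\<And>x. norm (f x) \<le> b"
  shows "apply_bcontfun (Bcontfun f) = f"
  using bcontfun_normI[OF assms] by (rule Bcontfun_inverse)

lemma antideriv:
  fixes g :: "real \<Rightarrow>\<^sub>C 'm::banach"
  assumes "e > 0"
  shows "antideriv e g t = integral {-e..max (-e) (min e t)} g - integral {-e..0} g"
    and "norm (antideriv e g) \<le> e * norm g"
proof -
  define G where "G s = integral {-e..s} g" for s
  have dG: "(G has_vector_derivative g s) (at s within {-e..e})" if "s \<in> {-e..e}" for s
    unfolding G_def by (rule integral_has_vector_derivative[OF continuous_on_apply_bcontfun that])
  have bG: "norm (G s - G 0) \<le> e * norm g" if s: "s \<in> {-e..e}" for s
  proof -
    have "norm (G s - G 0) \<le> norm g * norm (s - 0)"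
    proof (rule differentiable_bound[where S = "{-e..e}" and f' = "\<lambda>s h. h *\<^sub>R g s"])
      show "onorm (\<lambda>h. h *\<^sub>R g x) \<le> norm g" for x
        by (rule onorm_le) (use norm_bounded[of g x] in \<open>simp add: mult.commute mult_left_mono\<close>)
    qed (use dG s assms in \<open>auto simp: has_vector_derivative_def\<close>)
    also have "\<dots> \<le> norm g * e" using s by (intro mult_left_mono) auto
    finally show ?thesis by (simp add: mult.commute)
  qed
  have clamp: "max (-e) (min e t) \<in> {-e..e}" for t using assms by auto
  have "continuous_on {-e..e} G"
    unfolding G_def by (intro indefinite_integral_continuous_1 integrable_continuous_real continuous_on_apply_bcontfun)
  then have "continuous_on UNIV (\<lambda>t. G (max (-e) (min e t)))"
    by (rule continuous_on_compose2) (use clamp in \<open>auto intro!: continuous_intros\<close>)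
  then have "continuous_on UNIV (\<lambda>t. G (max (-e) (min e t)) - G 0)"
    by (intro continuous_intros)
  from apply_Bcontfun_bounded[OF this bG[OF clamp]]
  have *: "antideriv e g t = G (max (-e) (min e t)) - G 0" for t
    by (simp add: antideriv_def G_def)
  then show "antideriv e g t = integral {-e..max (-e) (min e t)} g - integral {-e..0} g"
    by (simp add: G_def)
  show "norm (antideriv e g) \<le> e * norm g"
    by (rule norm_bound) (simp only: * bG[OF clamp])
qed

lemma antideriv_has_vector_derivative:
  fixes g :: "real \<Rightarrow>\<^sub>C 'm::banach"
  assumes "\<bar>t\<bar> < e"
  shows "(antideriv e g has_vector_derivative g t) (at t)"
proof -
  have e: "e > 0" using assms by linarith
  have "((\<lambda>u. integral {-e..u} g) has_vector_derivative g t) (at t within {-e..e})"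
    by (rule integral_has_vector_derivative) (use assms in auto)
  then have "((\<lambda>u. integral {-e..u} g) has_vector_derivative g t) (at t)"
    using assms at_within_interior[of t "{-e..e}"] by (simp add: interior_atLeastAtMost_real abs_less_iff)
  from has_vector_derivative_diff[OF this has_vector_derivative_const[of "integral {-e..0} g"]]
  have "((\<lambda>u. integral {-e..u} g - integral {-e..0} g) has_vector_derivative g t) (at t)" by simp
  then show ?thesis
    by (rule has_vector_derivative_transform_within_open[where S = "{-e<..<e}"])
      (use assms in \<open>auto simp: antideriv(1)[OF e] max_def min_def\<close>)
qed

lemma antideriv_0: "e > 0 \<Longrightarrow> antideriv e g 0 = 0"
  by (simp add: antideriv(1))

lemma bounded_linear_antideriv:
  assumes "e > 0" shows "bounded_linear (antideriv e :: (real \<Rightarrow>\<^sub>C 'm::banach) \<Rightarrow> _)"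
proof (rule bounded_linear_intro)
  fix g h :: "real \<Rightarrow>\<^sub>C 'm" and r :: real
  have int: "g integrable_on {a..b}" for g :: "real \<Rightarrow>\<^sub>C 'm" and a b
    by (intro integrable_continuous_real continuous_on_apply_bcontfun)
  have "apply_bcontfun (g + h) = (\<lambda>t. g t + h t)" "apply_bcontfun (r *\<^sub>R g) = (\<lambda>t. r *\<^sub>R g t)" by auto
  then show "antideriv e (g + h) = antideriv e g + antideriv e h" "antideriv e (r *\<^sub>R g) = r *\<^sub>R antideriv e g"
    by (auto intro!: bcontfun_eqI simp: antideriv(1)[OF assms] integral_add int scaleR_diff_right)
  show "norm (antideriv e g) \<le> norm g * e" using antideriv(2)[OF assms, of g] by (simp add: mult.commute)
qed

text \<open>Building block for applying a curve of linear maps to a curve \<open>y\<close>: with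
  \<open>z\<close> the curve of images of \<open>b\<close>, the sum over all \<open>b\<close> in
  \<open>onb\<close> is the pointwise application. Unlike a space of operator-valued curves, this
  stays within one Banach space.\<close>

definition mult_coord :: "'m::real_inner \<Rightarrow> (real \<Rightarrow>\<^sub>C 'm) \<Rightarrow> (real \<Rightarrow>\<^sub>C 'm) \<Rightarrow> (real \<Rightarrow>\<^sub>C 'm)" where
  "mult_coord b y z = Bcontfun (\<lambda>t. (y t \<bullet> b) *\<^sub>R z t)"

lemma mult_coord:
  shows "mult_coord b y z t = (y t \<bullet> b) *\<^sub>R z t" and "norm (mult_coord b y z) \<le> norm y * norm z * norm b"
proof -
  have *: "norm ((y t \<bullet> b) *\<^sub>R z t) \<le> norm y * norm z * norm b" for t
  proof -
    have "\<bar>y t \<bullet> b\<bar> \<le> norm y * norm b"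
      using Cauchy_Schwarz_ineq2[of "y t" b] norm_bounded[of y t] mult_right_mono norm_ge_zero order_trans by metis
    then have "\<bar>y t \<bullet> b\<bar> * norm (z t) \<le> (norm y * norm b) * norm z"
      by (intro mult_mono norm_bounded) auto
    then show ?thesis by (simp add: mult_ac)
  qed
  have "apply_bcontfun (Bcontfun (\<lambda>t. (y t \<bullet> b) *\<^sub>R z t)) = (\<lambda>t. (y t \<bullet> b) *\<^sub>R z t)"
    by (rule apply_Bcontfun_bounded[OF _ *]) (intro continuous_intros continuous_on_apply_bcontfun)
  then show 1: "mult_coord b y z t = (y t \<bullet> b) *\<^sub>R z t" for t by (simp add: mult_coord_def)
  show "norm (mult_coord b y z) \<le> norm y * norm z * norm b" by (rule norm_bound) (simp only: 1 *)
qed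

lemma bounded_bilinear_mult_coord: "bounded_bilinear (mult_coord b)"
proof
  fix y y' z z' :: "real \<Rightarrow>\<^sub>C 'a" and r :: real
  show "mult_coord b (y + y') z = mult_coord b y z + mult_coord b y' z"
    "mult_coord b y (z + z') = mult_coord b y z + mult_coord b y z'"
    "mult_coord b (r *\<^sub>R y) z = r *\<^sub>R mult_coord b y z" "mult_coord b y (r *\<^sub>R z) = r *\<^sub>R mult_coord b y z"
    by (auto intro!: bcontfun_eqI simp: mult_coord(1) inner_add_left algebra_simps)
  show "\<exists>K. \<forall>y z. norm (mult_coord b y z) \<le> norm y * norm z * K" using mult_coord(2) by blast
qed

lemma bounded_bilinear_bounded_linear_comp:
  assumes "bounded_linear f" "bounded_bilinear P" shows "bounded_bilinear (\<lambda>x y. f (P x y))"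
proof -
  interpret f: bounded_linear f by fact
  interpret P: bounded_bilinear P by fact
  show ?thesis
  proof
    obtain K where K: "K > 0" "\<And>x. norm (f x) \<le> norm x * K" using f.pos_bounded by blast
    obtain C where C: "\<And>x y. norm (P x y) \<le> norm x * norm y * C" using P.bounded by blast
    have "norm (f (P x y)) \<le> norm x * norm y * (C * K)" for x y
      using order_trans[OF K(2) mult_right_mono[OF C, of K x y]] K(1) by (simp add: mult_ac)
    then show "\<exists>K. \<forall>x y. norm (f (P x y)) \<le> norm x * norm y * K" by blast
  qed (simp_all add: P.add_left P.add_right P.scaleR_left P.scaleR_right f.add f.scaleR)
qed

instance bcontfun :: (metric_space, banach) banach ..

section \<open>Superposition operators on curves\<close>

text \<open>Also known as the Nemytskii operator. \<open>Bcontfun\<close> returns the intended curve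
  only for bounded continuous arguments; the lemmas ensure this by confining \<open>y\<close> to a
  compact set on which \<open>g\<close> is continuous.\<close>

definition superpos :: "('m::metric_space \<Rightarrow> 'n::metric_space) \<Rightarrow> (real \<Rightarrow>\<^sub>C 'm) \<Rightarrow> (real \<Rightarrow>\<^sub>C 'n)" where
  "superpos g y = Bcontfun (\<lambda>t. g (y t))"

lemma superpos:
  fixes y :: "real \<Rightarrow>\<^sub>C 'm::metric_space" and g :: "'m \<Rightarrow> 'n::real_normed_vector"
  assumes "continuous_on S g" "compact K" "K \<subseteq> S" "y \<in> PiC UNIV (\<lambda>_. K)"
  shows "superpos g y t = g (y t)"
proof -
  have yK: "y t \<in> K" for t using mem_PiCD[OF assms(4)] by auto
  obtain b where b: "\<And>x. x \<in> K \<Longrightarrow> norm (g x) \<le> b"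
    using compact_imp_bounded[OF compact_continuous_image[OF continuous_on_subset[OF assms(1,3)] assms(2)]]
    by (auto simp: bounded_iff)
  have "continuous_on UNIV (\<lambda>t. g (y t))"
    by (rule continuous_on_compose2[OF assms(1) continuous_on_apply_bcontfun]) (use yK assms(3) in auto)
  from apply_Bcontfun_bounded[OF this b[OF yK]] show ?thesis by (simp add: superpos_def)
qed

lemma sum_bcontfun_apply: "apply_bcontfun (\<Sum>i\<in>I. F i) t = (\<Sum>i\<in>I. apply_bcontfun (F i) t)"
  by (induction I rule: infinite_finite_induct) auto

lemma superpos_linear_apply:
  fixes g :: "'m::fin_dim_inner \<Rightarrow> 'm"
  assumes g: "smooth_on S g" and K: "compact K" "K \<subseteq> S" and y: "y \<in> PiC UNIV (\<lambda>_. K)"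
  shows "(\<Sum>b\<in>onb. mult_coord b z (superpos (\<lambda>x. frechet_derivative g (at x) b) y)) t =
    frechet_derivative g (at (y t)) (z t)"
proof -
  have "y t \<in> S" using mem_PiCD[OF y] K(2) by auto
  then have lin: "linear (frechet_derivative g (at (y t)))"
    using smooth_on_has_derivative[OF g] has_derivative_linear by blast
  show ?thesis
    using superpos[OF smooth_on_imp_continuous_on[OF smooth_on_frechet_derivative[OF g]] K y]
    by (simp add: sum_bcontfun_apply mult_coord(1) linear_eq_sum_onb[OF lin, of "z t"])
qed

text \<open>The supremum norm bounds the increment at every time, so the \<open>d\<close> of
  \<open>uniform_linearization\<close> serves all times simultaneously.\<close>

lemma superpos_linearization:
  fixes g :: "'m::fin_dim_inner \<Rightarrow> 'm"
  assumes g: "smooth_on S g" and K: "compact K" "convex K" "K \<subseteq> S" and y: "y \<in> PiC UNIV (\<lambda>_. K)" and e: "e > 0"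
  obtains d where "d > 0" "\<And>z. z \<in> PiC UNIV (\<lambda>_. K) \<Longrightarrow> norm (z - y) < d \<Longrightarrow>
    norm (superpos g z - superpos g y - (\<Sum>b\<in>onb. mult_coord b (z - y) (superpos (\<lambda>x. frechet_derivative g (at x) b) y)))
      \<le> e * norm (z - y)"
proof -
  obtain d where d: "d > 0" "\<And>x y. x \<in> K \<Longrightarrow> y \<in> K \<Longrightarrow> norm (y - x) < d \<Longrightarrow>
    norm (g y - g x - frechet_derivative g (at x) (y - x)) \<le> e * norm (y - x)"
    using uniform_linearization[OF g K e] by blast
  show thesis
  proof (rule that[OF d(1)])
    fix z :: "real \<Rightarrow>\<^sub>C 'm" assume z: "z \<in> PiC UNIV (\<lambda>_. K)" "norm (z - y) < d"
    show "norm (superpos g z - superpos g y - (\<Sum>b\<in>onb. mult_coord b (z - y) (superpos (\<lambda>x. frechet_derivative g (at x) b) y)))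
      \<le> e * norm (z - y)" (is "norm ?r \<le> _")
    proof (rule norm_bound)
      fix t
      have zy: "norm (z t - y t) \<le> norm (z - y)" using norm_bounded[of "z - y" t] by simp
      have "?r t = g (z t) - g (y t) - frechet_derivative g (at (y t)) (z t - y t)"
        using superpos_linear_apply[OF g K(1,3) y, of "z - y" t]
          superpos[OF smooth_on_imp_continuous_on[OF g] K(1,3) y, of t]
          superpos[OF smooth_on_imp_continuous_on[OF g] K(1,3) z(1), of t] by simp
      also have "norm \<dots> \<le> e * norm (z t - y t)"
        by (rule d(2)) (use mem_PiCD[OF y] mem_PiCD[OF z(1)] zy z(2) in auto)
      also have "\<dots> \<le> e * norm (z - y)" using zy e by simp
      finally show "norm (?r t) \<le> e * norm (z - y)" .
    qed
  qed
qed

text \<open>The derivative is relative to the curves with values in \<open>K\<close>, where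
  \<open>superpos g\<close> is the pointwise composition; these form a closed set, whose points need
  not be interior.\<close>

lemma superpos_has_derivative:
  fixes g :: "'m::fin_dim_inner \<Rightarrow> 'm"
  assumes g: "smooth_on S g" and K: "compact K" "convex K" "K \<subseteq> S" and y: "y \<in> PiC UNIV (\<lambda>_. K)"
  shows "(superpos g has_derivative
    (\<lambda>h. \<Sum>b\<in>onb. mult_coord b h (superpos (\<lambda>x. frechet_derivative g (at x) b) y))) (at y within PiC UNIV (\<lambda>_. K))"
  unfolding has_derivative_within_alt
proof (intro conjI allI impI)
  show "bounded_linear (\<lambda>h. \<Sum>b\<in>onb. mult_coord b h (superpos (\<lambda>x. frechet_derivative g (at x) b) y))"
    by (intro bounded_linear_sum bounded_bilinear.bounded_linear_left[OF bounded_bilinear_mult_coord])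
  fix e :: real assume "e > 0"
  then show "\<exists>d>0. \<forall>z\<in>PiC UNIV (\<lambda>_. K). norm (z - y) < d \<longrightarrow>
    norm (superpos g z - superpos g y - (\<Sum>b\<in>onb. mult_coord b (z - y) (superpos (\<lambda>x. frechet_derivative g (at x) b) y)))
      \<le> e * norm (z - y)"
    by (rule superpos_linearization[OF g K y]) blast
qed

text \<open>The coefficients of the derivative are superpositions with the partial derivatives of
  \<open>g\<close>, so the induction generalizes \<open>g\<close>. The relative derivative suffices
  for the chain rule because \<open>y\<close> takes its values in the set concerned and its own
  domain \<open>U\<close> is open.\<close>

lemma Ck_on_superpos:
  fixes g :: "'m::fin_dim_inner \<Rightarrow> 'm" and y :: "'p::real_normed_vector \<Rightarrow> (real \<Rightarrow>\<^sub>C 'm)"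
  assumes K: "compact K" "convex K" "K \<subseteq> S" and U: "open U" and y: "y ` U \<subseteq> PiC UNIV (\<lambda>_. K)"
    and "smooth_on S g" "Ck_on k U y"
  shows "Ck_on k U (\<lambda>x. superpos g (y x))"
  using assms(6,7)
proof (induction k arbitrary: g)
  case 0
  have "continuous_on (PiC UNIV (\<lambda>_. K)) (superpos g)"
    using has_derivative_continuous[OF superpos_has_derivative[OF 0(1) K]]
    by (simp add: continuous_on_eq_continuous_within)
  then show ?case using continuous_on_compose2[OF _ _ y] 0(2) by auto
next
  case (Suc k)
  note g = Suc.prems(1)
  let ?y' = "\<lambda>x. frechet_derivative y (at x)" and ?g = "\<lambda>b x. superpos (\<lambda>x. frechet_derivative g (at x) b) (y x)"
  show ?case
  proof (rule Ck_on_SucI[OF U, where f' = "\<lambda>x v. \<Sum>b\<in>onb. mult_coord b (?y' x v) (?g b x)"])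
    fix x assume x: "x \<in> U"
    have "(superpos g has_derivative (\<lambda>h. \<Sum>b\<in>onb. mult_coord b h (?g b x))) (at (y x) within y ` U)"
      by (rule has_derivative_subset[OF superpos_has_derivative[OF g K] y]) (use x y in auto)
    from has_derivative_in_compose[OF has_derivative_at_withinI[OF Ck_on_SucD(1)[OF Suc.prems(2) x]] this]
    show "((\<lambda>x. superpos g (y x)) has_derivative (\<lambda>v. \<Sum>b\<in>onb. mult_coord b (?y' x v) (?g b x))) (at x)"
      using at_within_open[OF x U] by simp
  next
    show "Ck_on k U (\<lambda>x. \<Sum>b\<in>onb. mult_coord b (?y' x v) (?g b x))" for v
      by (intro Ck_on_sum[OF U] Ck_on_bilinear[OF U bounded_bilinear_mult_coord] Ck_on_SucD(2)[OF Suc.prems(2)]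
          Suc.IH smooth_on_frechet_derivative[OF g] Ck_on_mono_Suc[OF Suc.prems(2)])
  qed
qed

section \<open>The Picard operator and smoothness of its fixed point\<close>

lemma bounded_linear_const_bcontfun: "bounded_linear (const_bcontfun :: 'm::real_normed_vector \<Rightarrow> (real \<Rightarrow>\<^sub>C 'm))"
  by (rule bounded_linear_intro[where K = 1]) (auto intro!: bcontfun_eqI norm_bound)

text \<open>\<open>eL\<close> makes the integral operator a contraction with constant 1/2, and
  \<open>eB\<close> keeps curves that start within \<open>R / 2\<close> of \<open>x0\<close> inside
  the ball of radius \<open>R\<close> on which the bounds \<open>L\<close> and \<open>B\<close>
  hold.\<close>

locale picard =
  fixes f :: "'m::fin_dim_inner \<Rightarrow> 'm" and S :: "'m set" and x0 :: 'm and R e L B :: real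
  assumes f: "smooth_on S f" and R: "R > 0" and K: "cball x0 R \<subseteq> S" and e: "e > 0"
    and L: "L \<ge> 0" "\<And>x v. x \<in> cball x0 R \<Longrightarrow> norm (frechet_derivative f (at x) v) \<le> L * norm v"
    and eL: "e * L \<le> 1 / 2"
    and B: "\<And>x. x \<in> cball x0 R \<Longrightarrow> norm (f x) \<le> B" and eB: "e * B \<le> R / 2"
begin

abbreviation curves :: "(real \<Rightarrow>\<^sub>C 'm) set" where
  "curves \<equiv> PiC UNIV (\<lambda>_. cball x0 R)"

lemma superpos_f: "y \<in> curves \<Longrightarrow> superpos f y t = f (y t)"
  by (rule superpos[OF smooth_on_imp_continuous_on[OF f] compact_cball K])

lemma curvesD: "y \<in> curves \<Longrightarrow> y t \<in> cball x0 R"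
  by (simp add: mem_PiC_iff Pi_iff)

lemma contraction:
  assumes "y \<in> curves" "z \<in> curves"
  shows "norm (antideriv e (superpos f y) - antideriv e (superpos f z)) \<le> norm (y - z) / 2"
proof -
  interpret I: bounded_linear "antideriv e :: (real \<Rightarrow>\<^sub>C 'm) \<Rightarrow> _" by (rule bounded_linear_antideriv[OF e])
  have "norm (superpos f y - superpos f z) \<le> L * norm (y - z)"
  proof (rule norm_bound)
    fix t
    have "norm (f (y t) - f (z t)) \<le> L * norm (y t - z t)"
      by (rule lipschitz_on_compact[OF f convex_cball K curvesD[OF assms(1)] curvesD[OF assms(2)] L])
    also have "\<dots> \<le> L * norm (y - z)"
      using norm_bounded[of "y - z" t] L(1) by (intro mult_left_mono) auto
    finally show "norm ((superpos f y - superpos f z) t) \<le> L * norm (y - z)"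
      by (simp add: superpos_f assms)
  qed
  then have "norm (antideriv e (superpos f y - superpos f z)) \<le> e * (L * norm (y - z))"
    using antideriv(2)[OF e, of "superpos f y - superpos f z"] e mult_left_mono order_trans by fastforce
  also have "\<dots> \<le> 1 / 2 * norm (y - z)" using mult_right_mono[OF eL norm_ge_zero] by (simp add: mult.assoc)
  finally show ?thesis by (simp add: I.diff)
qed

lemma ex1_solution:
  assumes x: "x \<in> cball x0 (R / 2)"
  shows "\<exists>!y. y \<in> curves \<and> const_bcontfun x + antideriv e (superpos f y) = y"
proof -
  have "\<exists>!y\<in>curves. const_bcontfun x + antideriv e (superpos f y) = y"
  proof (rule Banach_fix[where c = "1/2"])
    show "complete curves" by (simp add: complete_eq_closed closed_PiC)
    show "curves \<noteq> {}" using R by (intro ex_in_conv[THEN iffD1] exI[of _ "const_bcontfun x0"]) (simp add: mem_PiC_iff)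
    show "(\<lambda>y. const_bcontfun x + antideriv e (superpos f y)) ` curves \<subseteq> curves"
    proof safe
      fix y assume y: "y \<in> curves"
      have "norm (superpos f y) \<le> B" by (rule norm_bound) (simp add: superpos_f[OF y] B[OF curvesD[OF y]])
      then have "norm (antideriv e (superpos f y)) \<le> R / 2"
        using antideriv(2)[OF e, of "superpos f y"] mult_left_mono[of "norm (superpos f y)" B e] e eB by linarith
      then have 1: "norm (antideriv e (superpos f y) t) \<le> R / 2" for t
        using norm_bounded order_trans by blast
      have "norm (x - x0 + antideriv e (superpos f y) t) \<le> R" for t
        using norm_triangle_ineq[of "x - x0" "antideriv e (superpos f y) t"] 1[of t] x
        by (simp add: dist_norm norm_minus_commute)
      then show "const_bcontfun x + antideriv e (superpos f y) \<in> curves"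
        by (simp add: mem_PiC_iff dist_norm norm_minus_commute algebra_simps)
    qed
    show "dist (const_bcontfun x + antideriv e (superpos f y)) (const_bcontfun x + antideriv e (superpos f z)) \<le> 1/2 * dist y z"
      if "y \<in> curves" "z \<in> curves" for y z using contraction[OF that] by (simp add: dist_norm)
  qed auto
  then show ?thesis by simp
qed

definition sol :: "'m \<Rightarrow> (real \<Rightarrow>\<^sub>C 'm)" where
  "sol x = (THE y. y \<in> curves \<and> const_bcontfun x + antideriv e (superpos f y) = y)"

lemma sol:
  assumes "x \<in> cball x0 (R / 2)"
  shows "sol x \<in> curves" "sol x = const_bcontfun x + antideriv e (superpos f (sol x))"
  using theI'[OF ex1_solution[OF assms]] unfolding sol_def[symmetric] by simp_all

text \<open>The factor 2 is \<open>1 / (1 - 1/2)\<close>, from the contraction constant. Besides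
  continuity, this converts remainders that are small relative to the increment of
  \<open>sol\<close> into remainders small relative to the increment of the initial value.\<close>

lemma sol_lipschitz:
  assumes "x \<in> cball x0 (R / 2)" "y \<in> cball x0 (R / 2)"
  shows "norm (sol x - sol y) \<le> 2 * norm (x - y)"
proof -
  interpret C: bounded_linear "const_bcontfun :: 'm \<Rightarrow> (real \<Rightarrow>\<^sub>C 'm)" by (rule bounded_linear_const_bcontfun)
  let ?d = "antideriv e (superpos f (sol x)) - antideriv e (superpos f (sol y))"
  have "sol x - sol y = const_bcontfun (x - y) + ?d"
    using sol(2)[OF assms(1)] sol(2)[OF assms(2)] by (simp add: C.diff algebra_simps)
  then have "norm (sol x - sol y) \<le> norm (const_bcontfun (x - y) :: real \<Rightarrow>\<^sub>C 'm) + norm ?d"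
    using norm_triangle_ineq by metis
  moreover have "norm (const_bcontfun (x - y) :: real \<Rightarrow>\<^sub>C 'm) \<le> norm (x - y)" by (rule norm_bound) simp
  ultimately show ?thesis using contraction[OF sol(1)[OF assms(1)] sol(1)[OF assms(2)]] by simp
qed

text \<open>The linearization of \<open>antideriv e \<circ> superpos f\<close> at the curve
  \<open>sol x\<close>. The sum stands outside the integral to match the form of the operator in
  \<open>Ck_on_linear_fixed_point\<close>.\<close>

abbreviation lin_op :: "'m \<Rightarrow> (real \<Rightarrow>\<^sub>C 'm) \<Rightarrow> (real \<Rightarrow>\<^sub>C 'm)" where
  "lin_op x z \<equiv> \<Sum>b\<in>onb. antideriv e (mult_coord b z (superpos (\<lambda>x. frechet_derivative f (at x) b) (sol x)))"

lemma lin_op: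
  assumes "x \<in> cball x0 (R / 2)"
  shows "lin_op x z = antideriv e (\<Sum>b\<in>onb. mult_coord b z (superpos (\<lambda>x. frechet_derivative f (at x) b) (sol x)))"
    "norm (lin_op x z) \<le> norm z / 2"
proof -
  interpret I: bounded_linear "antideriv e :: (real \<Rightarrow>\<^sub>C 'm) \<Rightarrow> _" by (rule bounded_linear_antideriv[OF e])
  let ?s = "\<Sum>b\<in>onb. mult_coord b z (superpos (\<lambda>x. frechet_derivative f (at x) b) (sol x))"
  show 1: "lin_op x z = antideriv e ?s" by (simp add: I.sum)
  have "norm ?s \<le> L * norm z"
  proof (rule norm_bound)
    fix t
    have "norm (?s t) \<le> L * norm (z t)"
      unfolding superpos_linear_apply[OF f compact_cball K sol(1)[OF assms]] by (rule L(2)[OF curvesD[OF sol(1)[OF assms]]])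
    also have "\<dots> \<le> L * norm z" by (intro mult_left_mono norm_bounded L)
    finally show "norm (?s t) \<le> L * norm z" .
  qed
  then have "norm (antideriv e ?s) \<le> e * (L * norm z)"
    using antideriv(2)[OF e, of ?s] e mult_left_mono order_trans by fastforce
  also have "\<dots> \<le> 1 / 2 * norm z" using mult_right_mono[OF eL norm_ge_zero] by (simp add: mult.assoc)
  finally show "norm (lin_op x z) \<le> norm z / 2" by (simp add: 1)
qed

lemma bilinear_op: "bounded_bilinear (\<lambda>y z. antideriv e (mult_coord b y z :: real \<Rightarrow>\<^sub>C 'm))"
  by (rule bounded_bilinear_bounded_linear_comp[OF bounded_linear_antideriv[OF e] bounded_bilinear_mult_coord])

text \<open>With \<open>r y\<close> the remainder in the linearization of \<open>superpos f\<close>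
  at \<open>sol x\<close>, the increment of \<open>sol\<close> solves a linear equation with
  operator \<open>lin_op x\<close> and inhomogeneity
  \<open>const_bcontfun (y - x) + antideriv e (r y)\<close>. Applying the inverse \<open>Q\<close>
  gives the increment in closed form, and \<open>r\<close> has derivative 0 by the Lipschitz
  estimate.\<close>

lemma sol_has_derivative:
  assumes x: "x \<in> ball x0 (R / 2)"
  shows "\<exists>w. (sol has_derivative w) (at x) \<and> (\<forall>v. w v = const_bcontfun v + lin_op x (w v))"
proof -
  interpret C: bounded_linear "const_bcontfun :: 'm \<Rightarrow> (real \<Rightarrow>\<^sub>C 'm)" by (rule bounded_linear_const_bcontfun)
  interpret I: bounded_linear "antideriv e :: (real \<Rightarrow>\<^sub>C 'm) \<Rightarrow> _" by (rule bounded_linear_antideriv[OF e])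
  have x': "x \<in> cball x0 (R / 2)" using x by auto
  define T where "T = lin_op x"
  have T: "bounded_linear T" "\<And>z. norm (T z) \<le> norm z / 2"
    unfolding T_def by (intro bounded_linear_sum bounded_bilinear.bounded_linear_left[OF bilinear_op], rule lin_op(2)[OF x'])
  obtain Q where "bounded_linear Q" "\<And>c z. z = c + T z \<Longrightarrow> z = Q c" "\<And>c. Q c = c + T (Q c)"
    using linear_fixed_point_solver[OF T] by blast
  note Q = this[unfolded T_def]
  interpret Q: bounded_linear Q by (rule Q(1))
  let ?D = "\<lambda>z. \<Sum>b\<in>onb. mult_coord b z (superpos (\<lambda>x. frechet_derivative f (at x) b) (sol x))"
  define r where "r y = superpos f (sol y) - superpos f (sol x) - ?D (sol y - sol x)" for y
  have rx: "r x = 0" by (simp add: r_def bounded_bilinear.zero_left[OF bounded_bilinear_mult_coord])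
  have r: "(r has_derivative (\<lambda>h. 0)) (at x within ball x0 (R / 2))"
    unfolding has_derivative_within_alt
  proof (intro conjI allI impI)
    fix \<eta> :: real assume "\<eta> > 0"
    \<comment> \<open>Half of \<open>\<eta>\<close> absorbs the Lipschitz factor 2 of
      \<open>sol\<close>.\<close>
    then have "\<eta> / 2 > 0" by simp
    from superpos_linearization[OF f compact_cball convex_cball K sol(1)[OF x'] this]
    obtain d where d: "d > 0" "\<And>z. z \<in> curves \<Longrightarrow> norm (z - sol x) < d \<Longrightarrow>
      norm (superpos f z - superpos f (sol x) - ?D (z - sol x)) \<le> \<eta> / 2 * norm (z - sol x)" by blast
    have "norm (r y) \<le> \<eta> * norm (y - x)" if y: "y \<in> ball x0 (R / 2)" "norm (y - x) < d / 2" for y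
    proof -
      have y': "y \<in> cball x0 (R / 2)" using y by auto
      have l: "norm (sol y - sol x) \<le> 2 * norm (y - x)" by (rule sol_lipschitz[OF y' x'])
      have "norm (r y) \<le> \<eta> / 2 * norm (sol y - sol x)"
        unfolding r_def by (rule d(2)[OF sol(1)[OF y']]) (use l y(2) in linarith)
      also have "\<dots> \<le> \<eta> / 2 * (2 * norm (y - x))" by (rule mult_left_mono[OF l]) (use \<open>\<eta> > 0\<close> in simp)
      finally show ?thesis by simp
    qed
    then show "\<exists>d>0. \<forall>y\<in>ball x0 (R / 2). norm (y - x) < d \<longrightarrow> norm (r y - r x - 0) \<le> \<eta> * norm (y - x)"
      using d(1) rx by (intro exI[of _ "d / 2"]) auto
  qed simp
  have eq: "sol x + Q (const_bcontfun (y - x) + antideriv e (r y)) = sol y" if y: "y \<in> ball x0 (R / 2)" for y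
  proof -
    have y': "y \<in> cball x0 (R / 2)" using y by auto
    have "lin_op x (sol y - sol x) + antideriv e (r y) = antideriv e (superpos f (sol y)) - antideriv e (superpos f (sol x))"
      by (simp only: r_def I.diff lin_op(1)[OF x']) simp
    from eq_diffI[OF sol(2)[OF x'] sol(2)[OF y'] this]
    have "sol y - sol x = (const_bcontfun (y - x) + antideriv e (r y)) + lin_op x (sol y - sol x)"
      by (simp only: C.diff)
    from Q(2)[OF this] show ?thesis by (metis add.commute diff_add_cancel)
  qed
  have "((\<lambda>y. sol x + Q (const_bcontfun (y - x) + antideriv e (r y))) has_derivative
    (\<lambda>v. 0 + Q (const_bcontfun (v - 0) + antideriv e 0))) (at x within ball x0 (R / 2))"
    by (intro has_derivative_add has_derivative_const Q.has_derivative C.has_derivative I.has_derivative r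
        has_derivative_diff has_derivative_ident)
  then have "((\<lambda>y. sol x + Q (const_bcontfun (y - x) + antideriv e (r y))) has_derivative (\<lambda>v. Q (const_bcontfun v))) (at x)"
    using at_within_open[OF x open_ball] by (simp add: I.zero)
  from has_derivative_transform_within_open[OF this open_ball x eq] Q(3) show ?thesis by blast
qed

lemma Ck_on_sol: "Ck_on k (ball x0 (R / 2)) sol"
proof (induction k)
  case 0
  have "2-lipschitz_on (ball x0 (R / 2)) sol"
    using sol_lipschitz by (intro lipschitz_onI) (auto simp: dist_norm)
  then show ?case using lipschitz_on_continuous_on by auto
next
  case (Suc k)
  let ?U = "ball x0 (R / 2)"
  have "\<forall>x\<in>?U. \<exists>w. (sol has_derivative w) (at x) \<and> (\<forall>v. w v = const_bcontfun v + lin_op x (w v))"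
    using sol_has_derivative by blast
  then obtain w where "\<forall>x\<in>?U. (sol has_derivative w x) (at x) \<and> (\<forall>v. w x v = const_bcontfun v + lin_op x (w x v))"
    by (rule bchoice[THEN exE])
  then have w: "(sol has_derivative w x) (at x)" "w x v = const_bcontfun v + lin_op x (w x v)" if "x \<in> ?U" for x v
    using that by blast+
  show ?case
  proof (rule Ck_on_SucI[OF open_ball w(1)])
    fix v
    show "Ck_on k ?U (\<lambda>x. w x v)"
    proof (rule Ck_on_linear_fixed_point[where U = ?U and I = onb and b = "\<lambda>x. const_bcontfun v"
          and P = "\<lambda>b y z. antideriv e (mult_coord b y z)"
          and a = "\<lambda>b x. superpos (\<lambda>x. frechet_derivative f (at x) b) (sol x)",
          OF open_ball bilinear_op _ _ Ck_on_const w(2)])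
      show "norm (lin_op x z) \<le> norm z / 2" if "x \<in> ?U" for x z by (rule lin_op(2)) (use that in auto)
      show "Ck_on k ?U (\<lambda>x. superpos (\<lambda>x. frechet_derivative f (at x) b) (sol x))" for b
        by (rule Ck_on_superpos[OF compact_cball convex_cball K open_ball _ smooth_on_frechet_derivative[OF f] Suc.IH])
          (use sol(1) in auto)
    qed
  qed
qed

end

text \<open>The curves of \<open>picard\<close> are extended constantly beyond the time interval, so
  they stay in \<open>S\<close> and depend smoothly on \<open>x\<close> at every time; only the
  differential equation is tied to times below \<open>e\<close>.\<close>

lemma local_flow_exists:
  fixes f :: "'m::fin_dim_inner \<Rightarrow> 'm"
  assumes S: "open S" and f: "smooth_on S f" and x0: "x0 \<in> S"
  obtains F :: "real \<Rightarrow> 'm \<Rightarrow> 'm" and r e where "r > 0" "e > 0" "ball x0 r \<subseteq> S"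
    "\<And>x. x \<in> ball x0 r \<Longrightarrow> F 0 x = x"
    "\<And>t x. x \<in> ball x0 r \<Longrightarrow> F t x \<in> S"
    "\<And>t x. x \<in> ball x0 r \<Longrightarrow> \<bar>t\<bar> < e \<Longrightarrow> ((\<lambda>t. F t x) has_vector_derivative f (F t x)) (at t)"
    "\<And>t. smooth_on (ball x0 r) (F t)"
proof -
  obtain R where R: "R > 0" "cball x0 R \<subseteq> S" using S x0 open_contains_cball by metis
  obtain L where L: "L \<ge> 0" "\<And>x v. x \<in> cball x0 R \<Longrightarrow> norm (frechet_derivative f (at x) v) \<le> L * norm v"
    using derivative_bound_compact[OF f compact_cball R(2)] by blast
  obtain B where "\<forall>y\<in>f ` cball x0 R. norm y \<le> B"
    using compact_imp_bounded[OF compact_continuous_image[OF continuous_on_subset[OF smooth_on_imp_continuous_on[OF f] R(2)] compact_cball]]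
    unfolding bounded_iff by blast
  then have B: "norm (f x) \<le> B" if "x \<in> cball x0 R" for x using that by blast
  have B0: "B \<ge> 0" using order_trans[OF norm_ge_zero B[of x0]] R(1) by simp
  \<comment> \<open>One bound for each smallness condition of \<open>picard\<close>; adding 1 avoids
    division by zero when \<open>L\<close> or \<open>B\<close> vanishes.\<close>
  define e where "e = min (1 / (2 * (L + 1))) (R / (2 * (B + 1)))"
  have e: "e > 0" using L(1) B0 R(1) by (simp add: e_def)
  have eL: "e * L \<le> 1 / 2"
  proof -
    have "e * L \<le> e * (L + 1)" using e by simp
    also have "\<dots> \<le> 1 / (2 * (L + 1)) * (L + 1)" using L(1) by (intro mult_right_mono) (auto simp: e_def)
    also have "\<dots> = 1 / 2" using L(1) by (simp add: field_simps)
    finally show ?thesis .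
  qed
  have eB: "e * B \<le> R / 2"
  proof -
    have "e * B \<le> e * (B + 1)" using e by simp
    also have "\<dots> \<le> R / (2 * (B + 1)) * (B + 1)" using B0 by (intro mult_right_mono) (auto simp: e_def)
    also have "\<dots> = R / 2" using B0 by (simp add: field_simps)
    finally show ?thesis .
  qed
  interpret picard f S x0 R e L B by unfold_locales (fact f R L B e eL eB)+
  have in_cball: "x \<in> ball x0 (R / 2) \<Longrightarrow> x \<in> cball x0 (R / 2)" for x by auto
  show thesis
  proof (rule that[of "R / 2" e "\<lambda>t x. sol x t"])
    show "ball x0 (R / 2) \<subseteq> S" using R by (auto intro!: subsetD[OF K])
    fix x assume x: "x \<in> ball x0 (R / 2)"
    note s = sol[OF in_cball[OF x]]
    have st: "sol x t = x + antideriv e (superpos f (sol x)) t" for t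
      by (subst s(2)) simp
    show "sol x 0 = x" by (simp add: st antideriv_0[OF e])
    show "sol x t \<in> S" for t using curvesD[OF s(1)] K by blast
    show "(sol x has_vector_derivative f (sol x t)) (at t)" if "\<bar>t\<bar> < e" for t
    proof -
      have "((\<lambda>t. x + antideriv e (superpos f (sol x)) t) has_vector_derivative (0 + superpos f (sol x) t)) (at t)"
        by (intro has_vector_derivative_add has_vector_derivative_const antideriv_has_vector_derivative that)
      then show ?thesis by (simp add: st[abs_def, symmetric] superpos_f[OF s(1)])
    qed
  next
    have lin: "bounded_linear (\<lambda>y :: real \<Rightarrow>\<^sub>C 'm. y t)" for t
      by (rule bounded_linear_intro[where K = 1]) (auto simp: norm_bounded)
    show "smooth_on (ball x0 (R / 2)) (\<lambda>x. sol x t)" for t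
      unfolding smooth_on_def using Ck_on_bounded_linear[OF open_ball lin Ck_on_sol] by blast
  qed (use R e in auto)
qed

section \<open>Smooth maps between charted spaces\<close>

text \<open>The part of the manifold axioms that concerns charts only, in terms of open sets.\<close>

definition charted :: "('a, 'm::fin_dim_inner) manifold \<Rightarrow> bool" where
  "charted M \<longleftrightarrow> (\<forall>p\<in>points M. \<exists>c\<in>atlas M. p \<in> fst c) \<and>
    (\<forall>c\<in>atlas M. openin (mtop M) (fst c) \<and> inj_on (snd c) (fst c) \<and>
      (\<forall>W. openin (mtop M) W \<and> W \<subseteq> fst c \<longrightarrow> open (snd c ` W)) \<and>
      (\<forall>G. open G \<longrightarrow> openin (mtop M) {p \<in> fst c. snd c p \<in> G})) \<and>
    (\<forall>c\<in>atlas M. \<forall>d\<in>atlas M. smooth_on (snd c ` (fst c \<inter> fst d)) (snd d \<circ> chart_inv c))"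

lemma chartedD:
  assumes "charted M"
  shows "p \<in> points M \<Longrightarrow> \<exists>c\<in>atlas M. p \<in> fst c"
    and "c \<in> atlas M \<Longrightarrow> openin (mtop M) (fst c)"
    and "c \<in> atlas M \<Longrightarrow> inj_on (snd c) (fst c)"
    and "c \<in> atlas M \<Longrightarrow> openin (mtop M) W \<Longrightarrow> W \<subseteq> fst c \<Longrightarrow> open (snd c ` W)"
    and "c \<in> atlas M \<Longrightarrow> open G \<Longrightarrow> openin (mtop M) {p \<in> fst c. snd c p \<in> G}"
    and "c \<in> atlas M \<Longrightarrow> d \<in> atlas M \<Longrightarrow> smooth_on (snd c ` (fst c \<inter> fst d)) (snd d \<circ> chart_inv c)"
  using assms by (auto simp: charted_def)

lemma smooth_manifold_charted:
  assumes "smooth_manifold M" shows "charted M"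
  unfolding charted_def
proof (intro conjI ballI allI impI)
  fix c assume c: "c \<in> atlas M"
  then have o: "openin (mtop M) (fst c)" and oi: "open (snd c ` fst c)"
    and h: "homeomorphic_map (subtopology (mtop M) (fst c)) (top_of_set (snd c ` fst c)) (snd c)"
    using assms by (auto simp: smooth_manifold_def)
  have sub: "fst c \<subseteq> points M" using openin_subset[OF o] .
  show "openin (mtop M) (fst c)" by fact
  show "inj_on (snd c) (fst c)"
    using homeomorphic_imp_injective_map[OF h] sub by (simp add: Int_absorb1)
  show "open (snd c ` W)" if "openin (mtop M) W \<and> W \<subseteq> fst c" for W
  proof -
    have "openin (subtopology (mtop M) (fst c)) W"
      using that o by (simp add: openin_open_subtopology)
    then have "openin (top_of_set (snd c ` fst c)) (snd c ` W)"
      using homeomorphic_imp_open_map[OF h] by (simp add: open_map_def)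
    then show ?thesis using oi openin_open_trans by blast
  qed
  show "openin (mtop M) {p \<in> fst c. snd c p \<in> G}" if "open G" for G
  proof -
    have "continuous_map (subtopology (mtop M) (fst c)) euclidean (snd c)"
      using homeomorphic_imp_continuous_map[OF h] continuous_map_in_subtopology by blast
    then have "openin (subtopology (mtop M) (fst c)) {p \<in> topspace (subtopology (mtop M) (fst c)). snd c p \<in> G}"
      using that by (intro openin_continuous_map_preimage) auto
    then show ?thesis using o sub by (simp add: openin_open_subtopology Int_absorb1)
  qed
qed (use assms in \<open>auto simp: smooth_manifold_def\<close>)

lemma chart_inv:
  assumes "charted M" "c \<in> atlas M"
  shows "p \<in> fst c \<Longrightarrow> chart_inv c (snd c p) = p"
    and "y \<in> snd c ` fst c \<Longrightarrow> chart_inv c y \<in> fst c"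
    and "y \<in> snd c ` fst c \<Longrightarrow> snd c (chart_inv c y) = y"
  using chartedD(3)[OF assms] by (auto simp: chart_inv_def inv_into_f_f f_inv_into_f inv_into_into)

lemma open_chart_image: "charted M \<Longrightarrow> c \<in> atlas M \<Longrightarrow> open (snd c ` fst c)"
  using chartedD(2,4) by blast

lemma chart_subset_points: "charted M \<Longrightarrow> c \<in> atlas M \<Longrightarrow> fst c \<subseteq> points M"
  using chartedD(2) openin_subset by blast

text \<open>Continuity near the point is implied, see \<open>smooth_chart_continuous\<close>.\<close>

definition smooth_near ::
  "('a, 'm::fin_dim_inner) manifold \<Rightarrow> ('b, 'n::fin_dim_inner) manifold \<Rightarrow> ('a \<Rightarrow> 'b) \<Rightarrow> 'a \<Rightarrow> bool" where
  "smooth_near M N f p \<longleftrightarrow> (\<exists>c\<in>atlas M. \<exists>d\<in>atlas N. \<exists>W. openin (mtop M) W \<and> p \<in> W \<and> W \<subseteq> fst c \<and>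
     f ` W \<subseteq> fst d \<and> smooth_on (snd c ` W) (snd d \<circ> f \<circ> chart_inv c))"

text \<open>The charts are injective and carry open sets to open sets in both directions, so the
  preimage of \<open>V\<close> can be computed from the continuous coordinate expression. Since
  \<open>f\<close> maps \<open>W\<close> into \<open>fst d\<close>, intersecting \<open>V\<close>
  with that domain loses nothing.\<close>

lemma smooth_chart_continuous:
  assumes M: "charted M" and N: "charted N" and c: "c \<in> atlas M" and d: "d \<in> atlas N"
    and W: "openin (mtop M) W" "W \<subseteq> fst c" "f ` W \<subseteq> fst d"
    and s: "smooth_on (snd c ` W) (snd d \<circ> f \<circ> chart_inv c)" and V: "openin (mtop N) V"
  shows "openin (mtop M) {p \<in> W. f p \<in> V}"
proof -
  let ?g = "snd d \<circ> f \<circ> chart_inv c" and ?V = "snd d ` (V \<inter> fst d)"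
  have "open ?V" using chartedD(4)[OF N d] V chartedD(2)[OF N d] by (simp add: openin_Int)
  moreover have "open (snd c ` W)" using chartedD(4)[OF M c] W by blast
  ultimately have "open (?g -` ?V \<inter> snd c ` W)"
    using smooth_on_imp_continuous_on[OF s] continuous_on_open_vimage by blast
  then have "openin (mtop M) {p \<in> fst c. snd c p \<in> ?g -` ?V \<inter> snd c ` W}"
    by (rule chartedD(5)[OF M c])
  moreover have "{p \<in> fst c. snd c p \<in> ?g -` ?V \<inter> snd c ` W} = {p \<in> W. f p \<in> V}"
  proof (intro equalityI subsetI)
    fix p assume p: "p \<in> {p \<in> fst c. snd c p \<in> ?g -` ?V \<inter> snd c ` W}"
    then obtain q where q: "snd c p = snd c q" "q \<in> W" by auto
    then have pq: "p = q" using chartedD(3)[OF M c] W(2) p by (auto dest: inj_onD)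
    obtain v where v: "?g (snd c p) = snd d v" "v \<in> V" "v \<in> fst d" using p by auto
    have "snd d (f p) = snd d v" using v(1) chart_inv(1)[OF M c] p by simp
    then have "f p = v" using chartedD(3)[OF N d] v(3) W(3) q(2) pq by (auto dest: inj_onD)
    then show "p \<in> {p \<in> W. f p \<in> V}" using v(2) pq q(2) by simp
  qed (use W chart_inv(1)[OF M c] in \<open>auto simp: image_iff subset_iff\<close>)
  ultimately show ?thesis by simp
qed

text \<open>\<open>smooth_near\<close> provides some pair of charts; this passes to any prescribed
  pair by composing with the transition maps on both sides. The sets \<open>A\<close> and
  \<open>B\<close> allow the neighbourhood and its image to be shrunk at the same time.\<close>

lemma smooth_near_charts:
  assumes M: "charted M" and N: "charted N" and f: "smooth_near M N f p"
    and c: "c \<in> atlas M" "p \<in> fst c" and d: "d \<in> atlas N" "f p \<in> fst d"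
    and A: "openin (mtop M) A" "p \<in> A" and B: "openin (mtop N) B" "f p \<in> B"
  obtains W where "openin (mtop M) W" "p \<in> W" "W \<subseteq> fst c \<inter> A" "f ` W \<subseteq> fst d \<inter> B"
    "smooth_on (snd c ` W) (snd d \<circ> f \<circ> chart_inv c)"
proof -
  obtain c' d' W' where c': "c' \<in> atlas M" and d': "d' \<in> atlas N" and W': "openin (mtop M) W'" "p \<in> W'"
    "W' \<subseteq> fst c'" "f ` W' \<subseteq> fst d'" and s: "smooth_on (snd c' ` W') (snd d' \<circ> f \<circ> chart_inv c')"
    using f unfolding smooth_near_def by blast
  define W where "W = {q \<in> W'. f q \<in> fst d \<inter> B} \<inter> fst c \<inter> A"
  have W: "openin (mtop M) W"
    unfolding W_def by (intro openin_Int smooth_chart_continuous[OF M N c' d' W'(1,3,4) s]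
        chartedD(2)[OF M c(1)] chartedD(2)[OF N d(1)] A B)
  have sub: "W \<subseteq> fst c" "W \<subseteq> W'" "f ` W \<subseteq> fst d" "W \<subseteq> A" "f ` W \<subseteq> B" by (auto simp: W_def)
  let ?a = "snd c' \<circ> chart_inv c" and ?b = "snd d' \<circ> f \<circ> chart_inv c'" and ?e = "snd d \<circ> chart_inv d'"
  have oW: "open (snd c ` W)" using chartedD(4)[OF M c(1) W sub(1)] .
  have oW': "open (snd c' ` W)" using chartedD(4)[OF M c' W] sub(2) W'(3) by blast
  have od: "open (snd d' ` (fst d' \<inter> fst d))"
    by (rule chartedD(4)[OF N d']) (auto intro: openin_Int chartedD(2)[OF N] d d')
  have a: "smooth_on (snd c ` W) ?a"
    by (rule smooth_on_subset[OF chartedD(6)[OF M c(1) c']]) (use sub W' in blast)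
  have inv: "chart_inv c (snd c q) = q" "chart_inv c' (snd c' q) = q" "chart_inv d' (snd d' (f q)) = f q"
    if "q \<in> W" for q
  proof -
    show "chart_inv c (snd c q) = q" by (rule chart_inv(1)[OF M c(1)]) (use that sub in blast)
    show "chart_inv c' (snd c' q) = q" by (rule chart_inv(1)[OF M c']) (use that sub W' in blast)
    show "chart_inv d' (snd d' (f q)) = f q" by (rule chart_inv(1)[OF N d']) (use that sub W' in blast)
  qed
  have ai: "?a ` snd c ` W \<subseteq> snd c' ` W" using inv(1) by auto
  have ba: "smooth_on (snd c ` W) (\<lambda>y. ?b (?a y))"
    by (rule smooth_on_compose[OF oW oW' a _ ai]) (rule smooth_on_subset[OF s], use sub in blast)
  have bi: "(\<lambda>y. ?b (?a y)) ` snd c ` W \<subseteq> snd d' ` (fst d' \<inter> fst d)"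
  proof (safe)
    fix q assume q: "q \<in> W"
    have "?b (?a (snd c q)) = snd d' (f q)" using inv(1,2)[OF q] by simp
    moreover have "f q \<in> fst d' \<inter> fst d" using q sub W' by blast
    ultimately show "?b (?a (snd c q)) \<in> snd d' ` (fst d' \<inter> fst d)" by simp
  qed
  have "smooth_on (snd c ` W) (\<lambda>y. ?e (?b (?a y)))"
    by (rule smooth_on_compose[OF oW od ba chartedD(6)[OF N d' d(1)] bi])
  then have "smooth_on (snd c ` W) (snd d \<circ> f \<circ> chart_inv c)"
    by (rule smooth_on_cong[OF oW]) (use inv in auto)
  with W sub show thesis using that[of W] W'(2) c d A B by (auto simp: W_def)
qed

lemma smooth_nearI:
  assumes "c \<in> atlas M" "d \<in> atlas N" "openin (mtop M) W" "p \<in> W" "W \<subseteq> fst c"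
    "f ` W \<subseteq> fst d" "smooth_on (snd c ` W) (snd d \<circ> f \<circ> chart_inv c)"
  shows "smooth_near M N f p"
  using assms unfolding smooth_near_def by blast

lemma smooth_near_in_points:
  assumes "charted M" "charted N" "smooth_near M N f p" shows "p \<in> points M" "f p \<in> points N"
  using assms openin_subset chart_subset_points[OF assms(2)] unfolding smooth_near_def by blast+

lemma smooth_near_continuous:
  assumes M: "charted M" and N: "charted N" and f: "smooth_near M N f p" and V: "openin (mtop N) V" "f p \<in> V"
  obtains W where "openin (mtop M) W" "p \<in> W" "f ` W \<subseteq> V"
proof -
  note p = smooth_near_in_points[OF M N f]
  obtain c d where c: "c \<in> atlas M" "p \<in> fst c" and d: "d \<in> atlas N" "f p \<in> fst d"
    using chartedD(1)[OF M p(1)] chartedD(1)[OF N p(2)] by blast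
  obtain W where "openin (mtop M) W" "p \<in> W" "f ` W \<subseteq> fst d \<inter> V"
    by (rule smooth_near_charts[OF M N f c d openin_topspace p(1) V])
  then show thesis using that by blast
qed

text \<open>Reduces smoothness to one convenient pair of charts around each point. Sufficiency uses
  that smoothness on a chart image is itself a local property.\<close>

lemma smooth_map_iff_smooth_near:
  assumes M: "charted M" and N: "charted N"
  shows "smooth_map M N f \<longleftrightarrow> (\<forall>p\<in>points M. smooth_near M N f p)"
proof
  assume f: "smooth_map M N f"
  show "\<forall>p\<in>points M. smooth_near M N f p"
  proof
    fix p assume p: "p \<in> points M"
    have cont: "continuous_map (mtop M) (mtop N) f" using f by (simp add: smooth_map_def)
    then have "f p \<in> points N" using p continuous_map_image_subset_topspace by blast
    then obtain c d where c: "c \<in> atlas M" "p \<in> fst c" and d: "d \<in> atlas N" "f p \<in> fst d"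
      using chartedD(1)[OF M p] chartedD(1)[OF N] by blast
    have "openin (mtop M) (fst c \<inter> {p \<in> points M. f p \<in> fst d})"
      by (intro openin_Int chartedD(2)[OF M c(1)] openin_continuous_map_preimage[OF cont] chartedD(2)[OF N d(1)])
    moreover have "fst c \<inter> {p \<in> points M. f p \<in> fst d} = {p \<in> fst c. f p \<in> fst d}"
      using chart_subset_points[OF M c(1)] by blast
    ultimately have "openin (mtop M) {p \<in> fst c. f p \<in> fst d}" by simp
    moreover have "smooth_on (snd c ` {p\<in>fst c. f p \<in> fst d}) (snd d \<circ> f \<circ> chart_inv c)"
      using f c d by (auto simp: smooth_map_def)
    ultimately show "smooth_near M N f p" using c d by (intro smooth_nearI[OF c(1) d(1)]) auto
  qed
next
  assume f: "\<forall>p\<in>points M. smooth_near M N f p"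
  show "smooth_map M N f"
    unfolding smooth_map_def
  proof (intro conjI ballI)
    show "continuous_map (mtop M) (mtop N) f"
      unfolding continuous_map_openin_preimage_eq
    proof (intro conjI allI impI)
      show "f \<in> points M \<rightarrow> points N" using f smooth_near_in_points(2)[OF M N] by blast
      fix V assume V: "openin (mtop N) V"
      show "openin (mtop M) (points M \<inter> f -` V)"
      proof (subst openin_subopen, safe)
        fix p assume p: "p \<in> points M" "f p \<in> V"
        obtain W where "openin (mtop M) W" "p \<in> W" "f ` W \<subseteq> V"
          using smooth_near_continuous[OF M N bspec[OF f p(1)] V p(2)] .
        then show "\<exists>T. openin (mtop M) T \<and> p \<in> T \<and> T \<subseteq> points M \<inter> f -` V"
          using openin_subset by (intro exI[of _ W]) blast
      qed
    qed
    fix c d assume c: "c \<in> atlas M" and d: "d \<in> atlas N"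
    show "smooth_on (snd c ` {p \<in> fst c. f p \<in> fst d}) (snd d \<circ> f \<circ> chart_inv c)"
    proof (rule smooth_on_locally, safe)
      fix p assume p: "p \<in> fst c" "f p \<in> fst d"
      have pM: "p \<in> points M" using chart_subset_points[OF M c] p by blast
      have fp: "f p \<in> points N" using chart_subset_points[OF N d] p by blast
      obtain W where W: "openin (mtop M) W" "p \<in> W" "W \<subseteq> fst c \<inter> points M"
        "smooth_on (snd c ` W) (snd d \<circ> f \<circ> chart_inv c)"
        by (rule smooth_near_charts[OF M N bspec[OF f pM] c p(1) d p(2) openin_topspace pM openin_topspace fp])
      then show "\<exists>T. open T \<and> snd c p \<in> T \<and> smooth_on T (snd d \<circ> f \<circ> chart_inv c)"
        using chartedD(4)[OF M c W(1)] by blast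
    qed
  qed
qed

lemma smooth_near_compose:
  assumes M: "charted M" and N: "charted N" and P: "charted P"
    and f: "smooth_near M N f p" and g: "smooth_near N P g (f p)"
  shows "smooth_near M P (\<lambda>x. g (f x)) p"
proof -
  note p = smooth_near_in_points[OF M N f] smooth_near_in_points(2)[OF N P g]
  obtain c d e where c: "c \<in> atlas M" "p \<in> fst c" and d: "d \<in> atlas N" "f p \<in> fst d"
    and e: "e \<in> atlas P" "g (f p) \<in> fst e"
    using chartedD(1)[OF M p(1)] chartedD(1)[OF N p(2)] chartedD(1)[OF P p(3)] by blast
  obtain V where V: "openin (mtop N) V" "f p \<in> V" "V \<subseteq> fst d \<inter> points N" "g ` V \<subseteq> fst e \<inter> points P"
    "smooth_on (snd d ` V) (snd e \<circ> g \<circ> chart_inv d)"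
    by (rule smooth_near_charts[OF N P g d e openin_topspace p(2) openin_topspace p(3)])
  obtain W where W: "openin (mtop M) W" "p \<in> W" "W \<subseteq> fst c \<inter> points M" "f ` W \<subseteq> fst d \<inter> V"
    "smooth_on (snd c ` W) (snd d \<circ> f \<circ> chart_inv c)"
    by (rule smooth_near_charts[OF M N f c d openin_topspace p(1) V(1,2)])
  have oW: "open (snd c ` W)" using chartedD(4)[OF M c(1) W(1)] W(3) by blast
  have oV: "open (snd d ` V)" using chartedD(4)[OF N d(1) V(1)] V(3) by blast
  have inv: "chart_inv c (snd c q) = q" "chart_inv d (snd d (f q)) = f q" if "q \<in> W" for q
    using chart_inv(1)[OF M c(1)] chart_inv(1)[OF N d(1)] W that by auto
  have "smooth_on (snd c ` W) (\<lambda>y. (snd e \<circ> g \<circ> chart_inv d) ((snd d \<circ> f \<circ> chart_inv c) y))"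
    by (rule smooth_on_compose[OF oW oV W(5) V(5)]) (use inv W in auto)
  then have "smooth_on (snd c ` W) (snd e \<circ> (\<lambda>x. g (f x)) \<circ> chart_inv c)"
    by (rule smooth_on_cong[OF oW]) (use inv in auto)
  moreover have "(\<lambda>x. g (f x)) ` W \<subseteq> fst e" using W(4) V(4) by blast
  ultimately show ?thesis using W by (intro smooth_nearI[OF c(1) e(1) W(1,2)]) auto
qed

lemma smooth_near_cong:
  assumes M: "charted M" and N: "charted N" and f: "smooth_near M N f p"
    and V: "openin (mtop M) V" "p \<in> V" "\<And>q. q \<in> V \<Longrightarrow> f q = g q"
  shows "smooth_near M N g p"
proof -
  note p = smooth_near_in_points[OF M N f]
  obtain c d where c: "c \<in> atlas M" "p \<in> fst c" and d: "d \<in> atlas N" "f p \<in> fst d"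
    using chartedD(1)[OF M p(1)] chartedD(1)[OF N p(2)] by blast
  obtain W where W: "openin (mtop M) W" "p \<in> W" "W \<subseteq> fst c \<inter> V" "f ` W \<subseteq> fst d \<inter> points N"
    "smooth_on (snd c ` W) (snd d \<circ> f \<circ> chart_inv c)"
    by (rule smooth_near_charts[OF M N f c d V(1,2) openin_topspace p(2)])
  have oW: "open (snd c ` W)" using chartedD(4)[OF M c(1) W(1)] W(3) by blast
  have inv: "chart_inv c (snd c q) = q" if "q \<in> W" for q
    using chart_inv(1)[OF M c(1)] W that by auto
  have fg: "f q = g q" if "q \<in> W" for q using V(3) W(3) that by blast
  have "smooth_on (snd c ` W) (snd d \<circ> g \<circ> chart_inv c)"
    by (rule smooth_on_cong[OF oW W(5)]) (use inv fg in auto)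
  moreover have "g ` W \<subseteq> fst d" using fg W(4) by auto
  ultimately show ?thesis using W by (intro smooth_nearI[OF c(1) d(1) W(1,2)]) auto
qed

lemma smooth_near_id:
  assumes M: "charted M" and p: "p \<in> points M" shows "smooth_near M M (\<lambda>x. x) p"
proof -
  obtain c where c: "c \<in> atlas M" "p \<in> fst c" using chartedD(1)[OF M p] by blast
  have "smooth_on (snd c ` fst c) (\<lambda>x. x)"
    by (rule smooth_on_linear[OF open_chart_image[OF M c(1)] bounded_linear_ident])
  then have "smooth_on (snd c ` fst c) (snd c \<circ> (\<lambda>x. x) \<circ> chart_inv c)"
    by (rule smooth_on_cong[OF open_chart_image[OF M c(1)]]) (use chart_inv[OF M c(1)] in auto)
  then show ?thesis using c chartedD(2)[OF M c(1)] by (intro smooth_nearI[OF c(1) c(1)]) auto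
qed

text \<open>\<open>chart_inv\<close> is an \<open>inv_into\<close> and hence depends on the chart
  domain; by injectivity the restricted and the original inverse agree on the image of the smaller
  domain.\<close>

lemma chart_inv_restrict:
  assumes "charted M" "c \<in> atlas M" "p \<in> fst c \<inter> W"
  shows "chart_inv (fst c \<inter> W, snd c) (snd c p) = p"
proof -
  have "inj_on (snd c) (fst c \<inter> W)" using chartedD(3)[OF assms(1,2)] by (rule inj_on_subset) auto
  then show ?thesis using assms(3) by (simp add: chart_inv_def)
qed

lemma atlas_open_submanifold: "atlas (open_submanifold M W) = (\<lambda>c. (fst c \<inter> W, snd c)) ` atlas M"
  by (auto simp: open_submanifold_def case_prod_beta)

lemma openin_open_submanifold:
  "openin (mtop M) W \<Longrightarrow> openin (mtop (open_submanifold M W)) V \<longleftrightarrow> openin (mtop M) V \<and> V \<subseteq> W"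
  by (simp add: open_submanifold_def openin_open_subtopology)

lemma points_open_submanifold: "openin (mtop M) W \<Longrightarrow> points (open_submanifold M W) = W"
  using openin_subset by (fastforce simp: open_submanifold_def)

lemma charted_open_submanifold:
  assumes M: "charted M" and W: "openin (mtop M) W" shows "charted (open_submanifold M W)"
  unfolding charted_def points_open_submanifold[OF W] atlas_open_submanifold openin_open_submanifold[OF W]
    ball_simps bex_simps fst_conv snd_conv
proof (intro conjI ballI allI impI)
  show "\<exists>c\<in>atlas M. p \<in> fst c \<inter> W" if "p \<in> W" for p
    using chartedD(1)[OF M] that openin_subset[OF W] by blast
  fix c assume c: "c \<in> atlas M"
  show "openin (mtop M) (fst c \<inter> W)" by (intro openin_Int chartedD(2)[OF M c] W)
  show "inj_on (snd c) (fst c \<inter> W)" using chartedD(3)[OF M c] by (rule inj_on_subset) auto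
  show "open (snd c ` V)" if "(openin (mtop M) V \<and> V \<subseteq> W) \<and> V \<subseteq> fst c \<inter> W" for V
    using chartedD(4)[OF M c] that by blast
  show "openin (mtop M) {p \<in> fst c \<inter> W. snd c p \<in> G}" if "open G" for G
  proof -
    have "{p \<in> fst c \<inter> W. snd c p \<in> G} = {p \<in> fst c. snd c p \<in> G} \<inter> W" by auto
    then show ?thesis using chartedD(5)[OF M c that] W by auto
  qed
  fix d assume d: "d \<in> atlas M"
  have o: "open (snd c ` (fst c \<inter> W \<inter> (fst d \<inter> W)))"
    by (rule chartedD(4)[OF M c]) (auto intro!: openin_Int chartedD(2)[OF M] W c d)
  have "smooth_on (snd c ` (fst c \<inter> W \<inter> (fst d \<inter> W))) (snd d \<circ> chart_inv c)"
    by (rule smooth_on_subset[OF chartedD(6)[OF M c d]]) auto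
  then show "smooth_on (snd c ` (fst c \<inter> W \<inter> (fst d \<inter> W))) (snd d \<circ> chart_inv (fst c \<inter> W, snd c))"
    by (rule smooth_on_cong[OF o]) (auto simp: chart_inv_restrict[OF M c] chart_inv(1)[OF M c])
qed auto

lemma smooth_near_open_submanifold_source:
  assumes M: "charted M" and W: "openin (mtop M) W" and N: "charted N"
  shows "smooth_near (open_submanifold M W) N f p \<longleftrightarrow> p \<in> W \<and> smooth_near M N f p"
proof safe
  assume f: "smooth_near (open_submanifold M W) N f p"
  show "p \<in> W"
    using smooth_near_in_points(1)[OF charted_open_submanifold[OF M W] N f] points_open_submanifold[OF W] by simp
  obtain c d V where c: "c \<in> atlas M" and d: "d \<in> atlas N" and V: "openin (mtop M) V" "V \<subseteq> W" "p \<in> V" "V \<subseteq> fst c \<inter> W"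
    "f ` V \<subseteq> fst d" "smooth_on (snd c ` V) (snd d \<circ> f \<circ> chart_inv (fst c \<inter> W, snd c))"
    using f unfolding smooth_near_def atlas_open_submanifold openin_open_submanifold[OF W] by auto
  have "smooth_on (snd c ` V) (snd d \<circ> f \<circ> chart_inv c)"
  proof (rule smooth_on_cong[OF _ V(6)])
    show "open (snd c ` V)" using chartedD(4)[OF M c V(1)] V(4) by blast
  qed (use V(4) in \<open>auto simp: chart_inv_restrict[OF M c] chart_inv(1)[OF M c] subset_iff\<close>)
  then show "smooth_near M N f p" using V by (intro smooth_nearI[OF c d V(1,3)]) auto
next
  assume p: "p \<in> W" and f: "smooth_near M N f p"
  note q = smooth_near_in_points[OF M N f]
  obtain c d where c: "c \<in> atlas M" "p \<in> fst c" and d: "d \<in> atlas N" "f p \<in> fst d"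
    using chartedD(1)[OF M q(1)] chartedD(1)[OF N q(2)] by blast
  obtain V where V: "openin (mtop M) V" "p \<in> V" "V \<subseteq> fst c \<inter> W" "f ` V \<subseteq> fst d \<inter> points N"
    "smooth_on (snd c ` V) (snd d \<circ> f \<circ> chart_inv c)"
    by (rule smooth_near_charts[OF M N f c d W p openin_topspace q(2)])
  have s: "smooth_on (snd c ` V) (snd d \<circ> f \<circ> chart_inv (fst c \<inter> W, snd c))"
  proof (rule smooth_on_cong[OF _ V(5)])
    show "open (snd c ` V)" using chartedD(4)[OF M c(1) V(1)] V(3) by blast
  qed (use V(3) in \<open>auto simp: chart_inv_restrict[OF M c(1)] chart_inv(1)[OF M c(1)] subset_iff\<close>)
  show "smooth_near (open_submanifold M W) N f p"
  proof (rule smooth_nearI)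
    show "(fst c \<inter> W, snd c) \<in> atlas (open_submanifold M W)" using c(1) by (auto simp: atlas_open_submanifold)
    show "openin (mtop (open_submanifold M W)) V" using V openin_open_submanifold[OF W] by blast
  qed (use V d s in auto)
qed

lemma smooth_near_open_submanifold_target:
  assumes M: "charted M" and N: "charted N" and W: "openin (mtop N) W"
  shows "smooth_near M (open_submanifold N W) f p \<longleftrightarrow> f p \<in> W \<and> smooth_near M N f p"
proof safe
  assume f: "smooth_near M (open_submanifold N W) f p"
  show "f p \<in> W"
    using smooth_near_in_points(2)[OF M charted_open_submanifold[OF N W] f] points_open_submanifold[OF W] by simp
  obtain c d V where c: "c \<in> atlas M" and d: "d \<in> atlas N" and V: "openin (mtop M) V" "p \<in> V" "V \<subseteq> fst c"
    "f ` V \<subseteq> fst d \<inter> W" "smooth_on (snd c ` V) (snd d \<circ> f \<circ> chart_inv c)"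
    using f unfolding smooth_near_def atlas_open_submanifold bex_simps fst_conv snd_conv by blast
  then show "smooth_near M N f p" by (intro smooth_nearI[OF c d V(1,2)]) auto
next
  assume p: "f p \<in> W" and f: "smooth_near M N f p"
  note q = smooth_near_in_points[OF M N f]
  obtain c d where c: "c \<in> atlas M" "p \<in> fst c" and d: "d \<in> atlas N" "f p \<in> fst d"
    using chartedD(1)[OF M q(1)] chartedD(1)[OF N q(2)] by blast
  obtain V where V: "openin (mtop M) V" "p \<in> V" "V \<subseteq> fst c \<inter> points M" "f ` V \<subseteq> fst d \<inter> W"
    "smooth_on (snd c ` V) (snd d \<circ> f \<circ> chart_inv c)"
    by (rule smooth_near_charts[OF M N f c d openin_topspace q(1) W p])
  show "smooth_near M (open_submanifold N W) f p"
  proof (rule smooth_nearI[OF c(1)])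
    show "(fst d \<inter> W, snd d) \<in> atlas (open_submanifold N W)" using d(1) by (auto simp: atlas_open_submanifold)
  qed (use V in auto)
qed

section \<open>Integral curves and flows of vector fields\<close>

text \<open>Gronwall's argument for the squared distance \<open>u\<close>, chosen because it is
  differentiable even where it vanishes. The bound on \<open>u'\<close> makes
  \<open>exp (- (2 * L) * t) * u t\<close> nonincreasing to the right of \<open>t0\<close> and
  \<open>exp (2 * L * t) * u t\<close> nondecreasing to the left; as \<open>u t0 = 0\<close>, both
  force \<open>u\<close> to be at most 0.\<close>

lemma ode_local_unique:
  fixes y z :: "real \<Rightarrow> 'm::fin_dim_inner"
  assumes S: "open S" and f: "smooth_on S f" and e: "e > 0"
    and y: "\<And>t. \<bar>t - t0\<bar> < e \<Longrightarrow> (y has_vector_derivative f (y t)) (at t)" "y t0 \<in> S"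
    and z: "\<And>t. \<bar>t - t0\<bar> < e \<Longrightarrow> (z has_vector_derivative f (z t)) (at t)"
    and eq: "y t0 = z t0"
  obtains d where "d > 0" "\<And>t. \<bar>t - t0\<bar> < d \<Longrightarrow> y t = z t"
proof -
  obtain R where R: "R > 0" "cball (y t0) R \<subseteq> S" using S y(2) open_contains_cball by metis
  obtain L where L: "L \<ge> 0" "\<And>x v. x \<in> cball (y t0) R \<Longrightarrow> norm (frechet_derivative f (at x) v) \<le> L * norm v"
    using derivative_bound_compact[OF f compact_cball R(2)] by blast
  have near: "\<exists>d>0. \<forall>t. \<bar>t - t0\<bar> < d \<longrightarrow> w t \<in> cball (y t0) R"
    if "(w has_vector_derivative v) (at t0)" "w t0 = y t0" for w v
  proof -
    have "isCont w t0" using has_vector_derivative_continuous[OF that(1)] .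
    then show ?thesis using R(1) that(2) unfolding continuous_at_eps_delta
      by (metis dist_commute dist_real_def less_imp_le mem_cball)
  qed
  obtain d1 where d1: "d1 > 0" "\<And>t. \<bar>t - t0\<bar> < d1 \<Longrightarrow> y t \<in> cball (y t0) R"
    using near[OF y(1)] e by (metis abs_zero diff_self)
  obtain d2 where d2: "d2 > 0" "\<And>t. \<bar>t - t0\<bar> < d2 \<Longrightarrow> z t \<in> cball (y t0) R"
    using near[OF z eq[symmetric]] e by (metis abs_zero diff_self)
  define d where "d = min e (min d1 d2)"
  define u where "u t = (y t - z t) \<bullet> (y t - z t)" for t
  define u' where "u' t = 2 * ((y t - z t) \<bullet> (f (y t) - f (z t)))" for t
  have u0: "u t0 = 0" by (simp add: u_def eq)
  have du: "(u has_real_derivative u' t) (at t)" if "\<bar>t - t0\<bar> < d" for t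
  proof -
    have "((\<lambda>t. y t - z t) has_vector_derivative (f (y t) - f (z t))) (at t)"
      using that by (intro has_vector_derivative_diff y z) (auto simp: d_def)
    from bounded_bilinear.has_vector_derivative[OF bounded_bilinear_inner this this]
    show ?thesis unfolding u_def u'_def has_real_derivative_iff_has_vector_derivative
      by (simp add: inner_commute)
  qed
  have bu: "\<bar>u' t\<bar> \<le> 2 * L * u t" if "\<bar>t - t0\<bar> < d" for t
  proof -
    have "norm (f (y t) - f (z t)) \<le> L * norm (y t - z t)"
      by (rule lipschitz_on_compact[OF f convex_cball R(2) d1(2) d2(2) L]) (use that in \<open>auto simp: d_def\<close>)
    then have "\<bar>(y t - z t) \<bullet> (f (y t) - f (z t))\<bar> \<le> norm (y t - z t) * (L * norm (y t - z t))"
      using Cauchy_Schwarz_ineq2 mult_left_mono norm_ge_zero order_trans by metis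
    also have "\<dots> = L * u t" by (simp add: u_def power2_norm_eq_inner[symmetric] power2_eq_square)
    finally show ?thesis by (simp add: u'_def abs_mult)
  qed
  have u_le: "u t \<le> 0" if t: "\<bar>t - t0\<bar> < d" for t
  proof (cases "t0 \<le> t")
    case True
    have "exp (- (2 * L) * t) * u t \<le> exp (- (2 * L) * t0) * u t0"
    proof (rule DERIV_nonpos_imp_nonincreasing[OF True], intro exI conjI)
      fix s assume s: "t0 \<le> s" "s \<le> t"
      then have s': "\<bar>s - t0\<bar> < d" using t by auto
      show "((\<lambda>s. exp (- (2 * L) * s) * u s) has_real_derivative
        (exp (- (2 * L) * s) * (u' s - 2 * L * u s))) (at s)"
        by (rule derivative_eq_intros du[OF s'] refl | simp add: algebra_simps)+
      show "exp (- (2 * L) * s) * (u' s - 2 * L * u s) \<le> 0"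
        using bu[OF s'] by (intro mult_nonneg_nonpos) auto
    qed
    then show ?thesis by (simp add: u0 mult_le_0_iff)
  next
    case False
    then have "t \<le> t0" by simp
    have "exp (2 * L * t) * u t \<le> exp (2 * L * t0) * u t0"
    proof (rule DERIV_nonneg_imp_nondecreasing[OF \<open>t \<le> t0\<close>], intro exI conjI)
      fix s assume s: "t \<le> s" "s \<le> t0"
      then have s': "\<bar>s - t0\<bar> < d" using t by auto
      show "((\<lambda>s. exp (2 * L * s) * u s) has_real_derivative
        (exp (2 * L * s) * (u' s + 2 * L * u s))) (at s)"
        by (rule derivative_eq_intros du[OF s'] refl | simp add: algebra_simps)+
      show "exp (2 * L * s) * (u' s + 2 * L * u s) \<ge> 0"
        using bu[OF s'] by (intro mult_nonneg_nonneg) auto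
    qed
    then show ?thesis by (simp add: u0 mult_le_0_iff)
  qed
  have "u t = 0" if "\<bar>t - t0\<bar> < d" for t by (rule antisym[OF u_le[OF that]]) (simp add: u_def)
  then have "y t = z t" if "\<bar>t - t0\<bar> < d" for t using that by (simp add: u_def)
  moreover have "d > 0" using e d1(1) d2(1) by (simp add: d_def)
  ultimately show thesis using that by blast
qed

text \<open>The chain rule in charts, applied with the identity for changing the chart along a curve
  and with other maps for transporting integral curves.\<close>

lemma curve_vderiv:
  fixes \<gamma> :: "real \<Rightarrow> 'a"
  assumes M: "charted M" and N: "charted N" and h: "smooth_near M N h (\<gamma> t)"
    and c: "c \<in> atlas M" "\<gamma> t \<in> fst c" and d: "d \<in> atlas N" "h (\<gamma> t) \<in> fst d"
    and J: "open J" "t \<in> J" and cont: "continuous_map (top_of_set J) (mtop M) \<gamma>"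
    and v: "((snd c \<circ> \<gamma>) has_vector_derivative v) (at t)"
  shows "((\<lambda>s. snd d (h (\<gamma> s))) has_vector_derivative
    frechet_derivative (snd d \<circ> h \<circ> chart_inv c) (at (snd c (\<gamma> t))) v) (at t)"
proof -
  note p = smooth_near_in_points[OF M N h]
  obtain W where W: "openin (mtop M) W" "\<gamma> t \<in> W" "W \<subseteq> fst c \<inter> points M"
    "smooth_on (snd c ` W) (snd d \<circ> h \<circ> chart_inv c)"
    by (rule smooth_near_charts[OF M N h c d openin_topspace p(1) openin_topspace p(2)])
  let ?g = "snd d \<circ> h \<circ> chart_inv c" and ?J = "{s \<in> J. \<gamma> s \<in> W}"
  have "openin (top_of_set J) ?J" using openin_continuous_map_preimage[OF cont W(1)] by simp
  then have oJ: "open ?J" using J(1) openin_open_trans by blast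
  have D: "(?g has_derivative frechet_derivative ?g (at (snd c (\<gamma> t)))) (at ((snd c \<circ> \<gamma>) t))"
    using smooth_on_has_derivative[OF W(4)] W(2) by simp
  interpret D: bounded_linear "frechet_derivative ?g (at (snd c (\<gamma> t)))"
    using D has_derivative_bounded_linear by blast
  have "((\<lambda>s. ?g ((snd c \<circ> \<gamma>) s)) has_vector_derivative frechet_derivative ?g (at (snd c (\<gamma> t))) v) (at t)"
    using has_derivative_compose[OF v[unfolded has_vector_derivative_def] D]
    by (simp add: has_vector_derivative_def D.scaleR)
  then show ?thesis
    by (rule has_vector_derivative_transform_within_open[OF _ oJ])
      (use W chart_inv(1)[OF M c(1)] J(2) in auto)
qed

section \<open>Integral curves as a local notion\<close>

lemma chart_inv_preimage:
  assumes "charted M" "c \<in> atlas M" shows "{y \<in> snd c ` fst c. chart_inv c y \<in> V} = snd c ` (V \<inter> fst c)"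
proof safe
  fix y p assume "p \<in> fst c" "chart_inv c (snd c p) \<in> V"
  then show "snd c p \<in> snd c ` (V \<inter> fst c)" using chart_inv(1)[OF assms] by auto
qed (use chart_inv(1)[OF assms] in auto)

lemma continuous_map_chart_inv:
  assumes M: "charted M" and c: "c \<in> atlas M"
  shows "continuous_map (top_of_set (snd c ` fst c)) (mtop M) (chart_inv c)"
  unfolding continuous_map_def
proof (intro conjI allI impI)
  show "chart_inv c \<in> topspace (top_of_set (snd c ` fst c)) \<rightarrow> points M"
    using chart_inv(2)[OF M c] chart_subset_points[OF M c] by auto
  fix V assume "openin (mtop M) V"
  then have "open (snd c ` (V \<inter> fst c))"
    by (intro chartedD(4)[OF M c] openin_Int chartedD(2)[OF M c]) auto
  then show "openin (top_of_set (snd c ` fst c)) {y \<in> topspace (top_of_set (snd c ` fst c)). chart_inv c y \<in> V}"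
    unfolding topspace_euclidean_subtopology chart_inv_preimage[OF assms]
    by (rule open_subset[rotated]) auto
qed

text \<open>An integral curve freed from the interval and the initial condition. Being local in
  time, this notion passes to open subsets, is invariant under time shifts and permits
  gluing.\<close>

definition solves ::
  "('a, 'm::fin_dim_inner) manifold \<Rightarrow> ('a \<Rightarrow> ('a, 'm) tangent) \<Rightarrow> real set \<Rightarrow> (real \<Rightarrow> 'a) \<Rightarrow> bool" where
  "solves M X J \<gamma> \<longleftrightarrow> open J \<and> continuous_map (top_of_set J) (mtop M) \<gamma> \<and>
     (\<forall>t\<in>J. \<forall>c\<in>atlas M. \<gamma> t \<in> fst c \<longrightarrow>
        ((snd c \<circ> \<gamma>) has_vector_derivative snd (X (\<gamma> t)) c) (at t))"

lemma integral_curve_iff_solves: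
  "integral_curve M X x J \<gamma> \<longleftrightarrow> solves M X J \<gamma> \<and> connected J \<and> 0 \<in> J \<and> \<gamma> 0 = x"
  by (auto simp: integral_curve_def solves_def is_interval_connected_1)

lemma solvesD:
  assumes "solves M X J \<gamma>"
  shows "open J" "continuous_map (top_of_set J) (mtop M) \<gamma>"
    "t \<in> J \<Longrightarrow> c \<in> atlas M \<Longrightarrow> \<gamma> t \<in> fst c \<Longrightarrow> ((snd c \<circ> \<gamma>) has_vector_derivative snd (X (\<gamma> t)) c) (at t)"
    "t \<in> J \<Longrightarrow> \<gamma> t \<in> points M"
  using assms continuous_map_image_subset_topspace[of "top_of_set J" "mtop M" \<gamma>] by (auto simp: solves_def)

lemma solves_open_preimage:
  assumes "solves M X J \<gamma>" "openin (mtop M) V" shows "open {t \<in> J. \<gamma> t \<in> V}"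
  using openin_continuous_map_preimage[OF solvesD(2)[OF assms(1)] assms(2)] solvesD(1)[OF assms(1)] openin_open_trans
  by auto

lemma solves_locally:
  assumes "open J" and "\<And>t. t \<in> J \<Longrightarrow> \<exists>J' \<gamma>'. t \<in> J' \<and> solves M X J' \<gamma>' \<and> (\<forall>s\<in>J'. s \<in> J \<and> \<gamma> s = \<gamma>' s)"
  shows "solves M X J \<gamma>"
  unfolding solves_def
proof (intro conjI ballI impI)
  show "continuous_map (top_of_set J) (mtop M) \<gamma>"
    unfolding continuous_map_def
  proof (intro conjI allI impI)
    show "\<gamma> \<in> topspace (top_of_set J) \<rightarrow> points M"
    proof
      fix t assume "t \<in> topspace (top_of_set J)"
      then have "t \<in> J" by simp
      from assms(2)[OF this] obtain J' \<gamma>' where "t \<in> J'" "solves M X J' \<gamma>'" "\<gamma> t = \<gamma>' t" by blast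
      then show "\<gamma> t \<in> points M" using solvesD(4) by metis
    qed
    fix V assume V: "openin (mtop M) V"
    have "open {t \<in> J. \<gamma> t \<in> V}"
    proof (subst open_subopen, safe)
      fix t assume t: "t \<in> J" "\<gamma> t \<in> V"
      from assms(2)[OF t(1)] obtain J' \<gamma>' where J': "t \<in> J'" "solves M X J' \<gamma>'" "\<forall>s\<in>J'. s \<in> J \<and> \<gamma> s = \<gamma>' s" by blast
      show "\<exists>T. open T \<and> t \<in> T \<and> T \<subseteq> {t \<in> J. \<gamma> t \<in> V}"
        using solves_open_preimage[OF J'(2) V] J'(1,3) t by (intro exI[of _ "{s \<in> J'. \<gamma>' s \<in> V}"]) auto
    qed
    then show "openin (top_of_set J) {t \<in> topspace (top_of_set J). \<gamma> t \<in> V}"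
      by (simp add: open_subset)
  qed
  fix t c assume t: "t \<in> J" and c: "c \<in> atlas M" "\<gamma> t \<in> fst c"
  from assms(2)[OF t] obtain J' \<gamma>' where J': "t \<in> J'" "solves M X J' \<gamma>'" "\<And>s. s\<in>J' \<Longrightarrow> \<gamma> s = \<gamma>' s" by blast
  have "((snd c \<circ> \<gamma>') has_vector_derivative snd (X (\<gamma> t)) c) (at t)"
    using solvesD(3)[OF J'(2,1) c(1)] J'(3)[OF J'(1)] c(2) by simp
  then show "((snd c \<circ> \<gamma>) has_vector_derivative snd (X (\<gamma> t)) c) (at t)"
    by (rule has_vector_derivative_transform_within_open[OF _ solvesD(1)[OF J'(2)] J'(1)]) (simp add: J'(3))
qed (fact assms(1))

lemma solves_subset: "solves M X J \<gamma> \<Longrightarrow> open J' \<Longrightarrow> J' \<subseteq> J \<Longrightarrow> solves M X J' \<gamma>"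
  unfolding solves_def by (meson continuous_map_from_subtopology_mono subset_iff)

lemma solves_shift:
  assumes "solves M X J \<gamma>" shows "solves M X {t. t + s \<in> J} (\<lambda>t. \<gamma> (t + s))"
  unfolding solves_def
proof (intro conjI ballI impI)
  have vim: "{t. t + s \<in> J} = (\<lambda>t. t + s) -` J" by auto
  show "open {t. t + s \<in> J}"
    unfolding vim using solvesD(1)[OF assms] by (intro open_vimage continuous_intros)
  have "continuous_map (top_of_set {t. t + s \<in> J}) (top_of_set J) (\<lambda>t. t + s)"
    by (auto simp: continuous_map_in_subtopology continuous_map_iff_continuous intro!: continuous_intros)
  from continuous_map_compose[OF this solvesD(2)[OF assms]]
  show "continuous_map (top_of_set {t. t + s \<in> J}) (mtop M) (\<lambda>t. \<gamma> (t + s))" by (simp add: o_def)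
  fix t c assume "t \<in> {t. t + s \<in> J}" "c \<in> atlas M" "\<gamma> (t + s) \<in> fst c"
  then have "((snd c \<circ> \<gamma>) has_vector_derivative snd (X (\<gamma> (t + s))) c) (at (t + s))"
    using solvesD(3)[OF assms] by simp
  moreover have "((\<lambda>t. t + s) has_derivative (\<lambda>h. h)) (at t)" by (auto intro!: derivative_eq_intros)
  ultimately show "((snd c \<circ> (\<lambda>t. \<gamma> (t + s))) has_vector_derivative snd (X (\<gamma> (t + s))) c) (at t)"
    unfolding has_vector_derivative_def o_def by (rule has_derivative_compose[rotated])
qed

locale vfield =
  fixes M :: "('a, 'm::fin_dim_inner) manifold" and X :: "'a \<Rightarrow> ('a, 'm) tangent"
  assumes M: "smooth_manifold M" and X: "vector_field M X"
begin

lemma charted: "charted M" by (rule smooth_manifold_charted[OF M])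

lemma X_tangent: assumes "p \<in> points M" shows "X p \<in> tangent_vectors M" "fst (X p) = p"
proof -
  have "continuous_map (mtop M) (mtop (tangent_bundle M)) X" using X by (simp add: vector_field_def smooth_map_def)
  then have "X p \<in> topspace (mtop (tangent_bundle M))" using assms continuous_map_image_subset_topspace by blast
  then show "X p \<in> tangent_vectors M"
    by (auto simp: tangent_bundle_def topology_generated_by_topspace tangent_chart_def)
  show "fst (X p) = p" using X assms by (simp add: vector_field_def)
qed

lemma X_transform:
  assumes "c \<in> atlas M" "d \<in> atlas M" "p \<in> fst c" "p \<in> fst d"
  shows "snd (X p) d = frechet_derivative (snd d \<circ> chart_inv c) (at (snd c p)) (snd (X p) c)"
proof -
  have p: "p \<in> points M" using chart_subset_points[OF charted] assms by blast
  have "(p, snd (X p)) \<in> tangent_vectors M" using X_tangent[OF p] by (metis prod.collapse)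
  then show ?thesis using assms unfolding tangent_vectors_def mem_Collect_eq case_prod_conv by blast
qed

text \<open>This coordinate expression is the right-hand side of the differential equation in the
  chart \<open>c\<close>.\<close>

lemma X_smooth:
  assumes c: "c \<in> atlas M" shows "smooth_on (snd c ` fst c) (\<lambda>y. snd (X (chart_inv c y)) c)"
proof -
  have "tangent_chart M c \<in> atlas (tangent_bundle M)" using c by (simp add: tangent_bundle_def)
  then have "smooth_on (snd c ` {p \<in> fst c. X p \<in> fst (tangent_chart M c)}) (snd (tangent_chart M c) \<circ> X \<circ> chart_inv c)"
    using X c by (auto simp: vector_field_def smooth_map_def)
  moreover have "{p \<in> fst c. X p \<in> fst (tangent_chart M c)} = fst c"
    using X_tangent chart_subset_points[OF charted c] by (auto simp: tangent_chart_def)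
  ultimately have "smooth_on (snd c ` fst c) (snd (tangent_chart M c) \<circ> X \<circ> chart_inv c)" by simp
  from smooth_on_bounded_linear[OF open_chart_image[OF charted c] bounded_linear_snd this]
  show ?thesis by (simp add: tangent_chart_def o_def)
qed

text \<open>The transformation rule of tangent vectors carries the derivative from one chart around
  each point of the curve to all others.\<close>

lemma solvesI:
  assumes J: "open J" and cont: "continuous_map (top_of_set J) (mtop M) \<gamma>"
    and v: "\<And>t. t \<in> J \<Longrightarrow> \<exists>c\<in>atlas M. \<gamma> t \<in> fst c \<and> ((snd c \<circ> \<gamma>) has_vector_derivative snd (X (\<gamma> t)) c) (at t)"
  shows "solves M X J \<gamma>"
  unfolding solves_def
proof (intro conjI ballI impI J cont)
  fix t d assume t: "t \<in> J" and d: "d \<in> atlas M" "\<gamma> t \<in> fst d"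
  obtain c where c: "c \<in> atlas M" "\<gamma> t \<in> fst c" "((snd c \<circ> \<gamma>) has_vector_derivative snd (X (\<gamma> t)) c) (at t)"
    using v[OF t] by blast
  have "\<gamma> t \<in> points M" using chart_subset_points[OF charted c(1)] c(2) by blast
  from curve_vderiv[OF charted charted smooth_near_id[OF charted this] c(1,2) d J t cont c(3)]
  show "((snd d \<circ> \<gamma>) has_vector_derivative snd (X (\<gamma> t)) d) (at t)"
    using X_transform[OF c(1) d(1) c(2) d(2)] by (simp add: o_def)
qed

lemma solves_unique_near:
  assumes g: "solves M X J \<gamma>" and h: "solves M X J \<delta>" and t0: "t0 \<in> J" "\<gamma> t0 = \<delta> t0"
  obtains d where "d > 0" "\<And>t. \<bar>t - t0\<bar> < d \<Longrightarrow> t \<in> J \<and> \<gamma> t = \<delta> t"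
proof -
  obtain c where c: "c \<in> atlas M" "\<gamma> t0 \<in> fst c" using chartedD(1)[OF charted] solvesD(4)[OF g t0(1)] by blast
  let ?S = "snd c ` fst c" and ?f = "\<lambda>y. snd (X (chart_inv c y)) c"
  have "open ({t \<in> J. \<gamma> t \<in> fst c} \<inter> {t \<in> J. \<delta> t \<in> fst c})"
    by (intro open_Int solves_open_preimage[OF g] solves_open_preimage[OF h] chartedD(2)[OF charted c(1)])
  moreover have "t0 \<in> {t \<in> J. \<gamma> t \<in> fst c} \<inter> {t \<in> J. \<delta> t \<in> fst c}" using t0 c by auto
  ultimately obtain e where e: "e > 0" "ball t0 e \<subseteq> {t \<in> J. \<gamma> t \<in> fst c} \<inter> {t \<in> J. \<delta> t \<in> fst c}"
    using openE by blast
  have e': "t \<in> J \<and> \<gamma> t \<in> fst c \<and> \<delta> t \<in> fst c" if "\<bar>t - t0\<bar> < e" for t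
    using that e(2) by (auto simp: dist_real_def abs_minus_commute subset_iff)
  obtain d where d: "d > 0" "\<And>t. \<bar>t - t0\<bar> < d \<Longrightarrow> (snd c \<circ> \<gamma>) t = (snd c \<circ> \<delta>) t"
  proof (rule ode_local_unique[OF open_chart_image[OF charted c(1)] X_smooth[OF c(1)] e(1)])
    fix t assume "\<bar>t - t0\<bar> < e"
    note t = e'[OF this]
    show "((snd c \<circ> \<gamma>) has_vector_derivative ?f ((snd c \<circ> \<gamma>) t)) (at t)"
      "((snd c \<circ> \<delta>) has_vector_derivative ?f ((snd c \<circ> \<delta>) t)) (at t)"
      using solvesD(3)[OF g _ c(1)] solvesD(3)[OF h _ c(1)] t chart_inv(1)[OF charted c(1)] by simp_all
  qed (use t0 c in auto)
  show thesis
  proof (rule that[of "min d e"])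
    fix t assume t: "\<bar>t - t0\<bar> < min d e"
    then show "t \<in> J \<and> \<gamma> t = \<delta> t"
      using d(2)[of t] e'[of t] chartedD(3)[OF charted c(1)] by (auto dest: inj_onD)
  qed (use d e in auto)
qed

text \<open>The coincidence set is closed since the manifold is Hausdorff, and open by uniqueness in
  a chart; connectedness of \<open>J\<close> does the rest.\<close>

lemma solves_unique:
  assumes g: "solves M X J \<gamma>" and h: "solves M X J \<delta>" and J: "connected J"
    and s: "s \<in> J" "\<gamma> s = \<delta> s" and t: "t \<in> J"
  shows "\<gamma> t = \<delta> t"
proof -
  let ?A = "{t \<in> J. \<gamma> t = \<delta> t}"
  have "Hausdorff_space (mtop M)" using M by (simp add: smooth_manifold_def)
  then have "closedin (top_of_set J) {t \<in> topspace (top_of_set J). \<gamma> t = \<delta> t}"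
    using closedin_continuous_maps_eq solvesD(2)[OF g] solvesD(2)[OF h] by blast
  then have "closedin (top_of_set J) ?A" by simp
  moreover have "open ?A"
  proof (subst open_subopen, safe)
    fix r assume r: "r \<in> J" "\<gamma> r = \<delta> r"
    obtain d where "d > 0" "\<And>t. \<bar>t - r\<bar> < d \<Longrightarrow> t \<in> J \<and> \<gamma> t = \<delta> t"
      using solves_unique_near[OF g h r] by blast
    then show "\<exists>T. open T \<and> r \<in> T \<and> T \<subseteq> ?A"
      by (intro exI[of _ "ball r d"]) (auto simp: dist_real_def abs_minus_commute)
  qed
  ultimately have "?A = {} \<or> ?A = J" using J open_subset[of ?A J] unfolding connected_clopen by blast
  with s t show ?thesis by blast
qed

lemma integral_curves_agree:
  assumes "integral_curve M X x J \<gamma>" "integral_curve M X x J' \<gamma>'" "t \<in> J" "t \<in> J'"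
  shows "\<gamma> t = \<gamma>' t"
proof -
  have "open (J \<inter> J')" "connected (J \<inter> J')"
    using assms by (auto simp: integral_curve_def is_interval_connected_1[symmetric] intro: is_interval_Int)
  then show ?thesis
    using solves_unique[of "J \<inter> J'" \<gamma> \<gamma>' 0 t] assms solves_subset[of M X J \<gamma> "J \<inter> J'"]
      solves_subset[of M X J' \<gamma>' "J \<inter> J'"]
    by (auto simp: integral_curve_iff_solves)
qed

text \<open>The union of all integral curves through \<open>x\<close>: any two agree where both are
  defined, so the union is again an integral curve, and the largest one rather than merely a maximal
  one.\<close>

lemma maximal_curve_exists:
  assumes "integral_curve M X x J0 \<gamma>0"
  obtains Jm \<gamma>m where "maximal_integral_curve M X x Jm \<gamma>m"
    "\<And>J \<gamma>. integral_curve M X x J \<gamma> \<Longrightarrow> J \<subseteq> Jm" "\<And>J \<gamma> t. integral_curve M X x J \<gamma> \<Longrightarrow> t \<in> J \<Longrightarrow> \<gamma>m t = \<gamma> t"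
proof -
  define Jm where "Jm = \<Union>{J. \<exists>\<gamma>. integral_curve M X x J \<gamma>}"
  define \<gamma>m where "\<gamma>m t = (THE y. \<exists>J \<gamma>. integral_curve M X x J \<gamma> \<and> t \<in> J \<and> y = \<gamma> t)" for t
  have sub: "J \<subseteq> Jm" if "integral_curve M X x J \<gamma>" for J \<gamma> using that by (auto simp: Jm_def)
  have eq: "\<gamma>m t = \<gamma> t" if "integral_curve M X x J \<gamma>" "t \<in> J" for J \<gamma> t
    unfolding \<gamma>m_def using that integral_curves_agree by (intro the_equality) blast+
  have "open Jm" unfolding Jm_def by (auto simp: integral_curve_def)
  have "solves M X Jm \<gamma>m"
  proof (rule solves_locally[OF \<open>open Jm\<close>])
    fix t assume "t \<in> Jm"
    then obtain J \<gamma> where J: "integral_curve M X x J \<gamma>" "t \<in> J" by (auto simp: Jm_def)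
    then show "\<exists>J' \<gamma>'. t \<in> J' \<and> solves M X J' \<gamma>' \<and> (\<forall>s\<in>J'. s \<in> Jm \<and> \<gamma>m s = \<gamma>' s)"
      using sub[OF J(1)] eq[OF J(1)] by (auto simp: integral_curve_iff_solves intro!: exI[of _ J] exI[of _ \<gamma>])
  qed
  moreover have "connected Jm" unfolding Jm_def
    by (rule connected_Union) (auto simp: integral_curve_iff_solves)
  moreover have "0 \<in> Jm" "\<gamma>m 0 = x"
    using sub[OF assms] eq[OF assms] assms by (auto simp: integral_curve_iff_solves)
  ultimately have "integral_curve M X x Jm \<gamma>m" by (simp add: integral_curve_iff_solves)
  then have "maximal_integral_curve M X x Jm \<gamma>m"
    unfolding maximal_integral_curve_def using sub by blast
  from that[of Jm \<gamma>m, OF this] sub eq show thesis by blast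
qed

lemma integral_curve_in_points: "integral_curve M X x J \<gamma> \<Longrightarrow> t \<in> J \<Longrightarrow> \<gamma> t \<in> points M"
  unfolding integral_curve_iff_solves using solvesD(4) by fast

text \<open>Together with \<open>flow_eq\<close> this relieves later arguments of maximality: any
  integral curve through \<open>x\<close> that reaches time \<open>t\<close> computes the
  flow.\<close>

lemma flow_domain_iff: "(t, x) \<in> flow_domain M X \<longleftrightarrow> (\<exists>J \<gamma>. integral_curve M X x J \<gamma> \<and> t \<in> J)"
proof
  assume "\<exists>J \<gamma>. integral_curve M X x J \<gamma> \<and> t \<in> J"
  then obtain J \<gamma> where J: "integral_curve M X x J \<gamma>" "t \<in> J" by blast
  obtain Jm \<gamma>m where "maximal_integral_curve M X x Jm \<gamma>m" "J \<subseteq> Jm"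
    using maximal_curve_exists[OF J(1)] J(1) by metis
  moreover have "x \<in> points M"
    using integral_curve_in_points[OF J(1), of 0] J(1) by (simp add: integral_curve_def)
  ultimately show "(t, x) \<in> flow_domain M X" using J(2) by (auto simp: flow_domain_def)
qed (auto simp: flow_domain_def maximal_integral_curve_def)

lemma flow_eq:
  assumes "integral_curve M X x J \<gamma>" "t \<in> J" shows "flow M X t x = \<gamma> t"
  unfolding flow_def
proof (rule the_equality)
  obtain Jm \<gamma>m where "maximal_integral_curve M X x Jm \<gamma>m" "J \<subseteq> Jm" "\<gamma>m t = \<gamma> t"
    using maximal_curve_exists[OF assms(1)] assms by metis
  then show "\<exists>J' \<gamma>'. maximal_integral_curve M X x J' \<gamma>' \<and> t \<in> J' \<and> \<gamma> t = \<gamma>' t"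
    using assms(2) by (intro exI[of _ Jm] exI[of _ \<gamma>m]) auto
qed (use assms integral_curves_agree in \<open>auto simp: maximal_integral_curve_def\<close>)

lemma flow_domainE:
  assumes "(t, x) \<in> flow_domain M X"
  obtains J \<gamma> where "integral_curve M X x J \<gamma>" "t \<in> J" "\<And>s. s \<in> J \<Longrightarrow> flow M X s x = \<gamma> s"
    "\<And>s. s \<in> J \<Longrightarrow> (s, x) \<in> flow_domain M X"
  using assms flow_eq unfolding flow_domain_iff by metis

lemma flow_in_points:
  assumes "(t, x) \<in> flow_domain M X" shows "x \<in> points M" "flow M X t x \<in> points M"
proof -
  show "x \<in> points M" using assms by (simp add: flow_domain_def)
  show "flow M X t x \<in> points M"
    using assms integral_curve_in_points by (metis flow_domainE)
qed

text \<open>The coordinate ball provided by \<open>local_flow_exists\<close>, pulled back to the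
  manifold. One existence time \<open>e\<close> serves all of \<open>W\<close>; this local
  uniformity drives the continuation along longer curves.\<close>

lemma local_flow:
  assumes p: "p \<in> points M"
  obtains e W where "e > 0" "openin (mtop M) W" "p \<in> W"
    "\<And>t q. \<bar>t\<bar> < e \<Longrightarrow> q \<in> W \<Longrightarrow> (t, q) \<in> flow_domain M X"
    "\<And>t q. \<bar>t\<bar> < e \<Longrightarrow> q \<in> W \<Longrightarrow> smooth_near M M (flow M X t) q"
proof -
  obtain c where c: "c \<in> atlas M" "p \<in> fst c" using chartedD(1)[OF charted p] by blast
  let ?S = "snd c ` fst c" and ?f = "\<lambda>y. snd (X (chart_inv c y)) c"
  have "snd c p \<in> ?S" using c by simp
  from local_flow_exists[OF open_chart_image[OF charted c(1)] X_smooth[OF c(1)] this]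
  obtain F r e where r: "r > 0" and e: "e > 0" and F: "ball (snd c p) r \<subseteq> ?S"
    "\<And>x. x \<in> ball (snd c p) r \<Longrightarrow> F 0 x = x"
    "\<And>t x. x \<in> ball (snd c p) r \<Longrightarrow> F t x \<in> ?S"
    "\<And>t x. x \<in> ball (snd c p) r \<Longrightarrow> \<bar>t\<bar> < e \<Longrightarrow> ((\<lambda>t. F t x) has_vector_derivative ?f (F t x)) (at t)"
    "\<And>t. smooth_on (ball (snd c p) r) (F t)"
    by metis
  let ?B = "ball (snd c p) r"
  define W where "W = {q \<in> fst c. snd c q \<in> ?B}"
  have W: "openin (mtop M) W" unfolding W_def by (rule chartedD(5)[OF charted c(1) open_ball])
  have curve: "integral_curve M X q {-e<..<e} (\<lambda>t. chart_inv c (F t (snd c q)))" if q: "q \<in> W" for q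
    unfolding integral_curve_iff_solves
  proof (intro conjI)
    have qB: "snd c q \<in> ?B" "q \<in> fst c" using q by (auto simp: W_def)
    have inS: "F t (snd c q) \<in> ?S" for t by (rule F(3)[OF qB(1)])
    have D: "((\<lambda>t. F t (snd c q)) has_vector_derivative ?f (F t (snd c q))) (at t)" if "t \<in> {-e<..<e}" for t
      by (rule F(4)[OF qB(1)]) (use that in auto)
    show "solves M X {-e<..<e} (\<lambda>t. chart_inv c (F t (snd c q)))"
    proof (rule solvesI)
      have "continuous_on {-e<..<e} (\<lambda>t. F t (snd c q))"
        using D has_vector_derivative_continuous by (intro continuous_at_imp_continuous_on) blast
      then have "continuous_map (top_of_set {-e<..<e}) (top_of_set ?S) (\<lambda>t. F t (snd c q))"
        using inS by (auto simp: continuous_map_in_subtopology)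
      from continuous_map_compose[OF this continuous_map_chart_inv[OF charted c(1)]]
      show "continuous_map (top_of_set {-e<..<e}) (mtop M) (\<lambda>t. chart_inv c (F t (snd c q)))"
        by (simp add: o_def)
      fix t assume t: "t \<in> {-e<..<e}"
      show "\<exists>d\<in>atlas M. chart_inv c (F t (snd c q)) \<in> fst d \<and>
        ((snd d \<circ> (\<lambda>t. chart_inv c (F t (snd c q)))) has_vector_derivative snd (X (chart_inv c (F t (snd c q)))) d) (at t)"
        using D[OF t] chart_inv(2,3)[OF charted c(1) inS] c(1) by (auto simp: o_def intro!: bexI[of _ c])
    qed simp
    show "chart_inv c (F 0 (snd c q)) = q" using F(2)[OF qB(1)] chart_inv(1)[OF charted c(1) qB(2)] by simp
  qed (use e in auto)
  show thesis
  proof (rule that[OF e W])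
    show "p \<in> W" using c r by (simp add: W_def)
    fix t q assume t: "\<bar>t\<bar> < e" and q: "q \<in> W"
    have tJ: "t \<in> {-e<..<e}" using t by auto
    show "(t, q) \<in> flow_domain M X" using curve[OF q] tJ by (auto simp: flow_domain_iff)
    have fl: "flow M X t q = chart_inv c (F t (snd c q))" if "q \<in> W" for q
      using flow_eq[OF curve[OF that] tJ] .
    have oW: "open (snd c ` W)" by (rule chartedD(4)[OF charted c(1) W]) (auto simp: W_def)
    show "smooth_near M M (flow M X t) q"
    proof (rule smooth_nearI[OF c(1) c(1) W q])
      show "flow M X t ` W \<subseteq> fst c" using fl chart_inv(2)[OF charted c(1) F(3)] by (auto simp: W_def)
      have "smooth_on (snd c ` W) (F t)" by (rule smooth_on_subset[OF F(5)]) (auto simp: W_def)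
      then show "smooth_on (snd c ` W) (snd c \<circ> flow M X t \<circ> chart_inv c)"
      proof (rule smooth_on_cong[OF oW])
        fix y assume "y \<in> snd c ` W"
        then obtain q where q: "y = snd c q" "q \<in> W" by auto
        then have "chart_inv c y = q" "y \<in> ?B" using chart_inv(1)[OF charted c(1)] by (auto simp: W_def)
        then show "F t y = (snd c \<circ> flow M X t \<circ> chart_inv c) y"
          using fl[OF q(2)] q(1) chart_inv(3)[OF charted c(1) F(3)] by simp
      qed
    qed (auto simp: W_def)
  qed
qed

section \<open>The group law of the flow\<close>

lemma flow_0: assumes "p \<in> points M" shows "(0, p) \<in> flow_domain M X" "flow M X 0 p = p"
proof -
  obtain e W where "e > 0" "p \<in> W" "\<And>t q. \<bar>t\<bar> < e \<Longrightarrow> q \<in> W \<Longrightarrow> (t, q) \<in> flow_domain M X"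
    using local_flow[OF assms] by metis
  then show D: "(0, p) \<in> flow_domain M X" by simp
  obtain J \<gamma> where "integral_curve M X p J \<gamma>" "0 \<in> J" "flow M X 0 p = \<gamma> 0"
    using flow_domainE[OF D] by metis
  then show "flow M X 0 p = p" by (simp add: integral_curve_def)
qed

text \<open>Restarting the curve through \<open>x\<close> at time \<open>s\<close> gives a curve
  through \<open>flow M X s x\<close> that is back at \<open>x\<close> at time \<open>- s\<close>,
  because 0 lies in the original domain.\<close>

lemma flow_inverse:
  assumes "(s, x) \<in> flow_domain M X"
  shows "(- s, flow M X s x) \<in> flow_domain M X" "flow M X (- s) (flow M X s x) = x"
proof -
  obtain J \<gamma> where J: "integral_curve M X x J \<gamma>" "s \<in> J" "flow M X s x = \<gamma> s" using flow_domainE[OF assms] by metis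
  have "{t. t + s \<in> J} = (\<lambda>t. t - s) ` J" by (force simp: image_iff)
  then have "connected {t. t + s \<in> J}"
    using J(1) by (auto simp: integral_curve_iff_solves intro!: connected_continuous_image continuous_intros)
  then have I: "integral_curve M X (flow M X s x) {t. t + s \<in> J} (\<lambda>t. \<gamma> (t + s))"
    using J solves_shift[of M X J \<gamma> s] by (simp add: integral_curve_iff_solves)
  have m: "- s \<in> {t. t + s \<in> J}" using J(1) by (simp add: integral_curve_def)
  show "(- s, flow M X s x) \<in> flow_domain M X" using I m by (auto simp: flow_domain_iff)
  show "flow M X (- s) (flow M X s x) = x" using flow_eq[OF I m] J(1) by (simp add: integral_curve_def)
qed

text \<open>The curve through \<open>x\<close> and the shifted curve through its value at time
  \<open>s\<close> meet at \<open>s\<close>. The overlap of their intervals is an interval, so they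
  agree throughout it and can be glued.\<close>

lemma flow_add:
  assumes "(s, x) \<in> flow_domain M X" "(t, flow M X s x) \<in> flow_domain M X"
  shows "(s + t, x) \<in> flow_domain M X" "flow M X (s + t) x = flow M X t (flow M X s x)"
proof -
  obtain J \<gamma> where J: "integral_curve M X x J \<gamma>" "s \<in> J" "flow M X s x = \<gamma> s" using flow_domainE[OF assms(1)] by metis
  obtain J' \<delta> where J': "integral_curve M X (\<gamma> s) J' \<delta>" "t \<in> J'" "flow M X t (\<gamma> s) = \<delta> t"
    using flow_domainE[OF assms(2)] J(3) by metis
  let ?K = "{u. u + (- s) \<in> J'}" and ?\<delta> = "\<lambda>u. \<delta> (u + (- s))"
  have K: "solves M X ?K ?\<delta>" using solves_shift[of M X J' \<delta> "- s"] J'(1) by (simp add: integral_curve_iff_solves)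
  have "?K = (\<lambda>t. t + s) ` J'" by (force simp: image_iff)
  then have cK: "connected ?K"
    using J'(1) by (auto simp: integral_curve_iff_solves intro!: connected_continuous_image continuous_intros)
  have sK: "s \<in> ?K" "?\<delta> s = \<gamma> s" using J'(1) by (auto simp: integral_curve_def)
  have g: "solves M X J \<gamma>" "connected J" "0 \<in> J" "\<gamma> 0 = x" using J(1) by (auto simp: integral_curve_iff_solves)
  have agree: "\<gamma> u = ?\<delta> u" if "u \<in> J" "u \<in> ?K" for u
  proof (rule solves_unique[where J = "J \<inter> ?K" and \<gamma> = \<gamma> and \<delta> = "?\<delta>" and s = s])
    have o: "open (J \<inter> ?K)" using solvesD(1)[OF g(1)] solvesD(1)[OF K] by blast
    show "solves M X (J \<inter> ?K) \<gamma>" "solves M X (J \<inter> ?K) ?\<delta>"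
      using solves_subset[OF g(1) o] solves_subset[OF K o] by auto
    show "connected (J \<inter> ?K)" using g(2) cK unfolding is_interval_connected_1[symmetric] by (rule is_interval_Int)
  qed (use that J(2) sK in auto)
  define \<epsilon> where "\<epsilon> u = (if u \<in> J then \<gamma> u else ?\<delta> u)" for u
  have \<epsilon>: "\<And>u. u \<in> J \<Longrightarrow> \<epsilon> u = \<gamma> u" "\<And>u. u \<in> ?K \<Longrightarrow> \<epsilon> u = ?\<delta> u" using agree by (auto simp: \<epsilon>_def)
  have "solves M X (J \<union> ?K) \<epsilon>"
  proof (rule solves_locally)
    show "open (J \<union> ?K)" using solvesD(1)[OF g(1)] solvesD(1)[OF K] by blast
    fix u assume "u \<in> J \<union> ?K"
    then consider "u \<in> J" | "u \<in> ?K" by blast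
    then show "\<exists>J' \<gamma>'. u \<in> J' \<and> solves M X J' \<gamma>' \<and> (\<forall>s\<in>J'. s \<in> J \<union> ?K \<and> \<epsilon> s = \<gamma>' s)"
    proof cases
      case 1
      show ?thesis by (intro exI[of _ J] exI[of _ \<gamma>] conjI 1 g(1) ballI \<epsilon>(1) UnI1)
    next
      case 2
      show ?thesis by (intro exI[of _ ?K] exI[of _ ?\<delta>] conjI 2 K ballI \<epsilon>(2) UnI2)
    qed
  qed
  moreover have "connected (J \<union> ?K)" using g(2) cK J(2) sK(1) by (intro connected_Un) auto
  ultimately have I: "integral_curve M X x (J \<union> ?K) \<epsilon>"
    using g(3,4) \<epsilon>(1) by (simp add: integral_curve_iff_solves)
  have m: "s + t \<in> ?K" using J'(2) by simp
  show "(s + t, x) \<in> flow_domain M X" using I m by (auto simp: flow_domain_iff)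
  show "flow M X (s + t) x = flow M X t (flow M X s x)"
    using flow_eq[OF I, of "s + t"] m \<epsilon>(2)[OF m] J(3) J'(3) by simp
qed

text \<open>The times with the property below form an open and closed part of the domain of an
  integral curve: flows for nearby times differ by the local flow at one point of the curve.\<close>

lemma flow_smooth_uniformly:
  assumes "(t, x) \<in> flow_domain M X"
  shows "\<exists>\<delta>>0. \<exists>W. openin (mtop M) W \<and> x \<in> W \<and>
    (\<forall>s y. \<bar>s - t\<bar> < \<delta> \<longrightarrow> y \<in> W \<longrightarrow> (s, y) \<in> flow_domain M X \<and> smooth_near M M (flow M X s) y)"
    (is "?P t")
proof -
  obtain J \<gamma> where J: "integral_curve M X x J \<gamma>" "t \<in> J" and fl: "\<And>s. s \<in> J \<Longrightarrow> flow M X s x = \<gamma> s"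
    using flow_domainE[OF assms] by metis
  have g: "solves M X J \<gamma>" "connected J" "0 \<in> J" "\<gamma> 0 = x" using J(1) by (auto simp: integral_curve_iff_solves)
  show ?thesis
  proof (rule connected_induction_simple[where P = ?P, OF g(2,3) J(2)])
    have "x \<in> points M" using flow_in_points(1)[OF assms] .
    then obtain e W where "e > 0" "openin (mtop M) W" "x \<in> W"
      "\<And>t q. \<bar>t\<bar> < e \<Longrightarrow> q \<in> W \<Longrightarrow> (t, q) \<in> flow_domain M X"
      "\<And>t q. \<bar>t\<bar> < e \<Longrightarrow> q \<in> W \<Longrightarrow> smooth_near M M (flow M X t) q"
      by (rule local_flow) blast
    then show "?P 0" by (intro exI[of _ e] conjI exI[of _ W]) auto
  next
    fix t1 assume t1: "t1 \<in> J"
    then have "\<gamma> t1 \<in> points M" using solvesD(4)[OF g(1)] by blast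
    then obtain e V where e: "e > 0" and V: "openin (mtop M) V" "\<gamma> t1 \<in> V"
      "\<And>t q. \<bar>t\<bar> < e \<Longrightarrow> q \<in> V \<Longrightarrow> (t, q) \<in> flow_domain M X"
      "\<And>t q. \<bar>t\<bar> < e \<Longrightarrow> q \<in> V \<Longrightarrow> smooth_near M M (flow M X t) q"
      by (rule local_flow) blast
    \<comment> \<open>With half of \<open>e\<close>, two times in \<open>?T\<close> differ by less
      than \<open>e\<close>, which the local flow on \<open>V\<close> can bridge in either
      direction.\<close>
    let ?T = "{\<tau> \<in> J. \<gamma> \<tau> \<in> V} \<inter> ball t1 (e / 2)"
    have step: "?P b" if a: "a \<in> ?T" and b: "b \<in> ?T" and Pa: "?P a" for a b
    proof -
      obtain \<delta> W where \<delta>: "\<delta> > 0" and W: "openin (mtop M) W" "x \<in> W"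
        "\<And>s y. \<bar>s - a\<bar> < \<delta> \<Longrightarrow> y \<in> W \<Longrightarrow> (s, y) \<in> flow_domain M X"
        "\<And>s y. \<bar>s - a\<bar> < \<delta> \<Longrightarrow> y \<in> W \<Longrightarrow> smooth_near M M (flow M X s) y"
        using Pa by blast
      have Wa: "(a, y) \<in> flow_domain M X" "smooth_near M M (flow M X a) y" if "y \<in> W" for y
        using W(3,4)[of a y] that \<delta> by auto
      have "flow M X a x \<in> V" using fl a by auto
      then obtain W0 where W0: "openin (mtop M) W0" "x \<in> W0" "flow M X a ` W0 \<subseteq> V"
        using smooth_near_continuous[OF charted charted Wa(2)[OF W(2)] V(1)] by blast
      have "\<bar>t1 - a\<bar> < e / 2" "\<bar>t1 - b\<bar> < e / 2" using a b by (auto simp: dist_real_def)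
      then have "\<bar>b - a\<bar> < e" by linarith
      show "?P b"
      \<comment> \<open>The remaining margin: it keeps \<open>s\<close> within \<open>e\<close> of
        \<open>a\<close>.\<close>
      proof (intro exI[of _ "e - \<bar>b - a\<bar>"] conjI exI[of _ "W \<inter> W0"] allI impI)
        show "openin (mtop M) (W \<inter> W0)" using W(1) W0(1) by blast
        fix s y assume s: "\<bar>s - b\<bar> < e - \<bar>b - a\<bar>" and y: "y \<in> W \<inter> W0"
        have s': "\<bar>s - a\<bar> < e" using s by linarith
        have *: "(s, z) \<in> flow_domain M X \<and> flow M X s z = flow M X (s - a) (flow M X a z)" if z: "z \<in> W \<inter> W0" for z
        proof -
          have "flow M X a z \<in> V" using z W0(3) by blast
          with flow_add[of a z "s - a"] Wa(1)[of z] V(3)[OF s'] z show ?thesis by simp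
        qed
        show "(s, y) \<in> flow_domain M X" using *[OF y] by blast
        have "smooth_near M M (\<lambda>z. flow M X (s - a) (flow M X a z)) y"
          by (rule smooth_near_compose[OF charted charted charted Wa(2) V(4)[OF s']]) (use y W0(3) in auto)
        then show "smooth_near M M (flow M X s) y"
          by (rule smooth_near_cong[OF charted charted _ openin_Int[OF W(1) W0(1)] y]) (simp add: *)
      qed (use \<open>\<bar>b - a\<bar> < e\<close> W(2) W0(2) in auto)
    qed
    show "\<exists>T. openin (top_of_set J) T \<and> t1 \<in> T \<and> (\<forall>a\<in>T. \<forall>b\<in>T. ?P a \<longrightarrow> ?P b)"
    proof (intro exI[of _ ?T] conjI ballI impI)
      show "openin (top_of_set J) ?T"
        by (rule open_subset) (auto intro!: solves_open_preimage[OF g(1) V(1)])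
      show "t1 \<in> ?T" using t1 V(2) e by simp
      show "?P b" if "a \<in> ?T" "b \<in> ?T" "?P a" for a b by (rule step[OF that])
    qed
  qed
qed

section \<open>Open flow domains and the maps at fixed times\<close>

lemma openin_flow_domain: "openin (prod_topology euclideanreal (mtop M)) (flow_domain M X)"
  unfolding openin_prod_topology_alt
proof (intro allI impI)
  fix t x assume "(t, x) \<in> flow_domain M X"
  from flow_smooth_uniformly[OF this] obtain \<delta> W where "\<delta> > 0" "openin (mtop M) W" "x \<in> W"
    "\<And>s y. \<bar>s - t\<bar> < \<delta> \<Longrightarrow> y \<in> W \<Longrightarrow> (s, y) \<in> flow_domain M X" by blast
  then show "\<exists>U V. openin euclideanreal U \<and> openin (mtop M) V \<and> t \<in> U \<and> x \<in> V \<and> U \<times> V \<subseteq> flow_domain M X"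
    by (intro exI[of _ "ball t \<delta>"] exI[of _ W]) (auto simp: dist_real_def abs_minus_commute)
qed

lemma openin_flow_domain_slice: "openin (mtop M) {x. (t, x) \<in> flow_domain M X}"
proof (subst openin_subopen, safe)
  fix x assume "(t, x) \<in> flow_domain M X"
  from flow_smooth_uniformly[OF this] obtain W where "openin (mtop M) W" "x \<in> W"
    "\<And>y. y \<in> W \<Longrightarrow> (t, y) \<in> flow_domain M X" by fastforce
  then show "\<exists>T. openin (mtop M) T \<and> x \<in> T \<and> T \<subseteq> {x. (t, x) \<in> flow_domain M X}" by blast
qed

lemma smooth_near_flow: "(t, x) \<in> flow_domain M X \<Longrightarrow> smooth_near M M (flow M X t) x"
  using flow_smooth_uniformly by force

lemma smooth_map_flow:
  "smooth_map (open_submanifold M {x. (t, x) \<in> flow_domain M X})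
    (open_submanifold M {x. (- t, x) \<in> flow_domain M X}) (flow M X t)"
proof -
  note W = openin_flow_domain_slice
  show ?thesis
    unfolding smooth_map_iff_smooth_near[OF charted_open_submanifold[OF charted W] charted_open_submanifold[OF charted W]]
      smooth_near_open_submanifold_source[OF charted W charted_open_submanifold[OF charted W]]
      smooth_near_open_submanifold_target[OF charted charted W] points_open_submanifold[OF W]
    by (auto simp: smooth_near_flow flow_inverse)
qed

lemma diffeomorphism_flow:
  "diffeomorphism (open_submanifold M {x. (t, x) \<in> flow_domain M X})
    (open_submanifold M {x. (- t, x) \<in> flow_domain M X}) (flow M X t)"
proof -
  have "smooth_map (open_submanifold M {x. (- t, x) \<in> flow_domain M X})
    (open_submanifold M {x. (t, x) \<in> flow_domain M X}) (flow M X (- t))"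
    using smooth_map_flow[of "- t"] by simp
  moreover have "flow M X t (flow M X (- t) x) = x" if "(- t, x) \<in> flow_domain M X" for x
    using that flow_inverse(2)[of "- t" x] by simp
  ultimately show ?thesis
    unfolding diffeomorphism_def points_open_submanifold[OF openin_flow_domain_slice]
    using smooth_map_flow[of t] flow_inverse(2) by blast
qed

end

section \<open>Products\<close>

lemma charted_model_manifold: "charted model_manifold"
proof -
  have "inv_into UNIV id = (id :: 'a \<Rightarrow> 'a)" by (auto simp: inv_id)
  then show ?thesis
    by (auto simp: charted_def model_manifold_def chart_inv_def id_def o_def
        intro: smooth_on_linear[OF open_UNIV bounded_linear_ident])
qed

lemma chart_inv_model: "chart_inv (UNIV, id) = id"
  by (simp add: chart_inv_def)

lemma atlas_prod_manifold:
  "atlas (prod_manifold M N) = {(fst c \<times> fst d, map_prod (snd c) (snd d)) | c d. c \<in> atlas M \<and> d \<in> atlas N}"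
  by (force simp: prod_manifold_def)

lemma prod_chart_in_atlas:
  "c \<in> atlas M \<Longrightarrow> d \<in> atlas N \<Longrightarrow> (fst c \<times> fst d, map_prod (snd c) (snd d)) \<in> atlas (prod_manifold M N)"
  unfolding atlas_prod_manifold by blast

lemma chart_inv_prod:
  assumes M: "charted M" and N: "charted N" and c: "c \<in> atlas M" and d: "d \<in> atlas N" "p \<in> fst c" "q \<in> fst d"
  shows "chart_inv (fst c \<times> fst d, map_prod (snd c) (snd d)) (snd c p, snd d q) = (p, q)"
proof -
  have "inj_on (map_prod (snd c) (snd d)) (fst c \<times> fst d)"
    by (rule map_prod_inj_on[OF chartedD(3)[OF M c] chartedD(3)[OF N d(1)]])
  from inv_into_f_f[OF this, of "(p, q)"] show ?thesis using d by (simp add: chart_inv_def)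
qed

lemma points_prod_manifold: "points (prod_manifold M N) = points M \<times> points N"
  by (simp add: prod_manifold_def)

lemma charted_prod_manifold:
  assumes M: "charted M" and N: "charted N" shows "charted (prod_manifold M N)"
proof -
  have top: "mtop (prod_manifold M N) = prod_topology (mtop M) (mtop N)" by (simp add: prod_manifold_def)
  have "\<exists>e\<in>atlas (prod_manifold M N). p \<in> fst e" if p: "p \<in> points M \<times> points N" for p
  proof -
    obtain c d where "c \<in> atlas M" "fst p \<in> fst c" "d \<in> atlas N" "snd p \<in> fst d"
      using p chartedD(1)[OF M, of "fst p"] chartedD(1)[OF N, of "snd p"] unfolding mem_Times_iff by blast
    then show ?thesis by (intro bexI[OF _ prod_chart_in_atlas]) (auto simp: mem_Times_iff)
  qed
  moreover have "openin (mtop (prod_manifold M N)) (fst e) \<and> inj_on (snd e) (fst e) \<and>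
      (\<forall>W. openin (mtop (prod_manifold M N)) W \<and> W \<subseteq> fst e \<longrightarrow> open (snd e ` W)) \<and>
      (\<forall>G. open G \<longrightarrow> openin (mtop (prod_manifold M N)) {p \<in> fst e. snd e p \<in> G})"
    if "e \<in> atlas (prod_manifold M N)" for e
  proof -
    from that obtain c d where c: "c \<in> atlas M" and d: "d \<in> atlas N"
      and e: "e = (fst c \<times> fst d, map_prod (snd c) (snd d))" unfolding atlas_prod_manifold by blast
    have "open (snd e ` W)" if W: "openin (prod_topology (mtop M) (mtop N)) W" "W \<subseteq> fst e" for W
    proof (subst open_subopen, intro ballI)
      fix y assume "y \<in> snd e ` W"
      then obtain p q where y: "y = snd e (p, q)" and pq: "(p, q) \<in> W" by auto
      from W(1)[unfolded openin_prod_topology_alt, rule_format, OF pq]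
      obtain U V where UV: "openin (mtop M) U" "openin (mtop N) V" "p \<in> U" "q \<in> V" "U \<times> V \<subseteq> W"
        by blast
      have sub: "U \<subseteq> fst c" "V \<subseteq> fst d" using UV(3-5) W(2) by (auto simp: e)
      show "\<exists>T. open T \<and> y \<in> T \<and> T \<subseteq> snd e ` W"
      proof (intro exI[of _ "snd c ` U \<times> snd d ` V"] conjI)
        show "open (snd c ` U \<times> snd d ` V)"
          by (intro open_Times chartedD(4)[OF M c UV(1) sub(1)] chartedD(4)[OF N d UV(2) sub(2)])
        have "snd c ` U \<times> snd d ` V = snd e ` (U \<times> V)" by (simp add: e map_prod_surj_on)
        then show "snd c ` U \<times> snd d ` V \<subseteq> snd e ` W" using UV(5) by blast
      qed (use UV in \<open>simp add: y e\<close>)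
    qed
    moreover have "openin (prod_topology (mtop M) (mtop N)) {p \<in> fst e. snd e p \<in> G}" if G: "open G" for G
      unfolding openin_prod_topology_alt
    proof (intro allI impI)
      fix p q assume "(p, q) \<in> {p \<in> fst e. snd e p \<in> G}"
      then have pq: "p \<in> fst c" "q \<in> fst d" "(snd c p, snd d q) \<in> G" by (auto simp: e)
      obtain A B where AB: "open A" "open B" "snd c p \<in> A" "snd d q \<in> B" "A \<times> B \<subseteq> G"
        by (rule open_prod_elim[OF G pq(3)]) auto
      then show "\<exists>U V. openin (mtop M) U \<and> openin (mtop N) V \<and> p \<in> U \<and> q \<in> V \<and> U \<times> V \<subseteq> {p \<in> fst e. snd e p \<in> G}"
        using pq chartedD(5)[OF M c AB(1)] chartedD(5)[OF N d AB(2)]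
        by (intro exI[of _ "{p \<in> fst c. snd c p \<in> A}"] exI[of _ "{q \<in> fst d. snd d q \<in> B}"]) (auto simp: e)
    qed
    ultimately show ?thesis
      using chartedD(2,3)[OF M c] chartedD(2,3)[OF N d]
      by (auto simp: top e openin_prod_Times_iff intro: map_prod_inj_on)
  qed
  moreover have "smooth_on (snd e ` (fst e \<inter> fst e')) (snd e' \<circ> chart_inv e)"
    if "e \<in> atlas (prod_manifold M N)" "e' \<in> atlas (prod_manifold M N)" for e e'
  proof -
    from that obtain c d c' d' where c: "c \<in> atlas M" "c' \<in> atlas M" and d: "d \<in> atlas N" "d' \<in> atlas N"
      and e: "e = (fst c \<times> fst d, map_prod (snd c) (snd d))" "e' = (fst c' \<times> fst d', map_prod (snd c') (snd d'))"
      unfolding atlas_prod_manifold by blast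
    let ?A = "snd c ` (fst c \<inter> fst c')" and ?B = "snd d ` (fst d \<inter> fst d')"
    have oA: "open ?A" by (rule chartedD(4)[OF M c(1)]) (auto intro!: openin_Int chartedD(2)[OF M] c)
    have oB: "open ?B" by (rule chartedD(4)[OF N d(1)]) (auto intro!: openin_Int chartedD(2)[OF N] d)
    have o: "open (?A \<times> ?B)" by (rule open_Times[OF oA oB])
    have 1: "smooth_on (?A \<times> ?B) (\<lambda>z. (snd c' \<circ> chart_inv c) (fst z))"
      by (rule smooth_on_compose[OF o oA smooth_on_linear[OF o bounded_linear_fst] chartedD(6)[OF M c]]) auto
    have 2: "smooth_on (?A \<times> ?B) (\<lambda>z. (snd d' \<circ> chart_inv d) (snd z))"
      by (rule smooth_on_compose[OF o oB smooth_on_linear[OF o bounded_linear_snd] chartedD(6)[OF N d]]) auto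
    have "smooth_on (?A \<times> ?B) (snd e' \<circ> chart_inv e)"
    proof (rule smooth_on_cong[OF o smooth_on_Pair[OF o 1 2]])
      fix z assume "z \<in> ?A \<times> ?B"
      then obtain p q where "z = (snd c p, snd d q)" "p \<in> fst c" "q \<in> fst d" by blast
      then show "((snd c' \<circ> chart_inv c) (fst z), (snd d' \<circ> chart_inv d) (snd z)) = (snd e' \<circ> chart_inv e) z"
        by (simp add: e chart_inv_prod[OF M N c(1) d(1)] chart_inv(1)[OF M c(1)] chart_inv(1)[OF N d(1)])
    qed
    moreover have "snd e ` (fst e \<inter> fst e') = ?A \<times> ?B" by (force simp: e)
    ultimately show ?thesis by simp
  qed
  ultimately show ?thesis unfolding charted_def points_prod_manifold by blast
qed

text \<open>The model factor needs no coordinates, so smoothness is read off from a map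
  \<open>k\<close> in which only the first factor is expressed in a chart.\<close>

lemma smooth_near_prodI:
  fixes N :: "('a, 'm::fin_dim_inner) manifold" and h :: "'a \<times> 'f::fin_dim_inner \<Rightarrow> 'b" and Q :: "('b, 'n::fin_dim_inner) manifold"
  assumes N: "charted N" and c: "c \<in> atlas N" and d: "d \<in> atlas Q" and z: "fst z \<in> fst c"
    and im: "\<And>x v. x \<in> fst c \<Longrightarrow> h (x, v) \<in> fst d"
    and s: "smooth_on (snd c ` fst c \<times> UNIV) k"
    and k: "\<And>x v. x \<in> fst c \<Longrightarrow> snd d (h (x, v)) = k (snd c x, v)"
  shows "smooth_near (prod_manifold N (model_manifold :: ('f, 'f) manifold)) Q h z"
proof -
  let ?P = "prod_manifold N (model_manifold :: ('f, 'f) manifold)"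
  let ?e = "(fst c \<times> UNIV, map_prod (snd c) id) :: ('a \<times> 'f, 'm \<times> 'f) chart"
  have m: "(UNIV, id) \<in> atlas (model_manifold :: ('f, 'f) manifold)" by (simp add: model_manifold_def)
  have e: "?e \<in> atlas ?P" using prod_chart_in_atlas[OF c m] by simp
  have P: "charted ?P" by (rule charted_prod_manifold[OF N charted_model_manifold])
  have im': "snd ?e ` fst ?e = snd c ` fst c \<times> UNIV" by force
  show ?thesis
  proof (rule smooth_nearI[OF e d chartedD(2)[OF P e]])
    have o: "open (snd ?e ` fst ?e)" by (rule open_chart_image[OF P e])
    show "smooth_on (snd ?e ` fst ?e) (snd d \<circ> h \<circ> chart_inv ?e)"
    proof (rule smooth_on_cong[OF o s[folded im']])
      fix y assume "y \<in> snd ?e ` fst ?e"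
      then obtain x v where y: "y = (snd c x, v)" "x \<in> fst c" by auto
      then show "k y = (snd d \<circ> h \<circ> chart_inv ?e) y"
        using chart_inv_prod[OF N charted_model_manifold c m y(2), of v] k[OF y(2)] by simp
    qed
  qed (use z im in \<open>auto simp: mem_Times_iff\<close>)
qed

lemma smooth_near_prod_scale:
  assumes N: "charted N" and z: "fst z \<in> points N"
  shows "smooth_near (prod_manifold N model_manifold) (prod_manifold N model_manifold) (\<lambda>z. (fst z, \<alpha> *\<^sub>R snd z)) z"
proof -
  obtain c where c: "c \<in> atlas N" "fst z \<in> fst c" using chartedD(1)[OF N z] by blast
  let ?e = "(fst c \<times> UNIV, map_prod (snd c) id)"
  have m: "(UNIV, id) \<in> atlas model_manifold" by (simp add: model_manifold_def)
  have e: "?e \<in> atlas (prod_manifold N model_manifold)" using prod_chart_in_atlas[OF c(1) m] by simp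
  have o: "open (snd c ` fst c \<times> UNIV)" by (intro open_Times open_chart_image[OF N c(1)] open_UNIV)
  show ?thesis
    by (rule smooth_near_prodI[OF N c(1) e c(2), where k = "\<lambda>y. (fst y, \<alpha> *\<^sub>R snd y)"])
      (auto intro!: smooth_on_linear[OF o] bounded_linear_Pair bounded_linear_fst
        bounded_linear_compose[OF bounded_linear_scaleR_right bounded_linear_snd])
qed

lemma smooth_near_prod_snd:
  assumes N: "charted N" and z: "fst z \<in> points N"
  shows "smooth_near (prod_manifold N model_manifold) model_manifold snd z"
proof -
  obtain c where c: "c \<in> atlas N" "fst z \<in> fst c" using chartedD(1)[OF N z] by blast
  have m: "(UNIV, id) \<in> atlas model_manifold" by (simp add: model_manifold_def)
  have o: "open (snd c ` fst c \<times> UNIV)" by (intro open_Times open_chart_image[OF N c(1)] open_UNIV)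
  show ?thesis
    by (rule smooth_near_prodI[OF N c(1) m c(2) _ smooth_on_linear[OF o bounded_linear_snd]]) auto
qed

lemma smooth_near_prod_slice:
  assumes N: "charted N" and x: "x \<in> points N"
  shows "smooth_near model_manifold (prod_manifold N model_manifold) (\<lambda>v. (x, v)) v"
proof -
  obtain c where c: "c \<in> atlas N" "x \<in> fst c" using chartedD(1)[OF N x] by blast
  have m: "(UNIV, id) \<in> atlas model_manifold" by (simp add: model_manifold_def)
  have e: "(fst c \<times> UNIV, map_prod (snd c) id) \<in> atlas (prod_manifold N model_manifold)"
    using prod_chart_in_atlas[OF c(1) m] by simp
  have "smooth_on UNIV (\<lambda>v. (snd c x, v))"
    by (rule smooth_on_Pair[OF open_UNIV smooth_on_const smooth_on_linear[OF open_UNIV bounded_linear_ident]])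
  then show ?thesis
    by (intro smooth_nearI[OF m e, of UNIV]) (use c in \<open>auto simp: chart_inv_model o_def model_manifold_def\<close>)
qed

lemma smooth_near_model_differentiable:
  assumes "smooth_near model_manifold model_manifold F v" shows "F differentiable (at v)"
proof -
  obtain W where W: "open W" "v \<in> W" "smooth_on W F"
    using assms unfolding smooth_near_def by (auto simp: model_manifold_def chart_inv_model[unfolded id_def] id_def o_def)
  then show ?thesis using smooth_on_has_derivative differentiableI by blast
qed

text \<open>On the line through \<open>v\<close> the map is
  \<open>h \<mapsto> h *\<^sub>R F v\<close>, with derivative \<open>F v\<close> at 0. By the chain
  rule this derivative is also \<open>D v\<close>, so \<open>F\<close> coincides with the linear map
  \<open>D\<close>.\<close>

lemma homogeneous_differentiable_additive:
  fixes F :: "'a::real_normed_vector \<Rightarrow> 'b::real_normed_vector"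
  assumes hom: "\<And>\<alpha> v. F (\<alpha> *\<^sub>R v) = \<alpha> *\<^sub>R F v" and F: "F differentiable (at 0)"
  shows "F (v + w) = F v + F w"
proof -
  obtain D where D: "(F has_derivative D) (at 0)" using F by (auto simp: differentiable_def)
  interpret D: bounded_linear D using D has_derivative_bounded_linear by blast
  have "F v = D v" for v
  proof (rule vector_derivative_unique_at)
    show "((\<lambda>h. h *\<^sub>R F v) has_vector_derivative F v) (at 0)"
      unfolding has_vector_derivative_def by (auto intro!: derivative_eq_intros)
    have "((\<lambda>h. h *\<^sub>R v) has_derivative (\<lambda>h. h *\<^sub>R v)) (at 0)" by (auto intro!: derivative_eq_intros)
    from has_derivative_compose[OF this] D
    have "((\<lambda>h. F (h *\<^sub>R v)) has_derivative (\<lambda>h. D (h *\<^sub>R v))) (at 0)" by simp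
    then show "((\<lambda>h. h *\<^sub>R F v) has_vector_derivative D v) (at 0)"
      unfolding has_vector_derivative_def by (simp add: hom D.scaleR)
  qed
  then show ?thesis by (simp add: D.add)
qed

section \<open>Linear vector fields\<close>

text \<open>\<open>rel\<close> says that the two fields are \<open>h\<close>-related; the chain rule
  then turns the velocity of \<open>\<gamma>\<close> into that of its image. The maps to which this
  is applied are the bundle projection and the scalar multiplications.\<close>

lemma solves_related:
  assumes X: "vfield M X" and Y: "vfield N Y"
    and h: "\<And>p. p \<in> points M \<Longrightarrow> smooth_near M N h p"
    and rel: "\<And>p. p \<in> points M \<Longrightarrow> Y (h p) = tangent_map M N h (X p)"
    and g: "solves M X J \<gamma>"
  shows "solves N Y J (\<lambda>t. h (\<gamma> t))"
proof -
  interpret M: vfield M X by fact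
  interpret N: vfield N Y by fact
  have "continuous_map (mtop M) (mtop N) h"
    using h smooth_map_iff_smooth_near[OF M.charted N.charted] by (auto simp: smooth_map_def)
  from continuous_map_compose[OF solvesD(2)[OF g] this]
  have cont: "continuous_map (top_of_set J) (mtop N) (\<lambda>t. h (\<gamma> t))" by (simp add: o_def)
  show ?thesis
  proof (rule N.solvesI[OF solvesD(1)[OF g] cont])
    fix t assume t: "t \<in> J"
    note p = solvesD(4)[OF g t]
    \<comment> \<open>The same choice of chart as inside \<open>tangent_map\<close>, so that its
      definition unfolds to the derivative in \<open>c\<close>.\<close>
    define c where "c = (SOME c. c \<in> atlas M \<and> \<gamma> t \<in> fst c)"
    have c: "c \<in> atlas M" "\<gamma> t \<in> fst c"
      using someI_ex[of "\<lambda>c. c \<in> atlas M \<and> \<gamma> t \<in> fst c"] chartedD(1)[OF M.charted p] unfolding c_def by blast+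
    obtain d where d: "d \<in> atlas N" "h (\<gamma> t) \<in> fst d"
      using chartedD(1)[OF N.charted smooth_near_in_points(2)[OF M.charted N.charted h[OF p]]] by blast
    have "snd (Y (h (\<gamma> t))) d = frechet_derivative (snd d \<circ> h \<circ> chart_inv c) (at (snd c (\<gamma> t))) (snd (X (\<gamma> t)) c)"
      using d by (simp add: rel[OF p] tangent_map_def Let_def M.X_tangent(2)[OF p] c_def[symmetric])
    with curve_vderiv[where h = h and \<gamma> = \<gamma>, OF M.charted N.charted h[OF p] c d solvesD(1)[OF g] t solvesD(2)[OF g]
        solvesD(3)[OF g t c]]
    show "\<exists>d\<in>atlas N. h (\<gamma> t) \<in> fst d \<and> ((snd d \<circ> (\<lambda>t. h (\<gamma> t))) has_vector_derivative snd (Y (h (\<gamma> t))) d) (at t)"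
      using d by (intro bexI[of _ d]) (simp_all add: o_def)
  qed
qed

section \<open>Bundle operations in local trivializations\<close>

locale linear_vfield =
  fixes E :: "('b, 'e::fin_dim_inner, 'a, 'm::fin_dim_inner, 'f::fin_dim_inner) vbundle"
    and X :: "'a \<Rightarrow> ('a, 'm) tangent" and Y :: "'b \<Rightarrow> ('b, 'e) tangent"
  assumes E: "smooth_vector_bundle E" and XY: "linear_vector_field E X Y"
begin

sublocale B: vfield "base E" X
  using E XY by unfold_locales (auto simp: smooth_vector_bundle_def linear_vector_field_def)

sublocale T: vfield "tot E" Y
  using E XY by unfold_locales (auto simp: smooth_vector_bundle_def linear_vector_field_def)

lemma proj_near: "e \<in> points (tot E) \<Longrightarrow> smooth_near (tot E) (base E) (proj E) e"
  using E smooth_map_iff_smooth_near[OF T.charted B.charted] unfolding smooth_vector_bundle_def by blast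

lemma proj_in_points: "e \<in> points (tot E) \<Longrightarrow> proj E e \<in> points (base E)"
  using smooth_near_in_points(2)[OF T.charted B.charted proj_near] .

lemma vscale_closed: "e \<in> points (tot E) \<Longrightarrow> vscale E \<alpha> e \<in> points (tot E) \<and> proj E (vscale E \<alpha> e) = proj E e"
  using E unfolding smooth_vector_bundle_def by blast

lemma vadd_closed: "e \<in> points (tot E) \<Longrightarrow> e' \<in> points (tot E) \<Longrightarrow> proj E e = proj E e' \<Longrightarrow>
    vadd E e e' \<in> points (tot E) \<and> proj E (vadd E e e') = proj E e"
  using E unfolding smooth_vector_bundle_def by blast

lemma openin_over: assumes "openin (mtop (base E)) U" shows "openin (mtop (tot E)) (over E U)"
proof -
  have "continuous_map (mtop (tot E)) (mtop (base E)) (proj E)"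
    using E by (simp add: smooth_vector_bundle_def smooth_map_def)
  from openin_continuous_map_preimage[OF this assms] show ?thesis by (simp add: over_def)
qed

abbreviation triv_target :: "'a set \<Rightarrow> ('a \<times> 'f, 'm \<times> 'f) manifold" where
  "triv_target U \<equiv> prod_manifold (open_submanifold (base E) U) model_manifold"

lemma charted_triv_target: "openin (mtop (base E)) U \<Longrightarrow> charted (triv_target U)"
  by (intro charted_prod_manifold charted_open_submanifold B.charted charted_model_manifold)

text \<open>Unpacks a bundle chart together with its inverse \<open>g\<close>. As \<open>g\<close>
  recovers a point from its base point and its \<open>\<psi>\<close>-value, identities in a fibre
  can be checked by comparing these two.\<close>

lemma local_triv:
  assumes x: "x \<in> points (base E)"
  obtains U \<psi> g where "openin (mtop (base E)) U" "x \<in> U"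
    "\<And>e. e \<in> over E U \<Longrightarrow> smooth_near (tot E) (triv_target U) (\<lambda>e. (proj E e, \<psi> e)) e"
    "\<And>z. fst z \<in> U \<Longrightarrow> smooth_near (triv_target U) (tot E) g z"
    "\<And>e. e \<in> over E U \<Longrightarrow> g (proj E e, \<psi> e) = e"
    "\<And>y v. y \<in> U \<Longrightarrow> g (y, v) \<in> over E U \<and> proj E (g (y, v)) = y \<and> \<psi> (g (y, v)) = v"
    "\<And>e e'. e \<in> over E U \<Longrightarrow> e' \<in> over E U \<Longrightarrow> proj E e = proj E e' \<Longrightarrow> \<psi> (vadd E e e') = \<psi> e + \<psi> e'"
    "\<And>e \<alpha>. e \<in> over E U \<Longrightarrow> \<psi> (vscale E \<alpha> e) = \<alpha> *\<^sub>R \<psi> e"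
proof -
  have "\<exists>(U, \<psi>)\<in>trivs E. x \<in> U" using E x unfolding smooth_vector_bundle_def by blast
  then obtain U \<psi> where U: "(U, \<psi>) \<in> trivs E" "x \<in> U" by auto
  have "openin (mtop (base E)) U \<and>
        diffeomorphism (open_submanifold (tot E) (over E U)) (triv_target U) (\<lambda>e. (proj E e, \<psi> e)) \<and>
        (\<forall>e\<in>over E U. \<forall>e'\<in>over E U. proj E e = proj E e' \<longrightarrow> \<psi> (vadd E e e') = \<psi> e + \<psi> e') \<and>
        (\<forall>e\<in>over E U. \<forall>\<alpha>. \<psi> (vscale E \<alpha> e) = \<alpha> *\<^sub>R \<psi> e)"
    using E U(1) unfolding smooth_vector_bundle_def by blast
  then have oU: "openin (mtop (base E)) U"
    and diff: "diffeomorphism (open_submanifold (tot E) (over E U)) (triv_target U) (\<lambda>e. (proj E e, \<psi> e))"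
    and add: "\<And>e e'. e \<in> over E U \<Longrightarrow> e' \<in> over E U \<Longrightarrow> proj E e = proj E e' \<Longrightarrow> \<psi> (vadd E e e') = \<psi> e + \<psi> e'"
    and scale: "\<And>e \<alpha>. e \<in> over E U \<Longrightarrow> \<psi> (vscale E \<alpha> e) = \<alpha> *\<^sub>R \<psi> e"
    by blast+
  note oE = openin_over[OF oU]
  have pts: "points (open_submanifold (tot E) (over E U)) = over E U" "points (triv_target U) = U \<times> UNIV"
    using points_open_submanifold[OF oE] points_open_submanifold[OF oU]
    by (simp_all add: points_prod_manifold) (simp add: model_manifold_def)
  note chT = charted_open_submanifold[OF T.charted oE] and chP = charted_triv_target[OF oU]
  obtain g where g: "smooth_map (open_submanifold (tot E) (over E U)) (triv_target U) (\<lambda>e. (proj E e, \<psi> e))"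
    "smooth_map (triv_target U) (open_submanifold (tot E) (over E U)) g"
    "\<And>e. e \<in> over E U \<Longrightarrow> g (proj E e, \<psi> e) = e"
    "\<And>z. z \<in> U \<times> UNIV \<Longrightarrow> (proj E (g z), \<psi> (g z)) = z"
    using diff unfolding diffeomorphism_def pts by blast
  show thesis
  proof (rule that[OF oU U(2) _ _ g(3) _ add scale])
    fix e assume "e \<in> over E U"
    then show "smooth_near (tot E) (triv_target U) (\<lambda>e. (proj E e, \<psi> e)) e"
      using g(1) unfolding smooth_map_iff_smooth_near[OF chT chP] pts
        smooth_near_open_submanifold_source[OF T.charted oE chP] by blast
  next
    have *: "\<forall>z\<in>U \<times> UNIV. g z \<in> over E U \<and> smooth_near (triv_target U) (tot E) g z"
      using g(2) unfolding smooth_map_iff_smooth_near[OF chP chT] pts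
        smooth_near_open_submanifold_target[OF chP T.charted oE] .
    show "smooth_near (triv_target U) (tot E) g z" if "fst z \<in> U" for z
      using bspec[OF *, of z] that by (simp add: mem_Times_iff)
    show "g (y, v) \<in> over E U \<and> proj E (g (y, v)) = y \<and> \<psi> (g (y, v)) = v" if "y \<in> U" for y v
      using that * g(4)[of "(y, v)"] by simp
  qed
qed

text \<open>Fibre axioms are recovered from a trivialization: both sides lie over the same base
  point, and \<open>\<psi>\<close> turns \<open>vscale\<close> into scaling in the model fibre. The
  next two laws follow in the same way.\<close>

lemma vscale_vscale: assumes "e \<in> points (tot E)" shows "vscale E \<alpha> (vscale E \<beta> e) = vscale E (\<alpha> * \<beta>) e"
proof -
  obtain U and \<psi> :: "'b \<Rightarrow> 'f" and g :: "'a \<times> 'f \<Rightarrow> 'b" where U: "proj E e \<in> U" "\<And>e. e \<in> over E U \<Longrightarrow> g (proj E e, \<psi> e) = e"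
    "\<And>e \<alpha>. e \<in> over E U \<Longrightarrow> \<psi> (vscale E \<alpha> e) = \<alpha> *\<^sub>R \<psi> e"
    by (rule local_triv[OF proj_in_points[OF assms]]) blast
  have m: "vscale E \<alpha> e \<in> over E U \<and> proj E (vscale E \<alpha> e) = proj E e"
    "vscale E \<alpha> (vscale E \<beta> e) \<in> over E U \<and> proj E (vscale E \<alpha> (vscale E \<beta> e)) = proj E e" "e \<in> over E U" for \<alpha> \<beta>
    using assms U(1) vscale_closed by (auto simp: over_def)
  show ?thesis using U(2)[of "vscale E \<alpha> (vscale E \<beta> e)"] U(2)[of "vscale E (\<alpha> * \<beta>) e"] U(3) m by simp
qed

lemma vscale_1: assumes "e \<in> points (tot E)" shows "vscale E 1 e = e"
proof -
  obtain U and \<psi> :: "'b \<Rightarrow> 'f" and g :: "'a \<times> 'f \<Rightarrow> 'b" where U: "proj E e \<in> U" "\<And>e. e \<in> over E U \<Longrightarrow> g (proj E e, \<psi> e) = e"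
    "\<And>e \<alpha>. e \<in> over E U \<Longrightarrow> \<psi> (vscale E \<alpha> e) = \<alpha> *\<^sub>R \<psi> e"
    by (rule local_triv[OF proj_in_points[OF assms]]) blast
  have "vscale E 1 e \<in> over E U" "proj E (vscale E 1 e) = proj E e" "e \<in> over E U"
    using assms U(1) vscale_closed by (auto simp: over_def)
  then show ?thesis using U(2)[of "vscale E 1 e"] U(2)[of e] U(3)[of e 1] by simp
qed

lemma vscale_0_eq:
  assumes "e \<in> points (tot E)" "e' \<in> points (tot E)" "proj E e = proj E e'"
  shows "vscale E 0 e = vscale E 0 e'"
proof -
  obtain U and \<psi> :: "'b \<Rightarrow> 'f" and g :: "'a \<times> 'f \<Rightarrow> 'b" where U: "proj E e \<in> U" "\<And>e. e \<in> over E U \<Longrightarrow> g (proj E e, \<psi> e) = e"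
    "\<And>e \<alpha>. e \<in> over E U \<Longrightarrow> \<psi> (vscale E \<alpha> e) = \<alpha> *\<^sub>R \<psi> e"
    by (rule local_triv[OF proj_in_points[OF assms(1)]]) blast
  have "vscale E 0 e \<in> over E U" "proj E (vscale E 0 e) = proj E e" "e \<in> over E U"
    "vscale E 0 e' \<in> over E U" "proj E (vscale E 0 e') = proj E e" "e' \<in> over E U"
    using assms U(1) vscale_closed by (auto simp: over_def)
  then show ?thesis using U(2)[of "vscale E 0 e"] U(2)[of "vscale E 0 e'"] U(3)[of e 0] U(3)[of e' 0] by simp
qed

text \<open>In a trivialization the scalar multiplication acts on the model factor alone and by a
  bounded linear map; it is conjugated back with \<open>g\<close>.\<close>

lemma vscale_near: assumes e: "e \<in> points (tot E)" shows "smooth_near (tot E) (tot E) (vscale E \<alpha>) e"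
proof -
  obtain U and \<psi> :: "'b \<Rightarrow> 'f" and g :: "'a \<times> 'f \<Rightarrow> 'b" where U: "openin (mtop (base E)) U" "proj E e \<in> U"
    "\<And>e. e \<in> over E U \<Longrightarrow> smooth_near (tot E) (triv_target U) (\<lambda>e. (proj E e, \<psi> e)) e"
    "\<And>z. fst z \<in> U \<Longrightarrow> smooth_near (triv_target U) (tot E) g z"
    "\<And>e. e \<in> over E U \<Longrightarrow> g (proj E e, \<psi> e) = e"
    "\<And>e \<alpha>. e \<in> over E U \<Longrightarrow> \<psi> (vscale E \<alpha> e) = \<alpha> *\<^sub>R \<psi> e"
    by (rule local_triv[OF proj_in_points[OF e]]) blast
  note P = charted_triv_target[OF U(1)]
  have eU: "e \<in> over E U" using e U(2) by (simp add: over_def)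
  have "proj E e \<in> points (open_submanifold (base E) U)" using points_open_submanifold[OF U(1)] U(2) by simp
  then have "smooth_near (triv_target U) (triv_target U) (\<lambda>z. (fst z, \<alpha> *\<^sub>R snd z)) (proj E e, \<psi> e)"
    by (intro smooth_near_prod_scale charted_open_submanifold[OF B.charted U(1)]) simp
  from smooth_near_compose[OF T.charted P P U(3)[OF eU] this]
  have "smooth_near (tot E) (triv_target U) (\<lambda>e. (proj E e, \<alpha> *\<^sub>R \<psi> e)) e" by simp
  from smooth_near_compose[OF T.charted P T.charted this U(4)]
  have "smooth_near (tot E) (tot E) (\<lambda>e. g (proj E e, \<alpha> *\<^sub>R \<psi> e)) e" using U(2) by simp
  then show ?thesis
  proof (rule smooth_near_cong[OF T.charted T.charted _ openin_over[OF U(1)] eU])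
    fix e assume e: "e \<in> over E U"
    then have "vscale E \<alpha> e \<in> over E U" "proj E (vscale E \<alpha> e) = proj E e"
      using vscale_closed by (auto simp: over_def)
    then show "g (proj E e, \<alpha> *\<^sub>R \<psi> e) = vscale E \<alpha> e" using U(5)[of "vscale E \<alpha> e"] U(6)[OF e] by simp
  qed
qed

section \<open>Transport of integral curves by the bundle operations\<close>

lemma bundle_morphism: "bundle_morphism E (tangent_prolongation E) Y X"
  using XY by (simp add: linear_vector_field_def)

text \<open>That \<open>Y\<close> covers \<open>X\<close> as a morphism into the prolonged bundle,
  whose projection is the tangent map of \<open>proj E\<close>, means precisely that the two fields
  are related by \<open>proj E\<close>.\<close>

lemma solves_proj: "solves (tot E) Y J \<eta> \<Longrightarrow> solves (base E) X J (\<lambda>t. proj E (\<eta> t))"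
proof (rule solves_related[OF T.vfield_axioms B.vfield_axioms proj_near])
  show "X (proj E e) = tangent_map (tot E) (base E) (proj E) (Y e)" if "e \<in> points (tot E)" for e
    using bundle_morphism that by (simp add: bundle_morphism_def tangent_prolongation_def)
qed

text \<open>The scaling of the prolonged bundle is the tangent map of
  \<open>vscale E \<alpha>\<close>, so homogeneity of \<open>Y\<close> says that \<open>Y\<close> is
  related to itself by this map.\<close>

lemma solves_vscale: "solves (tot E) Y J \<eta> \<Longrightarrow> solves (tot E) Y J (\<lambda>t. vscale E \<alpha> (\<eta> t))"
proof (rule solves_related[OF T.vfield_axioms T.vfield_axioms vscale_near])
  show "Y (vscale E \<alpha> e) = tangent_map (tot E) (tot E) (vscale E \<alpha>) (Y e)" if "e \<in> points (tot E)" for e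
    using bundle_morphism that by (simp add: bundle_morphism_def tangent_prolongation_def tangent_scale_def)
qed

lemma integral_curve_proj:
  "integral_curve (tot E) Y e J \<eta> \<Longrightarrow> integral_curve (base E) X (proj E e) J (\<lambda>t. proj E (\<eta> t))"
  by (auto simp: integral_curve_iff_solves solves_proj)

lemma integral_curve_vscale:
  "integral_curve (tot E) Y e J \<eta> \<Longrightarrow> integral_curve (tot E) Y (vscale E \<alpha> e) J (\<lambda>t. vscale E \<alpha> (\<eta> t))"
  by (auto simp: integral_curve_iff_solves solves_vscale)

text \<open>By \<open>vscale_0_eq\<close> the choice of the point in the fibre does not
  matter.\<close>

definition zero_section :: "'a \<Rightarrow> 'b" where
  "zero_section x = vscale E 0 (SOME e. e \<in> points (tot E) \<and> proj E e = x)"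

lemma zero_section:
  assumes "x \<in> points (base E)"
  shows "zero_section x \<in> points (tot E)" "proj E (zero_section x) = x"
    "\<And>e. e \<in> points (tot E) \<Longrightarrow> proj E e = x \<Longrightarrow> vscale E 0 e = zero_section x"
proof -
  obtain U and \<psi> :: "'b \<Rightarrow> 'f" and g :: "'a \<times> 'f \<Rightarrow> 'b" where "x \<in> U" "\<And>y v. y \<in> U \<Longrightarrow> g (y, v) \<in> over E U \<and> proj E (g (y, v)) = y"
    by (rule local_triv[OF assms]) blast
  then have "g (x, 0) \<in> points (tot E) \<and> proj E (g (x, 0)) = x" by (auto simp: over_def)
  then have s: "(SOME e. e \<in> points (tot E) \<and> proj E e = x) \<in> points (tot E) \<and>
    proj E (SOME e. e \<in> points (tot E) \<and> proj E e = x) = x"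
    by (rule someI[where P = "\<lambda>e. e \<in> points (tot E) \<and> proj E e = x"])
  then show "zero_section x \<in> points (tot E)" "proj E (zero_section x) = x"
    using vscale_closed by (simp_all add: zero_section_def)
  show "vscale E 0 e = zero_section x" if "e \<in> points (tot E)" "proj E e = x" for e
    unfolding zero_section_def by (rule vscale_0_eq) (use s that in auto)
qed

text \<open>Multiplying any integral curve through a zero vector by \<open>0\<close> gives the zero section
  along its projection.\<close>

lemma solves_zero_section:
  assumes g: "solves (base E) X J \<gamma>" shows "solves (tot E) Y J (\<lambda>t. zero_section (\<gamma> t))"
proof (rule solves_locally[OF solvesD(1)[OF g]])
  fix t assume t: "t \<in> J"
  note p = solvesD(4)[OF g t]
  obtain K \<eta> where K: "integral_curve (tot E) Y (zero_section (\<gamma> t)) K \<eta>"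
    using T.flow_domainE[OF T.flow_0(1)[OF zero_section(1)[OF p]]] by metis
  let ?I = "K \<inter> {s. s + t \<in> J}"
  have sK: "solves (tot E) Y K \<eta>" "0 \<in> K" "\<eta> 0 = zero_section (\<gamma> t)"
    using K by (auto simp: integral_curve_iff_solves)
  have o: "open ?I" using solvesD(1)[OF sK(1)] solvesD(1)[OF solves_shift[OF g, of t]] by blast
  have 1: "solves (base E) X ?I (\<lambda>s. proj E (\<eta> s))" by (rule solves_subset[OF solves_proj[OF sK(1)] o]) auto
  have 2: "solves (base E) X ?I (\<lambda>s. \<gamma> (s + t))" by (rule solves_subset[OF solves_shift[OF g] o]) auto
  have 0: "0 \<in> ?I" "proj E (\<eta> 0) = \<gamma> (0 + t)" using sK t zero_section(2)[OF p] by auto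
  obtain d where d: "d > 0" "\<And>s. \<bar>s - 0\<bar> < d \<Longrightarrow> s \<in> ?I \<and> proj E (\<eta> s) = \<gamma> (s + t)"
    by (rule B.solves_unique_near[OF 1 2 0]) blast
  let ?\<eta> = "\<lambda>s. vscale E 0 (\<eta> (s + (- t)))"
  have "solves (tot E) Y {s. s + (- t) \<in> K} ?\<eta>"
    using solves_shift[OF solves_vscale[OF sK(1), of 0], of "- t"] by simp
  then have 3: "solves (tot E) Y (ball t d) ?\<eta>"
    by (rule solves_subset) (use d(2) in \<open>auto simp: dist_real_def abs_minus_commute\<close>)
  have 4: "s \<in> J \<and> zero_section (\<gamma> s) = ?\<eta> s" if "s \<in> ball t d" for s
  proof -
    have "\<bar>(s + (- t)) - 0\<bar> < d" using that by (simp add: dist_real_def abs_minus_commute)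
    note s = d(2)[OF this]
    then have "\<eta> (s + (- t)) \<in> points (tot E)" "proj E (\<eta> (s + (- t))) = \<gamma> s" "s \<in> J"
      using solvesD(4)[OF sK(1)] by auto
    then show ?thesis using zero_section(3)[OF solvesD(4)[OF g]] by simp
  qed
  show "\<exists>J' \<gamma>'. t \<in> J' \<and> solves (tot E) Y J' \<gamma>' \<and> (\<forall>s\<in>J'. s \<in> J \<and> zero_section (\<gamma> s) = \<gamma>' s)"
    using 3 4 d(1) by (intro exI[of _ "ball t d"] exI[of _ ?\<eta>]) auto
qed

section \<open>The flow of the linear vector field\<close>

lemma flow_vscale:
  assumes "(t, e) \<in> flow_domain (tot E) Y"
  shows "(t, vscale E \<alpha> e) \<in> flow_domain (tot E) Y"
    "flow (tot E) Y t (vscale E \<alpha> e) = vscale E \<alpha> (flow (tot E) Y t e)"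
proof -
  obtain J \<eta> where J: "integral_curve (tot E) Y e J \<eta>" "t \<in> J" "flow (tot E) Y t e = \<eta> t"
    using T.flow_domainE[OF assms] by metis
  show "(t, vscale E \<alpha> e) \<in> flow_domain (tot E) Y"
    using integral_curve_vscale[OF J(1)] J(2) unfolding T.flow_domain_iff by blast
  show "flow (tot E) Y t (vscale E \<alpha> e) = vscale E \<alpha> (flow (tot E) Y t e)"
    using T.flow_eq[OF integral_curve_vscale[OF J(1)] J(2)] J(3) by simp
qed

lemma flow_proj:
  assumes "(t, e) \<in> flow_domain (tot E) Y"
  shows "(t, proj E e) \<in> flow_domain (base E) X" "proj E (flow (tot E) Y t e) = flow (base E) X t (proj E e)"
proof -
  obtain J \<eta> where J: "integral_curve (tot E) Y e J \<eta>" "t \<in> J" "flow (tot E) Y t e = \<eta> t"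
    using T.flow_domainE[OF assms] by metis
  show "(t, proj E e) \<in> flow_domain (base E) X"
    using integral_curve_proj[OF J(1)] J(2) unfolding B.flow_domain_iff by blast
  show "proj E (flow (tot E) Y t e) = flow (base E) X t (proj E e)"
    using B.flow_eq[OF integral_curve_proj[OF J(1)] J(2)] J(3) by simp
qed

text \<open>The time-\<open>t\<close> flow is defined at the zero vector of the fibre, hence near it, hence by
  homogeneity on the whole fibre.\<close>

lemma flow_domain_lift:
  assumes D: "(t, proj E e) \<in> flow_domain (base E) X" and e: "e \<in> points (tot E)"
  shows "(t, e) \<in> flow_domain (tot E) Y"
proof -
  let ?x = "proj E e" and ?V = "{e. (t, e) \<in> flow_domain (tot E) Y}"
  have x: "?x \<in> points (base E)" by (rule proj_in_points[OF e])
  obtain J \<gamma> where J: "integral_curve (base E) X ?x J \<gamma>" "t \<in> J" using B.flow_domainE[OF D] by metis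
  have "integral_curve (tot E) Y (zero_section ?x) J (\<lambda>t. zero_section (\<gamma> t))"
    using J(1) solves_zero_section by (auto simp: integral_curve_iff_solves)
  then have z: "zero_section ?x \<in> ?V" using J(2) unfolding T.flow_domain_iff by blast
  obtain U and \<psi> :: "'b \<Rightarrow> 'f" and g :: "'a \<times> 'f \<Rightarrow> 'b" where U: "openin (mtop (base E)) U" "?x \<in> U"
    "\<And>z. fst z \<in> U \<Longrightarrow> smooth_near (triv_target U) (tot E) g z"
    "\<And>e. e \<in> over E U \<Longrightarrow> g (proj E e, \<psi> e) = e"
    "\<And>e \<alpha>. e \<in> over E U \<Longrightarrow> \<psi> (vscale E \<alpha> e) = \<alpha> *\<^sub>R \<psi> e"
    by (rule local_triv[OF x]) blast
  note P = charted_triv_target[OF U(1)]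
  have gs: "g (?x, \<alpha> *\<^sub>R \<psi> e) = vscale E \<alpha> e" for \<alpha>
    using U(4)[of "vscale E \<alpha> e"] U(5)[of e \<alpha>] vscale_closed[OF e, of \<alpha>] U(2) e by (simp add: over_def)
  have xU: "?x \<in> points (open_submanifold (base E) U)" using points_open_submanifold[OF U(1)] U(2) by simp
  have s: "smooth_near model_manifold (tot E) (\<lambda>v. g (?x, v)) 0"
    by (rule smooth_near_compose[OF charted_model_manifold P T.charted
          smooth_near_prod_slice[OF charted_open_submanifold[OF B.charted U(1)] xU] U(3)]) (simp add: U(2))
  have "g (?x, 0) \<in> ?V" using gs[of 0] z zero_section(3)[OF x e refl] by simp
  then obtain W :: "'f set" where "openin (mtop model_manifold) W" and W: "0 \<in> W" "(\<lambda>v. g (?x, v)) ` W \<subseteq> ?V"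
    by (rule smooth_near_continuous[OF charted_model_manifold T.charted s T.openin_flow_domain_slice])
  then have oW: "open W" by (simp add: model_manifold_def)
  \<comment> \<open>The one-sided limit yields a nonzero factor, so that the scaling can be undone
    by \<open>1 / \<alpha>\<close> at the end.\<close>
  have "((\<lambda>\<alpha>. \<alpha> *\<^sub>R \<psi> e) \<longlongrightarrow> 0 *\<^sub>R \<psi> e) (at_right 0)" by (intro tendsto_intros)
  then have "\<forall>\<^sub>F \<alpha> in at_right 0. \<alpha> *\<^sub>R \<psi> e \<in> W" using oW W(1) by (intro topological_tendstoD) auto
  then have "\<forall>\<^sub>F \<alpha> in at_right 0. \<alpha> *\<^sub>R \<psi> e \<in> W \<and> (0::real) < \<alpha>"
    using eventually_at_right_less[of "0::real"] eventually_conj by blast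
  then obtain \<alpha> :: real where \<alpha>: "\<alpha> *\<^sub>R \<psi> e \<in> W" "0 < \<alpha>"
    using eventually_happens'[OF trivial_limit_at_right_real] by blast
  then have "(t, vscale E \<alpha> e) \<in> flow_domain (tot E) Y" using W(2) gs[of \<alpha>] by auto
  from flow_vscale(1)[OF this, of "1 / \<alpha>"] show ?thesis
    using \<alpha>(2) by (simp add: vscale_vscale[OF e] vscale_1[OF e])
qed

lemma flow_domain_tot:
  "(t, e) \<in> flow_domain (tot E) Y \<longleftrightarrow> e \<in> points (tot E) \<and> (t, proj E e) \<in> flow_domain (base E) X"
  using flow_domain_lift flow_proj(1) T.flow_in_points(1) by blast

text \<open>In local trivializations the flow on a fibre is homogeneous and differentiable at the
  origin, hence equal to its derivative there.\<close>

lemma flow_vadd: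
  assumes e: "(t, e) \<in> flow_domain (tot E) Y" and e': "(t, e') \<in> flow_domain (tot E) Y" and eq: "proj E e = proj E e'"
  shows "flow (tot E) Y t (vadd E e e') = vadd E (flow (tot E) Y t e) (flow (tot E) Y t e')"
proof -
  let ?x = "proj E e" and ?\<Phi> = "flow (tot E) Y t" and ?\<phi> = "flow (base E) X t"
  note eP = T.flow_in_points[OF e] and eP' = T.flow_in_points[OF e']
  have x: "?x \<in> points (base E)" "?\<phi> ?x \<in> points (base E)" using B.flow_in_points[OF flow_proj(1)[OF e]] .
  obtain U and \<psi> :: "'b \<Rightarrow> 'f" and g :: "'a \<times> 'f \<Rightarrow> 'b" where U: "openin (mtop (base E)) U" "?x \<in> U"
    "\<And>z. fst z \<in> U \<Longrightarrow> smooth_near (triv_target U) (tot E) g z"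
    "\<And>e. e \<in> over E U \<Longrightarrow> g (proj E e, \<psi> e) = e"
    "\<And>y v. y \<in> U \<Longrightarrow> g (y, v) \<in> over E U \<and> proj E (g (y, v)) = y \<and> \<psi> (g (y, v)) = v"
    "\<And>e e'. e \<in> over E U \<Longrightarrow> e' \<in> over E U \<Longrightarrow> proj E e = proj E e' \<Longrightarrow> \<psi> (vadd E e e') = \<psi> e + \<psi> e'"
    "\<And>e \<alpha>. e \<in> over E U \<Longrightarrow> \<psi> (vscale E \<alpha> e) = \<alpha> *\<^sub>R \<psi> e"
    by (rule local_triv[OF x(1)]) blast
  obtain U' and \<psi>' :: "'b \<Rightarrow> 'f" and g' :: "'a \<times> 'f \<Rightarrow> 'b" where U': "openin (mtop (base E)) U'" "?\<phi> ?x \<in> U'"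
    "\<And>e. e \<in> over E U' \<Longrightarrow> smooth_near (tot E) (triv_target U') (\<lambda>e. (proj E e, \<psi>' e)) e"
    "\<And>e. e \<in> over E U' \<Longrightarrow> g' (proj E e, \<psi>' e) = e"
    "\<And>e e'. e \<in> over E U' \<Longrightarrow> e' \<in> over E U' \<Longrightarrow> proj E e = proj E e' \<Longrightarrow> \<psi>' (vadd E e e') = \<psi>' e + \<psi>' e'"
    "\<And>e \<alpha>. e \<in> over E U' \<Longrightarrow> \<psi>' (vscale E \<alpha> e) = \<alpha> *\<^sub>R \<psi>' e"
    by (rule local_triv[OF x(2)]) blast
  note P = charted_triv_target[OF U(1)] and P' = charted_triv_target[OF U'(1)]
  \<comment> \<open>The flow from the fibre over \<open>?x\<close> to the fibre over
    \<open>?\<phi> ?x\<close>, read in the trivializations \<open>\<psi>\<close> and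
    \<open>\<psi>'\<close>. It makes sense on the whole model fibre because the
    time-\<open>t\<close> domain contains the whole fibre over \<open>?x\<close>.\<close>
  define F where "F v = \<psi>' (?\<Phi> (g (?x, v)))" for v
  have g: "g (?x, v) \<in> over E U" "proj E (g (?x, v)) = ?x" "\<psi> (g (?x, v)) = v" "g (?x, v) \<in> points (tot E)" for v
    using U(5)[OF U(2), of v] by (auto simp: over_def)
  have dom: "(t, g (?x, v)) \<in> flow_domain (tot E) Y" for v
    using flow_domain_tot g(2,4) flow_proj(1)[OF e] by simp
  have fl: "?\<Phi> b \<in> over E U'" "proj E (?\<Phi> b) = ?\<phi> ?x" if "(t, b) \<in> flow_domain (tot E) Y" "proj E b = ?x" for b
    using T.flow_in_points(2)[OF that(1)] flow_proj(2)[OF that(1)] that(2) U'(2) by (auto simp: over_def)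
  have hom: "F (\<alpha> *\<^sub>R v) = \<alpha> *\<^sub>R F v" for \<alpha> v
  proof -
    have "vscale E \<alpha> (g (?x, v)) \<in> over E U" "proj E (vscale E \<alpha> (g (?x, v))) = ?x"
      using vscale_closed[OF g(4), of \<alpha> v] g(2) U(2) by (auto simp: over_def)
    then have "g (?x, \<alpha> *\<^sub>R v) = vscale E \<alpha> (g (?x, v))"
      using U(4)[of "vscale E \<alpha> (g (?x, v))"] U(7)[OF g(1)] g(3) by simp
    then show ?thesis
      using flow_vscale(2)[OF dom] U'(6)[OF fl(1)[OF dom g(2)]] by (simp add: F_def)
  qed
  have xU: "?x \<in> points (open_submanifold (base E) U)" using points_open_submanifold[OF U(1)] U(2) by simp
  have x'U: "?\<phi> ?x \<in> points (open_submanifold (base E) U')" using points_open_submanifold[OF U'(1)] U'(2) by simp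
  have "smooth_near model_manifold (tot E) (\<lambda>v. g (?x, v)) 0"
    by (rule smooth_near_compose[OF charted_model_manifold P T.charted
          smooth_near_prod_slice[OF charted_open_submanifold[OF B.charted U(1)] xU] U(3)]) (simp add: U(2))
  from smooth_near_compose[OF charted_model_manifold T.charted T.charted this T.smooth_near_flow[OF dom]]
  have "smooth_near model_manifold (tot E) (\<lambda>v. ?\<Phi> (g (?x, v))) 0" .
  from smooth_near_compose[OF charted_model_manifold T.charted P' this U'(3)[OF fl(1)[OF dom g(2)]]]
  have 1: "smooth_near model_manifold (triv_target U') (\<lambda>v. (proj E (?\<Phi> (g (?x, v))), \<psi>' (?\<Phi> (g (?x, v))))) 0" .
  have "smooth_near (triv_target U') model_manifold snd (proj E (?\<Phi> (g (?x, 0))), \<psi>' (?\<Phi> (g (?x, 0))))"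
    by (rule smooth_near_prod_snd[OF charted_open_submanifold[OF B.charted U'(1)]]) (simp add: fl(2)[OF dom g(2)] x'U)
  from smooth_near_compose[OF charted_model_manifold P' charted_model_manifold 1 this]
  have "smooth_near model_manifold model_manifold F 0" by (simp add: F_def[abs_def])
  from homogeneous_differentiable_additive[OF hom smooth_near_model_differentiable[OF this]]
  have F_add: "F (v + w) = F v + F w" for v w .
  have eU: "e \<in> over E U" "e' \<in> over E U" using eP(1) eP'(1) eq U(2) by (auto simp: over_def)
  have ad: "vadd E e e' \<in> points (tot E)" "proj E (vadd E e e') = ?x" using vadd_closed[OF eP(1) eP'(1) eq] by auto
  have adU: "vadd E e e' \<in> over E U" using ad U(2) by (simp add: over_def)
  have adD: "(t, vadd E e e') \<in> flow_domain (tot E) Y" using flow_domain_tot ad flow_proj(1)[OF e] by simp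
  have F: "\<psi>' (?\<Phi> b) = F (\<psi> b)" if "b \<in> over E U" "proj E b = ?x" for b
    using U(4)[OF that(1)] that(2) by (simp add: F_def)
  have fle: "?\<Phi> e \<in> over E U'" "proj E (?\<Phi> e) = ?\<phi> ?x" using fl[OF e refl] .
  have fle': "?\<Phi> e' \<in> over E U'" "proj E (?\<Phi> e') = ?\<phi> ?x" using fl[OF e' eq[symmetric]] .
  have fls: "?\<Phi> (vadd E e e') \<in> over E U'" "proj E (?\<Phi> (vadd E e e')) = ?\<phi> ?x" using fl[OF adD ad(2)] .
  have sum: "vadd E (?\<Phi> e) (?\<Phi> e') \<in> over E U'" "proj E (vadd E (?\<Phi> e) (?\<Phi> e')) = ?\<phi> ?x"
    using vadd_closed[OF eP(2) eP'(2)] fle(2) fle'(2) U'(2) by (auto simp: over_def)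
  \<comment> \<open>Both points lie over \<open>?\<phi> ?x\<close>, so equality of their
    \<open>\<psi>'\<close>-values suffices; \<open>g'\<close> then recovers the points.\<close>
  have "\<psi>' (?\<Phi> (vadd E e e')) = \<psi>' (vadd E (?\<Phi> e) (?\<Phi> e'))"
    using F[OF adU ad(2)] F[OF eU(1) refl] F[OF eU(2) eq[symmetric]] U(6)[OF eU eq] F_add
      U'(5)[OF fle(1) fle'(1)] fle(2) fle'(2) by simp
  then show ?thesis using U'(4)[OF fls(1)] U'(4)[OF sum(1)] fls(2) sum(2) by simp
qed

lemma bundle_morphism_flow:
  "bundle_morphism (restrict_bundle E {x. (t, x) \<in> flow_domain (base E) X})
    (restrict_bundle E {x. (- t, x) \<in> flow_domain (base E) X}) (flow (tot E) Y t) (flow (base E) X t)"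
proof -
  \<comment> \<open>The part of the bundle over a time slice of the base flow domain is the
    corresponding slice for \<open>Y\<close>. Smoothness of the restricted map is thus the general
    fact about flows, applied to the total space.\<close>
  have over: "over E {x. (s, x) \<in> flow_domain (base E) X} = {e. (s, e) \<in> flow_domain (tot E) Y}" for s
    by (auto simp: over_def flow_domain_tot)
  have pts: "points (open_submanifold (tot E) {e. (s, e) \<in> flow_domain (tot E) Y}) = {e. (s, e) \<in> flow_domain (tot E) Y}" for s
    by (rule points_open_submanifold[OF T.openin_flow_domain_slice])
  show ?thesis
    unfolding bundle_morphism_def restrict_bundle_def over
    using T.smooth_map_flow[of t] B.smooth_map_flow[of t]
    by (simp add: pts flow_proj(2) flow_vadd flow_vscale(2))
qed

text \<open>The inverse morphism is the flow for time \<open>- t\<close>; it is again an instance of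
  \<open>bundle_morphism_flow\<close>, with the two restrictions exchanged.\<close>

lemma bundle_isomorphism_flow:
  "bundle_isomorphism (restrict_bundle E {x. (t, x) \<in> flow_domain (base E) X})
    (restrict_bundle E {x. (- t, x) \<in> flow_domain (base E) X}) (flow (tot E) Y t) (flow (base E) X t)"
  unfolding bundle_isomorphism_def
proof (intro conjI exI ballI)
  have over: "over E {x. (s, x) \<in> flow_domain (base E) X} = {e. (s, e) \<in> flow_domain (tot E) Y}" for s
    by (auto simp: over_def flow_domain_tot)
  have pts: "points (tot (restrict_bundle E {x. (s, x) \<in> flow_domain (base E) X})) = {e. (s, e) \<in> flow_domain (tot E) Y}"
    "points (base (restrict_bundle E {x. (s, x) \<in> flow_domain (base E) X})) = {x. (s, x) \<in> flow_domain (base E) X}" for s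
    using points_open_submanifold[OF T.openin_flow_domain_slice] points_open_submanifold[OF B.openin_flow_domain_slice]
    by (simp_all add: restrict_bundle_def over)
  show "bundle_morphism (restrict_bundle E {x. (t, x) \<in> flow_domain (base E) X})
    (restrict_bundle E {x. (- t, x) \<in> flow_domain (base E) X}) (flow (tot E) Y t) (flow (base E) X t)"
    by (rule bundle_morphism_flow)
  show "bundle_morphism (restrict_bundle E {x. (- t, x) \<in> flow_domain (base E) X})
    (restrict_bundle E {x. (t, x) \<in> flow_domain (base E) X}) (flow (tot E) Y (- t)) (flow (base E) X (- t))"
    using bundle_morphism_flow[of "- t"] by simp
  show "flow (tot E) Y (- t) (flow (tot E) Y t e) = e"
    if "e \<in> points (tot (restrict_bundle E {x. (t, x) \<in> flow_domain (base E) X}))" for e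
    using that T.flow_inverse(2) by (simp add: pts)
  show "flow (tot E) Y t (flow (tot E) Y (- t) e) = e"
    if "e \<in> points (tot (restrict_bundle E {x. (- t, x) \<in> flow_domain (base E) X}))" for e
    using that T.flow_inverse(2)[of "- t" e] by (simp add: pts)
  show "flow (base E) X (- t) (flow (base E) X t x) = x"
    if "x \<in> points (base (restrict_bundle E {x. (t, x) \<in> flow_domain (base E) X}))" for x
    using that B.flow_inverse(2) by (simp add: pts)
  show "flow (base E) X t (flow (base E) X (- t) x) = x"
    if "x \<in> points (base (restrict_bundle E {x. (- t, x) \<in> flow_domain (base E) X}))" for x
    using that B.flow_inverse(2)[of "- t" x] by (simp add: pts)
qed

end

theorem theorem1:
  fixes E :: "('b, 'e::fin_dim_inner, 'a, 'm::fin_dim_inner, 'f::fin_dim_inner) vbundle"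
    and X :: "'a \<Rightarrow> ('a, 'm) tangent" and Y :: "'b \<Rightarrow> ('b, 'e) tangent"
    and \<Omega> :: "(real \<times> 'a) set" and \<phi> :: "real \<Rightarrow> 'a \<Rightarrow> 'a" and \<Phi> :: "real \<Rightarrow> 'b \<Rightarrow> 'b"
    and Mt :: "real \<Rightarrow> 'a set"
  assumes "smooth_vector_bundle E"
    and "vector_field (base E) X"
    and "linear_vector_field E X Y"
    and "\<Omega> = flow_domain (base E) X"
    and "\<phi> = flow (base E) X"
    and "\<Phi> = flow (tot E) Y"
    and "\<And>t. Mt t = {x \<in> points (base E). (t, x) \<in> \<Omega>}"
  shows "openin (prod_topology euclideanreal (mtop (base E))) \<Omega> \<and>
    {0} \<times> points (base E) \<subseteq> \<Omega> \<and>
    flow_domain (tot E) Y = {(t, e). e \<in> points (tot E) \<and> (t, proj E e) \<in> \<Omega>} \<and>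
    (\<forall>t. openin (mtop (base E)) (Mt t) \<and>
      diffeomorphism (open_submanifold (base E) (Mt t)) (open_submanifold (base E) (Mt (- t))) (\<phi> t) \<and>
      bundle_isomorphism (restrict_bundle E (Mt t)) (restrict_bundle E (Mt (- t))) (\<Phi> t) (\<phi> t))"
proof -
  interpret linear_vfield E X Y using assms(1,3) by unfold_locales
  have Mt: "Mt t = {x. (t, x) \<in> flow_domain (base E) X}" for t
    using assms(4,7) B.flow_in_points(1) by auto
  show ?thesis
    unfolding assms(4-6) Mt
    using B.openin_flow_domain B.flow_0(1) flow_domain_tot B.openin_flow_domain_slice
      B.diffeomorphism_flow bundle_isomorphism_flow by auto
qed

end
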